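(* Let $u$ be a variational solution of the two-phase free boundary problem on $B_1$ and for $0<r<1$ define $$\mathcal{M}(u;r)=\frac1{r^3}\int_{B_r}\Big(|\nabla u|^2-y(\rho_+\chi^+(u)+\rho_-\chi^-(u))\Big)dx\,dy-\frac32\frac1{r^4}\int_{\partial B_r}u^2\,d\mathcal{H}^1.$$ Then $\mathcal{M}(u;\cdot)$ is differentiable almost everywhere with $$\partial_r\mathcal{M}(u;r)=\frac2{r^3}\int_{\partial B_r}\Big(\nabla u\cdot\nu-\frac32\frac ur\Big)^2d\mathcal{H}^1,$$ where $\nu$ is the outward unit normal to $\partial B_r$.
   Context: $B_r$ is the open disk of radius $r$ centered at $0$; $\mathcal{H}^1$ is one-dimensional Hausdorff measure. Let $\rho_+\neq\rho_-$ be positive constants. For $u\in C^0(B_1)$: $\Omega^+(u)=\operatorname{int}\{u\ge0\}$, $\Omega^-(u)=\{u<0\}$, $u_\pm=u$ on $\Omega^\pm(u)$ and $0$ on $\Omega^\mp(u)$, $\chi^\pm(u)$ the indicator of $\Omega^\pm(u)$. A variational solution is $u\in H^1(B_1)\cap C^0(B_1)$ with $u_\pm\in C^2(\Omega^\pm(u))$ such that for all $\phi\in C^1_0(B_1;\mathbb{R}^2)$: $0=\int_{B_1}\big(|\nabla u|^2\nabla\cdot\phi-2D\phi[\nabla u,\nabla u]-(\rho_+\chi^+(u)+\rho_-\chi^-(u))\nabla\cdot(y\phi)\big)dx\,dy$. *)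

theory Defs
  imports "HOL-Analysis.Analysis"
begin

type_synonym pt = "real \<times> real"   (* a point (x,y) of the plane; y = snd *)

definition C1c_on :: "pt set \<Rightarrow> (pt \<Rightarrow> 'b::real_normed_vector) \<Rightarrow> bool" where
  "C1c_on S \<phi> \<longleftrightarrow>
     (\<exists>D :: pt \<Rightarrow> (pt \<Rightarrow>\<^sub>L 'b). (\<forall>x. (\<phi> has_derivative blinfun_apply (D x)) (at x))
          \<and> continuous_on UNIV D)
     \<and> compact (closure {x. \<phi> x \<noteq> 0}) \<and> closure {x. \<phi> x \<noteq> 0} \<subseteq> S"

definition C2_on :: "pt set \<Rightarrow> (pt \<Rightarrow> real) \<Rightarrow> bool" where
  "C2_on S f \<longleftrightarrow>
     (\<exists>(Df :: pt \<Rightarrow> (pt \<Rightarrow>\<^sub>L real)) (D2f :: pt \<Rightarrow> (pt \<Rightarrow>\<^sub>L (pt \<Rightarrow>\<^sub>L real))).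
        (\<forall>x\<in>S. (f has_derivative blinfun_apply (Df x)) (at x)
               \<and> (Df has_derivative blinfun_apply (D2f x)) (at x))
        \<and> continuous_on S D2f)"

definition weak_gradient_on :: "pt set \<Rightarrow> (pt \<Rightarrow> real) \<Rightarrow> (pt \<Rightarrow> pt) \<Rightarrow> bool" where
  "weak_gradient_on S u G \<longleftrightarrow>
     set_integrable lborel S u \<and> set_integrable lborel S G \<and>
     (\<forall>\<psi> :: pt \<Rightarrow> real. C1c_on S \<psi> \<longrightarrow>
        (\<forall>v\<in>Basis. (LINT x:S|lborel. u x * frechet_derivative \<psi> (at x) v)
                    = - (LINT x:S|lborel. (G x \<bullet> v) * \<psi> x)))"

definition H1_with_gradient :: "pt set \<Rightarrow> (pt \<Rightarrow> real) \<Rightarrow> (pt \<Rightarrow> pt) \<Rightarrow> bool" where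
  "H1_with_gradient S u G \<longleftrightarrow>
     set_integrable lborel S (\<lambda>x. (u x)\<^sup>2) \<and> set_integrable lborel S (\<lambda>x. (norm (G x))\<^sup>2)
     \<and> weak_gradient_on S u G"

definition divergence :: "(pt \<Rightarrow> pt) \<Rightarrow> pt \<Rightarrow> real" where
  "divergence \<phi> x = fst (frechet_derivative \<phi> (at x) (1,0)) + snd (frechet_derivative \<phi> (at x) (0,1))"

definition B1 :: "pt set" where "B1 = ball 0 1"

definition Omega_plus :: "(pt \<Rightarrow> real) \<Rightarrow> pt set" where
  "Omega_plus u = interior {x\<in>B1. u x \<ge> 0}"

definition Omega_minus :: "(pt \<Rightarrow> real) \<Rightarrow> pt set" where
  "Omega_minus u = {x\<in>B1. u x < 0}"

definition rho_chi :: "real \<Rightarrow> real \<Rightarrow> (pt \<Rightarrow> real) \<Rightarrow> pt \<Rightarrow> real" where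
  "rho_chi \<rho>p \<rho>m u x = \<rho>p * indicator (Omega_plus u) x + \<rho>m * indicator (Omega_minus u) x"

definition variational_solution ::
  "real \<Rightarrow> real \<Rightarrow> (pt \<Rightarrow> real) \<Rightarrow> (pt \<Rightarrow> pt) \<Rightarrow> bool" where
  "variational_solution \<rho>p \<rho>m u G \<longleftrightarrow>
     H1_with_gradient B1 u G \<and> continuous_on B1 u \<and>
     C2_on (Omega_plus u) u \<and> C2_on (Omega_minus u) u \<and>
     (\<forall>\<phi> :: pt \<Rightarrow> pt. C1c_on B1 \<phi> \<longrightarrow>
        0 = (LINT x:B1|lborel.
               (norm (G x))\<^sup>2 * divergence \<phi> x
               - 2 * (G x \<bullet> frechet_derivative \<phi> (at x) (G x))
               - rho_chi \<rho>p \<rho>m u x * divergence (\<lambda>p. snd p *\<^sub>R \<phi> p) x))"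

text \<open>Integral over the circle of radius r (w.r.t. H^1), via arc-length parametrisation.\<close>
definition circle_integral :: "real \<Rightarrow> (pt \<Rightarrow> real) \<Rightarrow> real" where
  "circle_integral r f = (LINT \<theta>:{0..2*pi}|lborel. f (r * cos \<theta>, r * sin \<theta>) * r)"

definition Mfun :: "real \<Rightarrow> real \<Rightarrow> (pt \<Rightarrow> real) \<Rightarrow> (pt \<Rightarrow> pt) \<Rightarrow> real \<Rightarrow> real" where
  "Mfun \<rho>p \<rho>m u G r =
     1 / r^3 * (LINT x:ball 0 r|lborel. (norm (G x))\<^sup>2 - snd x * rho_chi \<rho>p \<rho>m u x)
     - 3/2 * (1 / r^4) * circle_integral r (\<lambda>x. (u x)\<^sup>2)"

end

theory Submission
  imports Defs
begin

text \<open>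
  On the open set \<open>P = {u \<noteq> 0}\<close> the solution is \<open>C\<^sup>2\<close>, its weak gradient \<open>G\<close> is the classical
  gradient \<open>F\<close>, and testing the variational identity with \<open>\<phi> = \<zeta> F\<close> gives \<open>\<bar>F\<bar>\<^sup>2 \<Delta>u = 0\<close>, hence \<open>\<Delta>u = 0\<close>.
  Replacing \<open>u\<close> by truncations \<open>T\<^sub>n(u)\<close> that vanish near \<open>{u = 0}\<close> makes every integration by parts
  classical; the limit \<open>n \<rightarrow> \<infinity>\<close> gives \<open>G = 0\<close> a.e. on \<open>{u = 0}\<close> and, for radial cutoffs \<open>\<eta>\<close>, the
  identities \<open>\<integral>\<nabla>u \<cdot> \<nabla>(u \<eta>) = 0\<close> and \<open>\<integral>div(u\<^sup>2 \<eta> x) = 0\<close>. The variational identity with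
  \<open>\<phi> = \<eta> x\<close> is a third one. Each has the form \<open>\<integral>\<eta>(\<bar>x\<bar>) p + \<eta>'(\<bar>x\<bar>) q = 0\<close>, which in polar
  coordinates says that \<open>\<integral> q\<close> over \<open>\<partial>B\<^sub>r\<close> equals \<open>\<integral> p\<close> over \<open>B\<^sub>r\<close> for almost every \<open>r\<close>. The formula
  follows by Lebesgue differentiation of the ball integrals and elementary algebra.
\<close>

section \<open>Lebesgue differentiation\<close>

text \<open>The obstacle is the free boundary: neither the regularity nor the measure of
  \<open>{u = 0}\<close> is known, so no integration by parts may reach it and no interface term can
  be computed. All classical calculus takes place on compact subsets of \<open>P\<close>, where
  \<rho> is locally constant, since it jumps only on the zero set. From |F|^2 times the Laplacian
  being 0 the Laplacian itself vanishes, because F = 0 on an open set forces the derivatives of F to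
  vanish there. The weak gradient \<open>G\<close> is determined only up to null sets, so its circle
  integrals are controlled for almost every radius only. The boundary term of \<open>Mfun\<close>
  has to be differentiated, hence known at all radii near r; its identity is therefore upgraded from
  almost every to every radius by continuity. The power r^-3 matches div (y x) = 3 y, which makes
  the terms with y \<rho> cancel in the derivative, and 3/2 is the degree of homogeneity for which
  the final square vanishes.\<close>

lemma lebesgue_points_cubes:
  fixes f :: "'a::euclidean_space \<Rightarrow> 'b::euclidean_space"
  assumes "\<And>a b. f integrable_on cbox a b"
  shows "AE x in lborel. \<forall>e>0. \<exists>d>0. \<forall>h. 0 < h \<and> h < d \<longrightarrow>
           norm (integral (cbox x (x + h *\<^sub>R One)) f /\<^sub>R h ^ DIM('a) - f x) < e"
proof (rule integrable_ccontinuous_explicit[OF assms])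
  fix N assume N: "negligible N" and *: "\<And>x e. \<lbrakk>x \<notin> N; 0 < e\<rbrakk> \<Longrightarrow> \<exists>d>0. \<forall>h. 0 < h \<and> h < d \<longrightarrow>
           norm (integral (cbox x (x + h *\<^sub>R One)) f /\<^sub>R h ^ DIM('a) - f x) < e"
  have "AE x in lebesgue. x \<notin> N"
    using N by (intro AE_not_in) (simp add: negligible_iff_null_sets)
  then have "AE x in lebesgue. \<forall>e>0. \<exists>d>0. \<forall>h. 0 < h \<and> h < d \<longrightarrow>
           norm (integral (cbox x (x + h *\<^sub>R One)) f /\<^sub>R h ^ DIM('a) - f x) < e"
    by (rule eventually_mono) (use * in blast)
  then show ?thesis by (simp only: AE_completion_iff)
qed

text \<open>An open set is a countable union of closed boxes. On one such box extend
  \<open>h\<close> by 0: since the intersection of two boxes is a box, the extension has integral 0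
  over every box of the space, so all its cube averages are 0 and it vanishes at each Lebesgue
  point.\<close>

lemma AE_zero_of_integral_cbox_zero:
  fixes h :: "'a::euclidean_space \<Rightarrow> real"
  assumes "open U"
    and int: "\<And>a b. cbox a b \<subseteq> U \<Longrightarrow> set_integrable lborel (cbox a b) h"
    and zero: "\<And>a b. cbox a b \<subseteq> U \<Longrightarrow> (LINT x:cbox a b|lborel. h x) = 0"
  shows "AE x in lborel. x \<in> U \<longrightarrow> h x = 0"
proof -
  obtain \<D> where \<D>: "countable \<D>" "\<D> \<subseteq> Pow U" "\<And>X. X \<in> \<D> \<Longrightarrow> \<exists>a b. X = cbox a b" "\<Union>\<D> = U"
    using open_countable_Union_open_cbox[OF \<open>open U\<close>] by blast
  have "AE x in lborel. x \<in> X \<longrightarrow> h x = 0" if XD: "X \<in> \<D>" for X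
  proof -
    obtain a b where X: "X = cbox a b" using \<D>(3)[OF XD] by blast
    have XU: "cbox a b \<subseteq> U" using \<D>(2) XD X by blast
    define f where "f = (\<lambda>x. if x \<in> cbox a b then h x else 0)"
    have f0: "(f has_integral 0) (cbox c d)" for c d
    proof -
      obtain p q where pq: "cbox a b \<inter> cbox c d = cbox p q"
        using Int_interval by blast
      have "cbox p q \<subseteq> U" using pq XU by blast
      then have "set_integrable lborel (cbox p q) h" "(LINT x:cbox p q|lborel. h x) = 0"
        using int zero by blast+
      then have "(h has_integral 0) (cbox p q)"
        by (metis has_integral_integral set_borel_integral_eq_integral)
      then have "((\<lambda>x. if x \<in> cbox p q then h x else 0) has_integral 0) UNIV"
        by (simp add: has_integral_restrict_UNIV)
      moreover have "(\<lambda>x. if x \<in> cbox p q then h x else 0) = (\<lambda>x. if x \<in> cbox c d then f x else 0)"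
        using pq by (auto simp: f_def fun_eq_iff)
      ultimately show ?thesis by (simp add: has_integral_restrict_UNIV)
    qed
    then have "\<And>c d. f integrable_on cbox c d" by blast
    from lebesgue_points_cubes[OF this] show ?thesis
    proof (rule eventually_mono)
      fix x assume x: "\<forall>e>0. \<exists>d>0. \<forall>h. 0 < h \<and> h < d \<longrightarrow>
           norm (integral (cbox x (x + h *\<^sub>R One)) f /\<^sub>R h ^ DIM('a) - f x) < e"
      have "f x = 0"
      proof (rule ccontr)
        assume "f x \<noteq> 0"
        then have "norm (f x) > 0" by simp
        with x obtain d where d: "d>0" "\<forall>h. 0 < h \<and> h < d \<longrightarrow>
            norm(integral (cbox x (x + h *\<^sub>R One)) f /\<^sub>R h ^ DIM('a) - f x) < norm (f x)"
          by meson
        have "integral (cbox x (x + (d/2) *\<^sub>R One)) f = 0"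
          using f0 by (rule integral_unique)
        with d(1) d(2)[rule_format, of "d/2"] show False by simp
      qed
      then show "x \<in> X \<longrightarrow> h x = 0" by (auto simp: f_def X)
    qed
  qed
  then have "AE x in lborel. \<forall>X\<in>\<D>. x \<in> X \<longrightarrow> h x = 0"
    by (subst AE_ball_countable[OF \<D>(1)]) simp
  then show ?thesis
    using \<D>(4) by (auto elim!: eventually_mono)
qed

text \<open>The averaging cubes have x as their lower corner, so they control only the right
  difference quotients. The left ones come from the same result for the reflected function,
  transported back through the invariance of Lebesgue measure under negation. The restriction to x >
  0 keeps \<open>{0..x}\<close> a genuine interval, as the set integral carries no
  orientation.\<close>

lemma lebesgue_differentiation_real:
  fixes f :: "real \<Rightarrow> real"
  assumes f: "integrable lborel f"
  shows "AE x in lborel. x > 0 \<longrightarrow> ((\<lambda>x. LINT t:{0..x}|lborel. f t) has_real_derivative f x) (at x)"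
proof -
  have fi: "(LINT t:{a..b}|lborel. f t) = integral {a..b} f" "f integrable_on {a..b}" for a b
  proof -
    have "set_integrable lborel {a..b} f"
      unfolding set_integrable_def using f by (intro integrable_mult_indicator) auto
    then show "(LINT t:{a..b}|lborel. f t) = integral {a..b} f" "f integrable_on {a..b}"
      using set_borel_integral_eq_integral by blast+
  qed
  have gi: "(\<lambda>x. f (- x)) integrable_on {a..b}" for a b :: real
    using fi(2)[of "-b" "-a"] Henstock_Kurzweil_Integration.integrable_reflect_real[where f=f and a="-b" and b="-a"] by simp
  have 1: "AE x in lborel. \<forall>e>0. \<exists>d>0. \<forall>h. 0 < h \<and> h < d \<longrightarrow> \<bar>integral {x..x + h} f / h - f x\<bar> < e"
    using lebesgue_points_cubes[of f] fi by (simp add: field_simps)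
  have "AE x in lborel. \<forall>e>0. \<exists>d>0. \<forall>h. 0 < h \<and> h < d \<longrightarrow>
      \<bar>integral {x..x + h} (\<lambda>x. f (- x)) / h - f (- x)\<bar> < e"
    using lebesgue_points_cubes[of "\<lambda>x. f (- x)"] gi by (simp add: field_simps)
  then have 2: "AE x in lborel. \<forall>e>0. \<exists>d>0. \<forall>h. 0 < h \<and> h < d \<longrightarrow>
      \<bar>integral {-x..-x + h} (\<lambda>x. f (- x)) / h - f x\<bar> < e"
    by (subst (asm) lborel_distr_uminus[symmetric], drule_tac AE_distrD[rotated]) simp_all
  from 1 2 show ?thesis
  proof eventually_elim
    case (elim x)
    have "((\<lambda>x. integral {0..x} f) has_real_derivative f x) (at x)" if x: "x > 0"
      unfolding DERIV_def LIM_eq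
    proof (intro allI impI)
      fix e :: real assume "e > 0"
      obtain d where d: "d>0" "\<forall>h. 0 < h \<and> h < d \<longrightarrow> \<bar>integral {x..x + h} f / h - f x\<bar> < e"
        using elim(1) \<open>e > 0\<close> by meson
      obtain d' where d': "d'>0" "\<forall>h. 0 < h \<and> h < d' \<longrightarrow>
          \<bar>integral {-x..-x + h} (\<lambda>x. f (- x)) / h - f x\<bar> < e"
        using elim(2) \<open>e > 0\<close> by meson
      have "norm ((integral {0..x+h} f - integral {0..x} f) / h - f x) < e"
        if h: "h \<noteq> 0" "norm h < min x (min d d')" for h
      proof (cases "h > 0")
        case True
        have "integral {0..x} f + integral {x..x+h} f = integral {0..x+h} f"
          using x True fi by (intro Henstock_Kurzweil_Integration.integral_combine) auto
        then have "integral {0..x+h} f - integral {0..x} f = integral {x..x+h} f" by simp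
        with d(2)[rule_format, of h] True h show ?thesis by auto
      next
        case False
        have "integral {0..x+h} f + integral {x+h..x} f = integral {0..x} f"
          using x False h fi by (intro Henstock_Kurzweil_Integration.integral_combine) auto
        moreover have "integral {-x..-x + (-h)} (\<lambda>x. f (- x)) = integral {x+h..x} f"
          using Henstock_Kurzweil_Integration.integral_reflect_real[of x "x+h" f] by (simp add: add.commute)
        ultimately have "(integral {0..x+h} f - integral {0..x} f) / h
            = integral {-x..-x + (-h)} (\<lambda>x. f (- x)) / (-h)"
          by (metis add_diff_cancel_left' minus_diff_eq minus_divide_divide minus_minus)
        with d'(2)[rule_format, of "-h"] False h show ?thesis by auto
      qed
      with x d d' show "\<exists>s>0. \<forall>h. h \<noteq> 0 \<and> norm (h - 0) < s \<longrightarrow>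
          norm ((integral {0..x+h} f - integral {0..x} f) / h - f x) < e"
        by (intro exI[of _ "min x (min d d')"]) auto
    qed
    then show ?case by (simp add: fi)
  qed
qed

section \<open>Polar coordinates\<close>

text \<open>Lebesgue measure on the line is the image under cot of the measure with density 1 /
  sin^2 on (0, pi). It suffices to compare the two on intervals, where -cot is a primitive of the
  density.\<close>

lemma nn_integral_cot:
  fixes g :: "real \<Rightarrow> ennreal"
  assumes [measurable]: "g \<in> borel_measurable borel"
  shows "(\<integral>\<^sup>+s. g s \<partial>lborel)
    = (\<integral>\<^sup>+\<theta>. ennreal (indicator {0<..<pi} \<theta> / (sin \<theta>)\<^sup>2) * g (cos \<theta> / sin \<theta>) \<partial>lborel)"
proof -
  let ?w = "\<lambda>\<theta>. ennreal (indicator {0<..<pi} \<theta> / (sin \<theta>)\<^sup>2)"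
  let ?c = "\<lambda>\<theta>::real. cos \<theta> / sin \<theta>"
  have "lborel = distr (density lborel ?w) borel ?c"
  proof (rule lborel_eqI)
    fix l u :: real assume "\<And>b. b \<in> Basis \<Longrightarrow> l \<bullet> b \<le> u \<bullet> b"
    then have lu: "l \<le> u" by simp
    \<comment> \<open>These are the arccotangents of \<open>u\<close> and \<open>l\<close>; since
      cot decreases, the endpoints change places.\<close>
    define a b where "a = pi/2 - arctan u" and "b = pi/2 - arctan l"
    have ab: "a \<le> b" "0 < a" "b < pi"
      using lu arctan_ubound[of u] arctan_lbound[of l] arctan_le_iff[of l u] by (auto simp: a_def b_def)
    have eq: "l < ?c \<theta> \<and> ?c \<theta> < u \<longleftrightarrow> \<theta> \<in> {a<..<b}" if "\<theta> \<in> {0<..<pi}" for \<theta>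
    proof -
      have "?c \<theta> = tan (pi/2 - \<theta>)" by (simp add: tan_def sin_diff cos_diff)
      moreover have "arctan (tan (pi/2 - \<theta>)) = pi/2 - \<theta>"
        using that by (intro arctan_tan) auto
      ultimately have "arctan (?c \<theta>) = pi/2 - \<theta>" by simp
      then show ?thesis
        using arctan_less_iff[of l "?c \<theta>"] arctan_less_iff[of "?c \<theta>" u] by (auto simp: a_def b_def)
    qed
    have "emeasure (distr (density lborel ?w) borel ?c) (box l u)
        = (\<integral>\<^sup>+\<theta>. ?w \<theta> * indicator (?c -` {l<..<u}) \<theta> \<partial>lborel)"
      by (simp add: emeasure_distr box_real, subst emeasure_density)
         (simp_all add: measurable_sets_borel[of ?c borel "{l<..<u}"])
    also have "\<dots> = (\<integral>\<^sup>+\<theta>. ennreal (1 / (sin \<theta>)\<^sup>2) * indicator {a..b} \<theta> \<partial>lborel)"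
    proof (rule nn_integral_cong_AE)
      have "AE \<theta> in lborel. \<theta> \<noteq> a \<and> \<theta> \<noteq> b"
        using AE_lborel_singleton[of a] AE_lborel_singleton[of b] by eventually_elim simp
      then show "AE \<theta> in lborel. ?w \<theta> * indicator (?c -` {l<..<u}) \<theta>
          = ennreal (1 / (sin \<theta>)\<^sup>2) * indicator {a..b} \<theta>"
      proof eventually_elim
        case (elim \<theta>)
        then show ?case using eq[of \<theta>] ab by (auto simp: indicator_def)
      qed
    qed
    also have "\<dots> = ennreal ((- ?c b) - (- ?c a))"
    proof (rule nn_integral_has_integral_lebesgue')
      show "((\<lambda>\<theta>. 1 / (sin \<theta>)\<^sup>2) has_integral (- ?c b) - (- ?c a)) {a..b}"
      proof (rule fundamental_theorem_of_calculus[OF ab(1)])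
        fix x assume "x \<in> {a..b}"
        then have "sin x > 0" using ab by (intro sin_gt_zero) auto
        then show "((\<lambda>x. - ?c x) has_vector_derivative 1 / (sin x)\<^sup>2) (at x within {a..b})"
          unfolding has_real_derivative_iff_has_vector_derivative[symmetric]
          by (auto intro!: derivative_eq_intros simp: field_simps power2_eq_square)
             (use sin_cos_squared_add3[of x] in algebra)
      qed
    qed simp
    also have "\<dots> = ennreal (u - l)"
      using tan_arctan[of l] tan_arctan[of u]
      by (simp add: a_def b_def cos_diff sin_diff tan_def)
    finally show "emeasure (distr (density lborel ?w) borel ?c) (box l u)
        = ennreal (\<Prod>b\<in>Basis. (u - l) \<bullet> b)" by simp
  qed simp
  then have "(\<integral>\<^sup>+s. g s \<partial>lborel) = (\<integral>\<^sup>+s. g s \<partial>distr (density lborel ?w) borel ?c)" by simp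
  also have "\<dots> = (\<integral>\<^sup>+\<theta>. ?w \<theta> * g (?c \<theta>) \<partial>lborel)"
    by (simp add: nn_integral_distr nn_integral_density)
  finally show ?thesis .
qed

text \<open>
  The substitution \<open>x = y cot \<theta>\<close> in the inner integral, followed by \<open>y = r sin \<theta>\<close> in the outer one,
  reduces polar coordinates to Tonelli and one-dimensional substitutions.
\<close>

lemma nn_integral_polar_upper:
  fixes f :: "real \<times> real \<Rightarrow> ennreal"
  assumes [measurable]: "f \<in> borel_measurable borel"
  shows "(\<integral>\<^sup>+y. (\<integral>\<^sup>+x. f (x, y) * indicator {0<..} y \<partial>lborel) \<partial>lborel)
    = (\<integral>\<^sup>+r. (\<integral>\<^sup>+\<theta>. f (r * cos \<theta>, r * sin \<theta>) * ennreal r * indicator {0<..<pi} \<theta> * indicator {0<..} r \<partial>lborel) \<partial>lborel)"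
proof -
  have [measurable]: "f \<in> borel_measurable (borel \<Otimes>\<^sub>M borel)"
    by (simp add: borel_prod)
  let ?w = "\<lambda>\<theta>. ennreal (indicator {0<..<pi} \<theta> / (sin \<theta>)\<^sup>2)"
  have 1: "(\<integral>\<^sup>+x. f (x, y) * indicator {0<..} y \<partial>lborel)
      = (\<integral>\<^sup>+\<theta>. ennreal y * indicator {0<..} y * ?w \<theta> * f (y * (cos \<theta> / sin \<theta>), y) \<partial>lborel)" for y
  proof (cases "y > 0")
    case True
    have "(\<integral>\<^sup>+x. f (x, y) \<partial>lborel) = ennreal y * (\<integral>\<^sup>+s. f (y * s, y) \<partial>lborel)"
      using nn_integral_real_affine[of "\<lambda>x. f (x, y)" y 0] True by simp
    also have "(\<integral>\<^sup>+s. f (y * s, y) \<partial>lborel) = (\<integral>\<^sup>+\<theta>. ?w \<theta> * f (y * (cos \<theta> / sin \<theta>), y) \<partial>lborel)"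
      by (rule nn_integral_cot) measurable
    finally show ?thesis using True by (simp add: nn_integral_cmult mult.assoc)
  qed simp
  have 2: "(\<integral>\<^sup>+y. ennreal y * indicator {0<..} y * ?w \<theta> * f (y * (cos \<theta> / sin \<theta>), y) \<partial>lborel)
      = (\<integral>\<^sup>+r. f (r * cos \<theta>, r * sin \<theta>) * ennreal r * indicator {0<..<pi} \<theta> * indicator {0<..} r \<partial>lborel)" for \<theta>
  proof (cases "\<theta> \<in> {0<..<pi}")
    case True
    then have s: "sin \<theta> > 0" by (auto intro: sin_gt_zero)
    have "(\<integral>\<^sup>+y. ennreal y * indicator {0<..} y * ?w \<theta> * f (y * (cos \<theta> / sin \<theta>), y) \<partial>lborel)
       = ennreal (sin \<theta>) * (\<integral>\<^sup>+r. ennreal (sin \<theta> * r) * indicator {0<..} (sin \<theta> * r) * ?w \<theta>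
            * f ((sin \<theta> * r) * (cos \<theta> / sin \<theta>), sin \<theta> * r) \<partial>lborel)"
      using nn_integral_real_affine[of "\<lambda>y. ennreal y * indicator {0<..} y * ?w \<theta> * f (y * (cos \<theta> / sin \<theta>), y)" "sin \<theta>" 0] s
      by simp
    also have "\<dots> = (\<integral>\<^sup>+r. ennreal (sin \<theta>) * (ennreal (sin \<theta> * r) * indicator {0<..} (sin \<theta> * r) * ?w \<theta>
            * f ((sin \<theta> * r) * (cos \<theta> / sin \<theta>), sin \<theta> * r)) \<partial>lborel)"
      by (subst nn_integral_cmult) auto
    also have "\<dots> = (\<integral>\<^sup>+r. f (r * cos \<theta>, r * sin \<theta>) * ennreal r * indicator {0<..<pi} \<theta> * indicator {0<..} r \<partial>lborel)"
    proof (rule nn_integral_cong)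
      fix r :: real
      show "ennreal (sin \<theta>) * (ennreal (sin \<theta> * r) * indicator {0<..} (sin \<theta> * r) * ?w \<theta>
            * f ((sin \<theta> * r) * (cos \<theta> / sin \<theta>), sin \<theta> * r))
         = f (r * cos \<theta>, r * sin \<theta>) * ennreal r * indicator {0<..<pi} \<theta> * indicator {0<..} r"
      proof (cases "r > 0")
        case r: True
        \<comment> \<open>The Jacobian: sin \<theta> from dy, y = r sin \<theta> from dx, and the
          weight 1 / sin^2 combine to r.\<close>
        have "ennreal (sin \<theta>) * (ennreal (sin \<theta> * r) * ennreal (1 / (sin \<theta>)\<^sup>2)) = ennreal r"
          using s r by (simp add: ennreal_mult[symmetric] field_simps power2_eq_square)
        then have "ennreal (sin \<theta>) * (ennreal (sin \<theta> * r) * ennreal (1 / (sin \<theta>)\<^sup>2) * c) = c * ennreal r" for c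
          by (metis mult.assoc mult.commute)
        then show ?thesis
          using True s r by (simp add: mult.commute[of "sin \<theta>" r])
      next
        case False
        then show ?thesis using s by (simp add: zero_less_mult_iff)
      qed
    qed
    finally show ?thesis .
  qed simp
  have "(\<integral>\<^sup>+y. (\<integral>\<^sup>+x. f (x, y) * indicator {0<..} y \<partial>lborel) \<partial>lborel)
     = (\<integral>\<^sup>+y. (\<integral>\<^sup>+\<theta>. ennreal y * indicator {0<..} y * ?w \<theta> * f (y * (cos \<theta> / sin \<theta>), y) \<partial>lborel) \<partial>lborel)"
    by (simp only: 1)
  also have "\<dots> = (\<integral>\<^sup>+\<theta>. (\<integral>\<^sup>+y. ennreal y * indicator {0<..} y * ?w \<theta> * f (y * (cos \<theta> / sin \<theta>), y) \<partial>lborel) \<partial>lborel)"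
    by (rule lborel_pair.Fubini') measurable
  also have "\<dots> = (\<integral>\<^sup>+\<theta>. (\<integral>\<^sup>+r. f (r * cos \<theta>, r * sin \<theta>) * ennreal r * indicator {0<..<pi} \<theta> * indicator {0<..} r \<partial>lborel) \<partial>lborel)"
    by (simp only: 2)
  also have "\<dots> = (\<integral>\<^sup>+r. (\<integral>\<^sup>+\<theta>. f (r * cos \<theta>, r * sin \<theta>) * ennreal r * indicator {0<..<pi} \<theta> * indicator {0<..} r \<partial>lborel) \<partial>lborel)"
    by (rule lborel_pair.Fubini') measurable
  finally show ?thesis .
qed

text \<open>Reflection in the origin carries the lower half plane to the upper one and shifts the
  angle by pi. The line y = 0 and the angles 0, pi and 2 pi are null sets.\<close>

lemma nn_integral_polar:
  fixes f :: "real \<times> real \<Rightarrow> ennreal"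
  assumes [measurable]: "f \<in> borel_measurable borel"
  shows "(\<integral>\<^sup>+z. f z \<partial>lborel)
    = (\<integral>\<^sup>+r. (\<integral>\<^sup>+\<theta>. f (r * cos \<theta>, r * sin \<theta>) * ennreal r * indicator {0..2*pi} \<theta> * indicator {0<..} r \<partial>lborel) \<partial>lborel)"
proof -
  have [measurable]: "f \<in> borel_measurable (borel \<Otimes>\<^sub>M borel)"
    by (simp add: borel_prod)
  let ?I = "\<lambda>A r \<theta>. f (r * cos \<theta>, r * sin \<theta>) * ennreal r * indicator A \<theta> * indicator {0<..} r"
  have "(\<integral>\<^sup>+z. f z \<partial>lborel) = (\<integral>\<^sup>+y. (\<integral>\<^sup>+x. f (x, y) \<partial>lborel) \<partial>lborel)"
    by (simp add: lborel_prod[symmetric] lborel_pair.nn_integral_snd[symmetric] split: prod.split)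
  also have "\<dots> = (\<integral>\<^sup>+y. (\<integral>\<^sup>+x. f (x, y) * indicator {0<..} y \<partial>lborel)
        + (\<integral>\<^sup>+x. f (x, y) * indicator {0<..} (- y) \<partial>lborel) \<partial>lborel)"
    using AE_lborel_singleton[of "0::real"]
    by (intro nn_integral_cong_AE) (auto elim!: eventually_mono simp: indicator_def linorder_neq_iff)
  also have "\<dots> = (\<integral>\<^sup>+y. (\<integral>\<^sup>+x. f (x, y) * indicator {0<..} y \<partial>lborel) \<partial>lborel)
        + (\<integral>\<^sup>+y. (\<integral>\<^sup>+x. f (x, y) * indicator {0<..} (- y) \<partial>lborel) \<partial>lborel)"
    by (rule nn_integral_add) measurable
  also have "(\<integral>\<^sup>+y. (\<integral>\<^sup>+x. f (x, y) * indicator {0<..} (- y) \<partial>lborel) \<partial>lborel)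
      = (\<integral>\<^sup>+y. (\<integral>\<^sup>+x. f (- x, - y) * indicator {0<..} y \<partial>lborel) \<partial>lborel)"
  proof -
    have "(\<integral>\<^sup>+x. f (x, y) * indicator {0<..} (- y) \<partial>lborel)
        = (\<integral>\<^sup>+x. f (- x, y) * indicator {0<..} (- y) \<partial>lborel)" for y
      using nn_integral_real_affine[of "\<lambda>x. f (x, y) * indicator {0<..} (- y)" "-1" 0] by simp
    moreover have "(\<integral>\<^sup>+y. (\<integral>\<^sup>+x. f (- x, y) * indicator {0<..} (- y) \<partial>lborel) \<partial>lborel)
        = (\<integral>\<^sup>+y. (\<integral>\<^sup>+x. f (- x, - y) * indicator {0<..} y \<partial>lborel) \<partial>lborel)"
      using nn_integral_real_affine[of "\<lambda>y. \<integral>\<^sup>+x. f (- x, y) * indicator {0<..} (- y) \<partial>lborel" "-1" 0] by simp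
    ultimately show ?thesis by simp
  qed
  also have "\<dots> = (\<integral>\<^sup>+r. (\<integral>\<^sup>+\<theta>. f (- (r * cos \<theta>), - (r * sin \<theta>)) * ennreal r * indicator {0<..<pi} \<theta> * indicator {0<..} r \<partial>lborel) \<partial>lborel)"
  proof -
    have "(\<lambda>z. f (- fst z, - snd z)) \<in> borel_measurable (borel \<Otimes>\<^sub>M borel)" by measurable
    then show ?thesis
      using nn_integral_polar_upper[of "\<lambda>z. f (- fst z, - snd z)"] by (simp add: borel_prod)
  qed
  also have "\<dots> = (\<integral>\<^sup>+r. (\<integral>\<^sup>+\<theta>. ?I {pi<..<2*pi} r \<theta> \<partial>lborel) \<partial>lborel)"
  proof (rule nn_integral_cong)
    fix r :: real
    have "(\<integral>\<^sup>+\<theta>. ?I {pi<..<2*pi} r \<theta> \<partial>lborel) = (\<integral>\<^sup>+\<theta>. ?I {pi<..<2*pi} r (pi + \<theta>) \<partial>lborel)"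
      using nn_integral_real_affine[of "?I {pi<..<2*pi} r" 1 pi] by simp
    also have "\<dots> = (\<integral>\<^sup>+\<theta>. f (- (r * cos \<theta>), - (r * sin \<theta>)) * ennreal r * indicator {0<..<pi} \<theta> * indicator {0<..} r \<partial>lborel)"
      by (intro nn_integral_cong) (auto simp: indicator_def add.commute[of pi])
    finally show "(\<integral>\<^sup>+\<theta>. f (- (r * cos \<theta>), - (r * sin \<theta>)) * ennreal r * indicator {0<..<pi} \<theta> * indicator {0<..} r \<partial>lborel)
       = (\<integral>\<^sup>+\<theta>. ?I {pi<..<2*pi} r \<theta> \<partial>lborel)" by simp
  qed
  also have "(\<integral>\<^sup>+y. (\<integral>\<^sup>+x. f (x, y) * indicator {0<..} y \<partial>lborel) \<partial>lborel) = (\<integral>\<^sup>+r. (\<integral>\<^sup>+\<theta>. ?I {0<..<pi} r \<theta> \<partial>lborel) \<partial>lborel)"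
    by (rule nn_integral_polar_upper) measurable
  also have "(\<integral>\<^sup>+r. (\<integral>\<^sup>+\<theta>. ?I {0<..<pi} r \<theta> \<partial>lborel) \<partial>lborel) + (\<integral>\<^sup>+r. (\<integral>\<^sup>+\<theta>. ?I {pi<..<2*pi} r \<theta> \<partial>lborel) \<partial>lborel)
     = (\<integral>\<^sup>+r. (\<integral>\<^sup>+\<theta>. ?I {0<..<pi} r \<theta> \<partial>lborel) + (\<integral>\<^sup>+\<theta>. ?I {pi<..<2*pi} r \<theta> \<partial>lborel) \<partial>lborel)"
    by (rule nn_integral_add[symmetric]) measurable
  also have "\<dots> = (\<integral>\<^sup>+r. (\<integral>\<^sup>+\<theta>. ?I {0..2*pi} r \<theta> \<partial>lborel) \<partial>lborel)"
  proof (rule nn_integral_cong)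
    fix r :: real
    have "(\<integral>\<^sup>+\<theta>. ?I {0<..<pi} r \<theta> \<partial>lborel) + (\<integral>\<^sup>+\<theta>. ?I {pi<..<2*pi} r \<theta> \<partial>lborel)
       = (\<integral>\<^sup>+\<theta>. ?I {0<..<pi} r \<theta> + ?I {pi<..<2*pi} r \<theta> \<partial>lborel)"
      by (rule nn_integral_add[symmetric]) measurable
    also have "\<dots> = (\<integral>\<^sup>+\<theta>. ?I {0..2*pi} r \<theta> \<partial>lborel)"
    proof (rule nn_integral_cong_AE)
      have "AE \<theta> in lborel. \<theta> \<noteq> 0 \<and> \<theta> \<noteq> pi \<and> \<theta> \<noteq> 2*pi"
        using AE_lborel_singleton[of "0::real"] AE_lborel_singleton[of pi] AE_lborel_singleton[of "2*pi"]
        by eventually_elim simp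
      then show "AE \<theta> in lborel. ?I {0<..<pi} r \<theta> + ?I {pi<..<2*pi} r \<theta> = ?I {0..2*pi} r \<theta>"
        by eventually_elim (auto simp: indicator_def)
    qed
    finally show "(\<integral>\<^sup>+\<theta>. ?I {0<..<pi} r \<theta> \<partial>lborel) + (\<integral>\<^sup>+\<theta>. ?I {pi<..<2*pi} r \<theta> \<partial>lborel) = \<dots>" .
  qed
  finally show ?thesis .
qed

lemma integral_polar:
  fixes f :: "real \<times> real \<Rightarrow> real"
  assumes f: "integrable lborel f"
  shows "AE r in lborel. 0 < r \<longrightarrow> set_integrable lborel {0..2*pi} (\<lambda>\<theta>. f (r * cos \<theta>, r * sin \<theta>))"
    and "integrable lborel (\<lambda>r. indicator {0<..} r * circle_integral r f)"
    and "(\<integral>z. f z \<partial>lborel) = (\<integral>r. indicator {0<..} r * circle_integral r f \<partial>lborel)"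
proof -
  have fm [measurable]: "f \<in> borel_measurable borel" using f by simp
  let ?w = "\<lambda>z::real\<times>real. fst z * indicator {0..2*pi} (snd z) * indicator {0<..} (fst z)"
  let ?\<Phi> = "\<lambda>z::real\<times>real. (fst z * cos (snd z), fst z * sin (snd z))"
  have [measurable]: "?w \<in> borel_measurable borel" "?\<Phi> \<in> borel_measurable borel"
    by (simp_all add: borel_prod[symmetric])
  have w: "?w z \<ge> 0" for z by (auto simp: indicator_def)
  \<comment> \<open>Read as an equality of measures, the nonnegative formula carries over to signed
    integrands through the rules for image measures and densities; Fubini then gives integrability
    on almost every circle.\<close>
  have pol: "lborel = distr (density lborel ?w) borel ?\<Phi>"
  proof (rule measure_eqI)
    fix A :: "(real \<times> real) set" assume "A \<in> sets lborel"
    then have [measurable]: "A \<in> sets borel" by simp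
    have "emeasure lborel A = (\<integral>\<^sup>+z. indicator A z \<partial>lborel)" by simp
    also have "\<dots> = (\<integral>\<^sup>+r. (\<integral>\<^sup>+\<theta>. indicator A (r * cos \<theta>, r * sin \<theta>) * ennreal r * indicator {0..2*pi} \<theta> * indicator {0<..} r \<partial>lborel) \<partial>lborel)"
      by (rule nn_integral_polar) measurable
    also have "\<dots> = (\<integral>\<^sup>+r. (\<integral>\<^sup>+\<theta>. ennreal (?w (r, \<theta>)) * indicator A (?\<Phi> (r, \<theta>)) \<partial>lborel) \<partial>lborel)"
      by (intro nn_integral_cong) (auto simp: indicator_def)
    also have "\<dots> = (\<integral>\<^sup>+z. ennreal (?w z) * indicator A (?\<Phi> z) \<partial>lborel)"
      unfolding lborel_prod[symmetric] by (rule lborel.nn_integral_fst) (simp add: lborel_prod)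
    also have "\<dots> = (\<integral>\<^sup>+z. ennreal (?w z) * indicator (?\<Phi> -` A) z \<partial>lborel)"
      by (intro nn_integral_cong) (auto simp: indicator_def)
    also have "\<dots> = emeasure (distr (density lborel ?w) borel ?\<Phi>) A"
      by (simp add: emeasure_distr emeasure_density measurable_sets_borel[of ?\<Phi> borel A])
    finally show "emeasure lborel A = emeasure (distr (density lborel ?w) borel ?\<Phi>) A" .
  qed simp
  have "integrable (distr (density lborel ?w) borel ?\<Phi>) f"
    using f pol by simp
  then have "integrable (density lborel ?w) (\<lambda>z. f (?\<Phi> z))"
    by (simp add: integrable_distr_eq)
  then have I: "integrable lborel (\<lambda>z. ?w z * f (?\<Phi> z))"
    by (subst (asm) integrable_density) (simp_all add: w)
  have "(\<integral>z. f z \<partial>lborel) = (\<integral>z. f z \<partial>distr (density lborel ?w) borel ?\<Phi>)" using pol by simp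
  also have "\<dots> = (\<integral>z. f (?\<Phi> z) \<partial>density lborel ?w)"
    by (simp add: integral_distr)
  also have "\<dots> = (\<integral>z. ?w z * f (?\<Phi> z) \<partial>lborel)"
    by (subst integral_density) (simp_all add: w)
  finally have E: "(\<integral>z. f z \<partial>lborel) = (\<integral>z. ?w z * f (?\<Phi> z) \<partial>lborel)" .
  have c: "(\<integral>\<theta>. ?w (r, \<theta>) * f (?\<Phi> (r, \<theta>)) \<partial>lborel) = indicator {0<..} r * circle_integral r f" for r
    unfolding circle_integral_def set_lebesgue_integral_def
    by (simp flip: integral_mult_right_zero add: mult_ac)
  have I': "integrable (lborel \<Otimes>\<^sub>M lborel) (\<lambda>z. ?w z * f (?\<Phi> z))" using I by (simp add: lborel_prod)
  show "AE r in lborel. 0 < r \<longrightarrow> set_integrable lborel {0..2*pi} (\<lambda>\<theta>. f (r * cos \<theta>, r * sin \<theta>))"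
    using lborel_pair.AE_integrable_fst'[OF I']
  proof eventually_elim
    case (elim r)
    show ?case
    proof
      assume "0 < r"
      then have "(\<lambda>\<theta>. ?w (r, \<theta>) * f (?\<Phi> (r, \<theta>)))
         = (\<lambda>\<theta>. r * (indicator {0..2*pi} \<theta> *\<^sub>R f (r * cos \<theta>, r * sin \<theta>)))"
        by (auto simp: mult_ac)
      with elim \<open>0 < r\<close> show "set_integrable lborel {0..2*pi} (\<lambda>\<theta>. f (r * cos \<theta>, r * sin \<theta>))"
        unfolding set_integrable_def by simp
    qed
  qed
  show "integrable lborel (\<lambda>r. indicator {0<..} r * circle_integral r f)"
    using lborel_pair.integrable_fst'[OF I'] by (simp only: c)
  show "(\<integral>z. f z \<partial>lborel) = (\<integral>r. indicator {0<..} r * circle_integral r f \<partial>lborel)"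
    using lborel_pair.integral_fst'[OF I'] E by (simp only: c lborel_prod)
qed

section \<open>Compactly supported functions and the divergence theorem\<close>

text \<open>The gradient is an explicit vector field instead of a choice operator, so sums, products
  and compositions come with closed formulas for their gradients, and off \<open>S\<close> both
  arguments stay arbitrary.\<close>

definition C1_grad :: "pt set \<Rightarrow> (pt \<Rightarrow> real) \<Rightarrow> (pt \<Rightarrow> pt) \<Rightarrow> bool" where
  "C1_grad S f g \<longleftrightarrow> (\<forall>x\<in>S. (f has_derivative (\<lambda>h. g x \<bullet> h)) (at x)) \<and> continuous_on S g"

definition test_fun :: "pt set \<Rightarrow> (pt \<Rightarrow> real) \<Rightarrow> (pt \<Rightarrow> pt) \<Rightarrow> bool" where
  "test_fun S f g \<longleftrightarrow> C1_grad UNIV f g \<and> (\<exists>K. compact K \<and> K \<subseteq> S \<and> (\<forall>x. x \<notin> K \<longrightarrow> f x = 0))"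

lemma C1_gradD: "C1_grad S f g \<Longrightarrow> x \<in> S \<Longrightarrow> (f has_derivative (\<lambda>h. g x \<bullet> h)) (at x)"
  by (simp add: C1_grad_def)

lemma C1_grad_continuous_grad: "C1_grad S f g \<Longrightarrow> continuous_on S g"
  by (simp add: C1_grad_def)

lemma C1_grad_continuous: "C1_grad S f g \<Longrightarrow> continuous_on S f"
  by (meson C1_gradD continuous_at_imp_continuous_on has_derivative_continuous)

lemma C1_grad_subset: "C1_grad S f g \<Longrightarrow> T \<subseteq> S \<Longrightarrow> C1_grad T f g"
  by (auto simp: C1_grad_def intro: continuous_on_subset)

lemma C1_grad_fst: "C1_grad S fst (\<lambda>_. (1, 0))"
  by (auto simp: C1_grad_def inner_Pair_0 intro!: derivative_eq_intros)

lemma C1_grad_snd: "C1_grad S snd (\<lambda>_. (0, 1))"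
  by (auto simp: C1_grad_def inner_Pair_0 intro!: derivative_eq_intros)

lemma C1_grad_add:
  assumes "C1_grad S f g" "C1_grad S f' g'"
  shows "C1_grad S (\<lambda>x. f x + f' x) (\<lambda>x. g x + g' x)"
  using assms unfolding C1_grad_def
  by (auto intro!: derivative_eq_intros continuous_intros simp: inner_add_left)

lemma C1_grad_mult:
  assumes "C1_grad S f g" "C1_grad S f' g'"
  shows "C1_grad S (\<lambda>x. f x * f' x) (\<lambda>x. f x *\<^sub>R g' x + f' x *\<^sub>R g x)"
  using assms C1_grad_continuous[OF assms(1)] C1_grad_continuous[OF assms(2)] unfolding C1_grad_def
  by (auto intro!: derivative_eq_intros continuous_intros simp: inner_add_left)

lemma C1_grad_compose:
  assumes "C1_grad S f g" "\<And>t. (T has_real_derivative T' t) (at t)" "continuous_on UNIV T'"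
  shows "C1_grad S (\<lambda>x. T (f x)) (\<lambda>x. T' (f x) *\<^sub>R g x)"
  unfolding C1_grad_def
proof (intro conjI ballI)
  fix x assume "x \<in> S"
  then have "(f has_derivative (\<lambda>h. g x \<bullet> h)) (at x)" using assms(1) by (simp add: C1_gradD)
  then have "((\<lambda>x. T (f x)) has_derivative (\<lambda>h. T' (f x) * (g x \<bullet> h))) (at x)"
    using assms(2)[of "f x"] has_derivative_compose[of f _ x UNIV T "(*) (T' (f x))"]
    by (simp add: has_field_derivative_def)
  then show "((\<lambda>x. T (f x)) has_derivative (\<lambda>h. (T' (f x) *\<^sub>R g x) \<bullet> h)) (at x)"
    by simp
next
  show "continuous_on S (\<lambda>x. T' (f x) *\<^sub>R g x)"
    using C1_grad_continuous[OF assms(1)] C1_grad_continuous_grad[OF assms(1)]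
    by (intro continuous_on_scaleR continuous_on_compose2[OF assms(3)]) auto
qed

lemma inner_eq_zero_fun_imp_zero: "(\<lambda>h. g \<bullet> h) = (\<lambda>h. 0) \<Longrightarrow> g = (0::'a::real_inner)"
  by (metis inner_eq_zero_iff)

lemma C1_grad_eq_0_on_open:
  assumes "C1_grad S f g" "open V" "V \<subseteq> S" "\<And>x. x \<in> V \<Longrightarrow> f x = 0" "x \<in> V"
  shows "g x = 0"
proof -
  have "((\<lambda>x. 0) has_derivative (\<lambda>h. g x \<bullet> h)) (at x)"
    using has_derivative_transform_within_open[OF C1_gradD[OF assms(1)] assms(2,5), of "\<lambda>_. 0"] assms by auto
  then have "(\<lambda>h. g x \<bullet> h) = (\<lambda>h. 0)"
    using has_derivative_unique has_derivative_const by blast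
  then show ?thesis by (rule inner_eq_zero_fun_imp_zero)
qed

text \<open>The open sets \<open>S\<close> and \<open>- K\<close> cover the plane. On the first the
  extension is \<open>f\<close>, on the second it is locally 0, and on the overlap the gradient of
  \<open>f\<close> vanishes because \<open>f\<close> is 0 on an open set.\<close>

lemma C1_grad_extend:
  assumes f: "C1_grad S f g" and "open S" "compact K" "K \<subseteq> S" and z: "\<And>x. x \<in> S \<Longrightarrow> x \<notin> K \<Longrightarrow> f x = 0"
  shows "test_fun S (\<lambda>x. if x \<in> S then f x else 0) (\<lambda>x. if x \<in> S then g x else 0)"
    (is "test_fun S ?f ?g")
proof -
  have oK: "open (- K)" using \<open>compact K\<close> compact_imp_closed by blast
  have gz: "g x = 0" if "x \<in> S" "x \<notin> K" for x
    by (rule C1_grad_eq_0_on_open[OF f, of "S - K"]) (use that z \<open>open S\<close> \<open>compact K\<close> in \<open>auto intro: compact_imp_closed\<close>)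
  have "(?f has_derivative (\<lambda>h. ?g x \<bullet> h)) (at x)" for x
  proof (cases "x \<in> S")
    case True
    then show ?thesis
      using has_derivative_transform_within_open[OF C1_gradD[OF f True] \<open>open S\<close>, of ?f] by simp
  next
    case False
    then have "x \<in> - K" using \<open>K \<subseteq> S\<close> by blast
    then show ?thesis
      using has_derivative_transform_within_open[OF has_derivative_const oK, of x 0 ?f] z False by auto
  qed
  moreover have "continuous_on (S \<union> - K) ?g"
  proof (rule continuous_on_open_Un[OF \<open>open S\<close> oK])
    show "continuous_on S ?g"
      using C1_grad_continuous_grad[OF f] by (auto intro: continuous_on_eq)
    show "continuous_on (- K) ?g"
      by (rule continuous_on_eq[of _ "\<lambda>_. 0"]) (use gz in auto)
  qed
  moreover have "S \<union> - K = UNIV" using \<open>K \<subseteq> S\<close> by blast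
  ultimately have "C1_grad UNIV ?f ?g" by (simp add: C1_grad_def)
  moreover have "\<forall>x. x \<notin> K \<longrightarrow> ?f x = 0" using z by auto
  ultimately show ?thesis using assms(3,4) unfolding test_fun_def by blast
qed

lemma test_funD:
  assumes "test_fun S f g"
  obtains K where "compact K" "K \<subseteq> S" "\<And>x. x \<notin> K \<Longrightarrow> f x = 0" "\<And>x. x \<notin> K \<Longrightarrow> g x = 0"
proof -
  obtain K where K: "compact K" "K \<subseteq> S" "\<And>x. x \<notin> K \<Longrightarrow> f x = 0" and f: "C1_grad UNIV f g"
    using assms by (auto simp: test_fun_def)
  have "g x = 0" if "x \<notin> K" for x
    by (rule C1_grad_eq_0_on_open[OF f, of "- K"]) (use that K in \<open>auto intro: compact_imp_closed\<close>)
  with K that show thesis by blast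
qed

lemma test_fun_mono: "test_fun S f g \<Longrightarrow> S \<subseteq> T \<Longrightarrow> test_fun T f g"
  unfolding test_fun_def by blast

lemma integrable_continuous_compact_support:
  fixes f :: "'a::euclidean_space \<Rightarrow> 'b::{banach, second_countable_topology}"
  assumes "continuous_on UNIV f" "compact K" "\<And>x. x \<notin> K \<Longrightarrow> f x = 0"
  shows "integrable lborel f"
proof -
  have "integrable lborel (\<lambda>x. indicator K x *\<^sub>R f x)"
    using assms by (intro borel_integrable_compact) (auto intro: continuous_on_subset)
  moreover have "(\<lambda>x. indicator K x *\<^sub>R f x) = f"
    using assms(3) by (auto simp: indicator_def)
  ultimately show ?thesis by simp
qed

lemma integral_derivative_compact_support:
  fixes F f :: "real \<Rightarrow> real"
  assumes "\<And>t. (F has_real_derivative f t) (at t)" "continuous_on UNIV f"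
    and "\<And>t. \<bar>t\<bar> \<ge> R \<Longrightarrow> F t = 0" "\<And>t. \<bar>t\<bar> \<ge> R \<Longrightarrow> f t = 0" "R > 0"
  shows "(\<integral>t. f t \<partial>lborel) = 0"
proof -
  have "(\<integral>t. indicator {-R..R} t *\<^sub>R f t \<partial>lborel) = F R - F (-R)"
    using assms by (intro integral_FTC_Icc)
      (auto simp: has_real_derivative_iff_has_vector_derivative[symmetric]
         intro: has_field_derivative_at_within continuous_on_subset)
  moreover have "(\<lambda>t. indicator {-R..R} t *\<^sub>R f t) = f"
  proof
    fix t show "indicator {-R..R} t *\<^sub>R f t = f t"
      using assms(4)[of t] by (cases "R \<le> \<bar>t\<bar>") (auto simp: indicator_def)
  qed
  ultimately show ?thesis using assms by simp
qed

text \<open>Along each coordinate line the partial derivative integrates to 0, because the function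
  vanishes at both ends; Fubini does the rest.\<close>

lemma test_fun_integral_grad:
  assumes "test_fun S f g"
  shows "integrable lborel g" "(\<integral>x. fst (g x) \<partial>lborel) = 0" "(\<integral>x. snd (g x) \<partial>lborel) = 0"
proof -
  obtain K where K: "compact K" "\<And>x. x \<notin> K \<Longrightarrow> f x = 0" "\<And>x. x \<notin> K \<Longrightarrow> g x = 0"
    using test_funD[OF assms] by metis
  have f: "C1_grad UNIV f g" using assms by (simp add: test_fun_def)
  have cg: "continuous_on UNIV g" using f by (rule C1_grad_continuous_grad)
  show ig: "integrable lborel g"
    using integrable_continuous_compact_support[OF cg K(1,3)] by simp
  obtain R where R: "R > 0" "\<And>x. x \<in> K \<Longrightarrow> norm x < R"
    using compact_imp_bounded[OF K(1)] bounded_pos_less by blast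
  have far: "(x, y) \<notin> K" if "R \<le> \<bar>x\<bar> \<or> R \<le> \<bar>y\<bar>" for x y
    using R(2)[of "(x, y)"] norm_fst_le[of x y] norm_snd_le[of y x] that by fastforce
  have d: "(f has_derivative (\<lambda>h. g x \<bullet> h)) (at x)" for x
    using f by (simp add: C1_gradD)
  have "((\<lambda>t. f (t, y)) has_derivative (\<lambda>h. g (x, y) \<bullet> (h, 0))) (at x)" for x y
    by (rule has_derivative_compose[of "\<lambda>t. (t, y)" "\<lambda>h. (h, 0)" x UNIV f, OF _ d])
       (auto intro!: derivative_eq_intros)
  then have d1: "((\<lambda>t. f (t, y)) has_real_derivative fst (g (x, y))) (at x)" for x y
    by (simp add: has_field_derivative_def inner_prod_def)
  have "((\<lambda>t. f (x, t)) has_derivative (\<lambda>h. g (x, y) \<bullet> (0, h))) (at y)" for x y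
    by (rule has_derivative_compose[of "\<lambda>t. (x, t)" "\<lambda>h. (0, h)" y UNIV f, OF _ d])
       (auto intro!: derivative_eq_intros)
  then have d2: "((\<lambda>t. f (x, t)) has_real_derivative snd (g (x, y))) (at y)" for x y
    by (simp add: has_field_derivative_def inner_prod_def)
  have c1: "continuous_on UNIV (\<lambda>t. g (t, y))" and c2: "continuous_on UNIV (\<lambda>t. g (y, t))" for y
    by (auto intro!: continuous_on_compose2[OF cg] continuous_intros)
  have z1: "(\<integral>x. fst (g (x, y)) \<partial>lborel) = 0" for y
    by (rule integral_derivative_compact_support[OF d1 _ _ _ R(1)])
       (use c1 far K in \<open>auto intro!: continuous_on_fst\<close>)
  have z2: "(\<integral>y. snd (g (x, y)) \<partial>lborel) = 0" for x
    by (rule integral_derivative_compact_support[OF d2 _ _ _ R(1)])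
       (use c2 far K in \<open>auto intro!: continuous_on_snd\<close>)
  have i: "integrable (lborel \<Otimes>\<^sub>M lborel) (\<lambda>x. fst (g x))" "integrable (lborel \<Otimes>\<^sub>M lborel) (\<lambda>x. snd (g x))"
    using ig integrable_bounded_linear[OF bounded_linear_fst ig] integrable_bounded_linear[OF bounded_linear_snd ig]
    by (simp_all add: lborel_prod)
  have "(\<integral>y. (\<integral>x. fst (g (x, y)) \<partial>lborel) \<partial>lborel) = (\<integral>x. fst (g x) \<partial>(lborel \<Otimes>\<^sub>M lborel))"
  proof -
    have "(\<lambda>(x, y). fst (g (x, y))) = (\<lambda>x. fst (g x))" by auto
    then show ?thesis
      using lborel_pair.integral_snd[of "\<lambda>x y. fst (g (x, y))"] i(1) by simp
  qed
  then show "(\<integral>x. fst (g x) \<partial>lborel) = 0" by (simp add: z1 lborel_prod)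
  have "(\<integral>x. (\<integral>y. snd (g (x, y)) \<partial>lborel) \<partial>lborel) = (\<integral>x. snd (g x) \<partial>(lborel \<Otimes>\<^sub>M lborel))"
    by (rule lborel_pair.integral_fst'[OF i(2)])
  then show "(\<integral>x. snd (g x) \<partial>lborel) = 0" by (simp add: z2 lborel_prod)
qed

text \<open>The components need to be C^1 on \<open>S\<close> alone and to vanish on
  \<open>S\<close> off \<open>K\<close>, which suits fields built from the classical gradient on
  \<open>P\<close>. Extension by 0 turns each component into a test function on the plane.\<close>

lemma divergence_theorem_compact_support:
  assumes "open S" "compact K" "K \<subseteq> S" "C1_grad S V1 g1" "C1_grad S V2 g2"
    and "\<And>x. x \<in> S \<Longrightarrow> x \<notin> K \<Longrightarrow> V1 x = 0" "\<And>x. x \<in> S \<Longrightarrow> x \<notin> K \<Longrightarrow> V2 x = 0"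
  shows "set_integrable lborel S (\<lambda>x. fst (g1 x) + snd (g2 x))"
    and "(LINT x:S|lborel. fst (g1 x) + snd (g2 x)) = 0"
proof -
  let ?g1 = "\<lambda>x. if x \<in> S then g1 x else 0" and ?g2 = "\<lambda>x. if x \<in> S then g2 x else 0"
  have t: "test_fun S (\<lambda>x. if x \<in> S then V1 x else 0) ?g1" "test_fun S (\<lambda>x. if x \<in> S then V2 x else 0) ?g2"
    using assms by (auto intro!: C1_grad_extend)
  have eq: "indicator S x *\<^sub>R (fst (g1 x) + snd (g2 x)) = fst (?g1 x) + snd (?g2 x)" for x
    by simp
  have i: "integrable lborel (\<lambda>x. fst (?g1 x))" "integrable lborel (\<lambda>x. snd (?g2 x))"
    using integrable_bounded_linear[OF bounded_linear_fst test_fun_integral_grad(1)[OF t(1)]]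
      integrable_bounded_linear[OF bounded_linear_snd test_fun_integral_grad(1)[OF t(2)]] by auto
  show "set_integrable lborel S (\<lambda>x. fst (g1 x) + snd (g2 x))"
    unfolding set_integrable_def eq using i by (rule Bochner_Integration.integrable_add)
  show "(LINT x:S|lborel. fst (g1 x) + snd (g2 x)) = 0"
    unfolding set_lebesgue_integral_def eq
    using Bochner_Integration.integral_add[OF i] test_fun_integral_grad(2)[OF t(1)] test_fun_integral_grad(3)[OF t(2)]
    by simp
qed

section \<open>Passage from test functions to the class \<open>C1c_on\<close>\<close>

lemma test_fun_C1c:
  assumes "test_fun S f g"
  shows "C1c_on S f" "frechet_derivative f (at x) = (\<lambda>h. g x \<bullet> h)"
proof -
  obtain K where K: "compact K" "K \<subseteq> S" "\<And>x. x \<notin> K \<Longrightarrow> f x = 0"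
    using test_funD[OF assms] by metis
  have f: "C1_grad UNIV f g" using assms by (simp add: test_fun_def)
  show "frechet_derivative f (at x) = (\<lambda>h. g x \<bullet> h)"
    using frechet_derivative_at[OF C1_gradD[OF f]] by simp
  have cl: "closure {x. f x \<noteq> 0} \<subseteq> K"
    using K by (intro closure_minimal) (auto intro: compact_imp_closed)
  show "C1c_on S f"
    unfolding C1c_on_def
  proof (intro conjI exI[of _ "\<lambda>x. blinfun_inner_left (g x)"] allI)
    show "(f has_derivative blinfun_apply (blinfun_inner_left (g x))) (at x)" for x
      using C1_gradD[OF f, of x] by (simp add: blinfun_inner_left.rep_eq inner_commute)
    show "continuous_on UNIV (\<lambda>x. blinfun_inner_left (g x))"
      using C1_grad_continuous_grad[OF f] by (intro continuous_intros)
    show "compact (closure {x. f x \<noteq> 0})"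
      using cl bounded_subset[OF compact_imp_bounded[OF K(1)]] closure_subset
      unfolding compact_closure by blast
    show "closure {x. f x \<noteq> 0} \<subseteq> S" using cl K(2) by blast
  qed
qed

lemma test_fun_pair_C1c:
  assumes "test_fun S f1 g1" "test_fun S f2 g2"
  shows "C1c_on S (\<lambda>x. (f1 x, f2 x))"
    and "((\<lambda>x. (f1 x, f2 x)) has_derivative (\<lambda>h. (g1 x \<bullet> h, g2 x \<bullet> h))) (at x)"
proof -
  obtain K1 where K1: "compact K1" "K1 \<subseteq> S" "\<And>x. x \<notin> K1 \<Longrightarrow> f1 x = 0"
    using test_funD[OF assms(1)] by metis
  obtain K2 where K2: "compact K2" "K2 \<subseteq> S" "\<And>x. x \<notin> K2 \<Longrightarrow> f2 x = 0"
    using test_funD[OF assms(2)] by metis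
  have f: "C1_grad UNIV f1 g1" "C1_grad UNIV f2 g2" using assms by (simp_all add: test_fun_def)
  show d: "((\<lambda>x. (f1 x, f2 x)) has_derivative (\<lambda>h. (g1 x \<bullet> h, g2 x \<bullet> h))) (at x)" for x
    using C1_gradD[OF f(1), of x] C1_gradD[OF f(2), of x] by (auto intro: has_derivative_Pair)
  have cl: "closure {x. (f1 x, f2 x) \<noteq> 0} \<subseteq> K1 \<union> K2"
    using K1 K2 by (intro closure_minimal) (auto intro: compact_imp_closed simp: zero_prod_def)
  let ?D = "\<lambda>x. (blinfun_scaleR_left (1, 0) o\<^sub>L blinfun_inner_left (g1 x)) + (blinfun_scaleR_left (0, 1) o\<^sub>L blinfun_inner_left (g2 x))"
  show "C1c_on S (\<lambda>x. (f1 x, f2 x))"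
    unfolding C1c_on_def
  proof (intro conjI exI[of _ ?D] allI)
    show "((\<lambda>x. (f1 x, f2 x)) has_derivative blinfun_apply (?D x)) (at x)" for x
    proof -
      have "blinfun_apply (?D x) = (\<lambda>h. (g1 x \<bullet> h, g2 x \<bullet> h))"
        by (rule ext) (simp add: blinfun.add_left inner_commute)
      then show ?thesis using d[of x] by simp
    qed
    show "continuous_on UNIV ?D"
      using C1_grad_continuous_grad[OF f(1)] C1_grad_continuous_grad[OF f(2)] by (intro continuous_intros)
    show "compact (closure {x. (f1 x, f2 x) \<noteq> 0})"
      using cl bounded_subset[OF compact_imp_bounded[OF compact_Un[OF K1(1) K2(1)]]] closure_subset
      unfolding compact_closure by blast
    show "closure {x. (f1 x, f2 x) \<noteq> 0} \<subseteq> S" using cl K1(2) K2(2) by blast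
  qed
qed

section \<open>Cutoff functions\<close>

text \<open>A C^1 step that is 0 for t \<le> 0 and tends to 1. The square removes the corner at 0;
  the value 1 is reached only in the limit, which is enough because the argument is always scaled by
  n.\<close>

definition ramp :: "real \<Rightarrow> real" where
  "ramp t = (max 0 t)\<^sup>2 / (1 + (max 0 t)\<^sup>2)"

definition ramp' :: "real \<Rightarrow> real" where
  "ramp' t = 2 * max 0 t / (1 + (max 0 t)\<^sup>2)\<^sup>2"

lemma DERIV_max_0_square: "((\<lambda>t. (max 0 t)\<^sup>2) has_real_derivative 2 * max 0 t) (at t)"
proof -
  consider "t < 0" | "t = 0" | "t > 0" by linarith
  then show ?thesis
  proof cases
    case 1
    have "((\<lambda>t. 0) has_real_derivative 2 * max 0 t) (at t)" using 1 by simp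
    then show ?thesis
      by (rule has_field_derivative_transform_within_open[where S="{..<0}"]) (use 1 in auto)
  next
    case 2
    have "(max 0 h)\<^sup>2 / h = max 0 h" for h :: real
      by (cases "0 \<le> h") (simp_all add: power2_eq_square)
    moreover have "((\<lambda>h::real. max 0 h) \<longlongrightarrow> max 0 0) (at 0)"
      by (intro tendsto_intros)
    ultimately show ?thesis using 2 by (simp add: DERIV_def)
  next
    case 3
    have "((\<lambda>t. t\<^sup>2) has_real_derivative 2 * max 0 t) (at t)"
      using 3 by (auto intro!: derivative_eq_intros)
    then show ?thesis
      by (rule has_field_derivative_transform_within_open[where S="{0<..}"]) (use 3 in auto)
  qed
qed

lemma one_plus_square_pos: "1 + (x::real)\<^sup>2 > 0"
  by (simp add: add_pos_nonneg)

lemma DERIV_ramp: "(ramp has_real_derivative ramp' t) (at t)"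
proof -
  have "((\<lambda>t. (max 0 t)\<^sup>2 / (1 + (max 0 t)\<^sup>2)) has_real_derivative
     (2 * max 0 t * (1 + (max 0 t)\<^sup>2) - (max 0 t)\<^sup>2 * (2 * max 0 t)) / ((1 + (max 0 t)\<^sup>2) * (1 + (max 0 t)\<^sup>2))) (at t)"
    using one_plus_square_pos[of "max 0 t"] 
    by (intro DERIV_divide DERIV_max_0_square DERIV_add[OF DERIV_const DERIV_max_0_square, simplified]) auto
  moreover have "(2 * max 0 t * (1 + (max 0 t)\<^sup>2) - (max 0 t)\<^sup>2 * (2 * max 0 t)) / ((1 + (max 0 t)\<^sup>2) * (1 + (max 0 t)\<^sup>2)) = ramp' t"
    by (simp add: ramp'_def power2_eq_square algebra_simps)
  ultimately show ?thesis by (simp add: ramp_def[abs_def])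
qed

lemma continuous_on_ramp': "continuous_on S ramp'"
  unfolding ramp'_def using one_plus_square_pos
  by (intro continuous_intros) (metis power_eq_0_iff less_irrefl)

lemma continuous_on_ramp: "continuous_on S ramp"
  by (meson DERIV_ramp DERIV_isCont continuous_at_imp_continuous_on)

lemma ramp_bounds: "0 \<le> ramp t" "ramp t \<le> 1"
  using one_plus_square_pos[of "max 0 t"] by (auto simp: ramp_def)

lemma ramp_nonpos: "t \<le> 0 \<Longrightarrow> ramp t = 0"
  by (simp add: ramp_def)

lemma le_one_plus_square: "(t::real) \<le> 1 + t\<^sup>2"
  using zero_le_power2[of "t - 1/2"] by (simp add: power2_eq_square algebra_simps)

lemma ramp_defect: "t > 0 \<Longrightarrow> 1 - ramp t \<le> 1 / t"
proof -
  assume t: "t > 0"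
  then have "1 - ramp t = 1 / (1 + t\<^sup>2)"
    using one_plus_square_pos[of t] by (simp add: ramp_def field_simps)
  also have "\<dots> \<le> 1 / t"
    using t le_one_plus_square[of t] one_plus_square_pos[of t] by (intro divide_left_mono) auto
  finally show ?thesis .
qed

text \<open>The factor \<open>t + 1\<close> is the one in \<open>cut'\<close>: there the argument is
  n s^2 - 1, and the chain rule produces n s^2. Bounding the product therefore bounds
  \<open>cut'\<close> uniformly in n.\<close>

lemma ramp'_nonneg: "0 \<le> (t + 1) * ramp' t"
  by (cases "t \<le> 0") (auto simp: ramp'_def intro!: mult_nonneg_nonneg divide_nonneg_nonneg)

lemma ramp'_bound: "(t + 1) * ramp' t \<le> 4 / (1 + t\<^sup>2)"
proof (cases "t > 0")
  case True
  have "(t + 1) * (2 * t) \<le> 4 * (1 + t\<^sup>2)"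
    using le_one_plus_square[of t] by (simp add: power2_eq_square algebra_simps)
  then have "(t + 1) * (2 * t) / (1 + t\<^sup>2)\<^sup>2 \<le> 4 * (1 + t\<^sup>2) / (1 + t\<^sup>2)\<^sup>2"
    by (intro divide_right_mono) auto
  also have "\<dots> = 4 / (1 + t\<^sup>2)"
    using one_plus_square_pos[of t] by (simp add: power2_eq_square[of "1 + t\<^sup>2"] del: distrib_left_numeral)
  finally show ?thesis using True by (simp add: ramp'_def)
next
  case False
  then show ?thesis using one_plus_square_pos[of t] by (simp add: ramp'_def)
qed

lemma ramp'_decay: "t > 0 \<Longrightarrow> (t + 1) * ramp' t \<le> 4 / t"
  using ramp'_bound[of t] le_one_plus_square[of t] divide_left_mono[of t "1 + t\<^sup>2" 4]
    one_plus_square_pos[of t] by force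

lemma tendsto_ramp:
  assumes "filterlim f at_top F"
  shows "((\<lambda>n. ramp (f n)) \<longlongrightarrow> 1) F"
proof (rule tendsto_sandwich)
  have "((\<lambda>n. inverse (f n)) \<longlongrightarrow> 0) F"
    using tendsto_inverse_0_at_top[OF assms] .
  from tendsto_diff[OF tendsto_const this, of 1]
  show "((\<lambda>n. 1 - inverse (f n)) \<longlongrightarrow> 1) F" by simp
  have "\<forall>\<^sub>F n in F. f n > 0" using assms by (simp add: filterlim_at_top_dense)
  then show "\<forall>\<^sub>F n in F. 1 - inverse (f n) \<le> ramp (f n)"
    by eventually_elim (use ramp_defect in \<open>fastforce simp: inverse_eq_divide\<close>)
qed (use ramp_bounds in auto)

lemma tendsto_ramp':
  assumes "filterlim f at_top F"
  shows "((\<lambda>n. (f n + 1) * ramp' (f n)) \<longlongrightarrow> 0) F"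
proof (rule tendsto_sandwich[where f="\<lambda>_. 0"])
  have "((\<lambda>n. inverse (f n)) \<longlongrightarrow> 0) F"
    using tendsto_inverse_0_at_top[OF assms] .
  from tendsto_mult[OF tendsto_const this, of 4]
  show "((\<lambda>n. 4 * inverse (f n)) \<longlongrightarrow> 0) F" by simp
  have "\<forall>\<^sub>F n in F. f n > 0" using assms by (simp add: filterlim_at_top_dense)
  then show "\<forall>\<^sub>F n in F. (f n + 1) * ramp' (f n) \<le> 4 * inverse (f n)"
    by eventually_elim (use ramp'_decay in \<open>simp add: divide_inverse\<close>)
qed (use ramp'_nonneg in auto)

text \<open>
  \<open>cut n\<close> is a \<open>C\<^sup>1\<close> approximation of the identity that vanishes near \<open>0\<close>. Since \<open>u\<close> is classical
  away from its zero set, \<open>cut n \<circ> u\<close> is \<open>C\<^sup>1\<close> on the whole disk.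
\<close>

definition cut :: "nat \<Rightarrow> real \<Rightarrow> real" where
  "cut n t = t * ramp (real n * t\<^sup>2 - 1)"

definition cut' :: "nat \<Rightarrow> real \<Rightarrow> real" where
  "cut' n t = ramp (real n * t\<^sup>2 - 1) + 2 * (real n * t\<^sup>2) * ramp' (real n * t\<^sup>2 - 1)"

lemma DERIV_cut: "(cut n has_real_derivative cut' n t) (at t)"
proof -
  have "((\<lambda>t. ramp (real n * t\<^sup>2 - 1)) has_real_derivative ramp' (real n * t\<^sup>2 - 1) * (2 * real n * t)) (at t)"
    by (rule DERIV_chain2[OF DERIV_ramp]) (auto intro!: derivative_eq_intros)
  then have "((\<lambda>t. t * ramp (real n * t\<^sup>2 - 1)) has_real_derivative
      1 * ramp (real n * t\<^sup>2 - 1) + ramp' (real n * t\<^sup>2 - 1) * (2 * real n * t) * t) (at t)"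
    by (intro DERIV_mult DERIV_ident)
  then show ?thesis
    by (simp add: cut_def[abs_def] cut'_def power2_eq_square mult_ac)
qed

lemma continuous_on_cut': "continuous_on S (cut' n)"
  unfolding cut'_def
  by (intro continuous_intros continuous_on_compose2[OF continuous_on_ramp[of UNIV]]
     continuous_on_compose2[OF continuous_on_ramp'[of UNIV]]) auto

lemma cut_eq_0: "real n * t\<^sup>2 \<le> 1 \<Longrightarrow> cut n t = 0"
  by (simp add: cut_def ramp_nonpos)

lemma cut_bound: "\<bar>cut n t\<bar> \<le> \<bar>t\<bar>"
  using ramp_bounds[of "real n * t\<^sup>2 - 1"] by (auto simp: cut_def abs_mult intro: mult_left_le)

text \<open>The constant is 1 + 2 * 4: \<open>ramp\<close> is at most 1, and
  \<open>(t + 1) * ramp' t\<close> is at most 4. Independence of n and t is what provides dominating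
  functions.\<close>

lemma cut'_bound: "\<bar>cut' n t\<bar> \<le> 9"
  using ramp_bounds[of "real n * t\<^sup>2 - 1"] ramp'_nonneg[of "real n * t\<^sup>2 - 1"]
    ramp'_bound[of "real n * t\<^sup>2 - 1"] divide_left_mono[of 1 "1 + (real n * t\<^sup>2 - 1)\<^sup>2" 4]
    one_plus_square_pos[of "real n * t\<^sup>2 - 1"]
  by (simp add: cut'_def mult.assoc)

lemma filterlim_cut_arg: "t \<noteq> 0 \<Longrightarrow> filterlim (\<lambda>n. real n * t\<^sup>2 - 1) at_top sequentially"
  unfolding diff_conv_add_uminus
  by (subst add.commute, intro filterlim_tendsto_add_at_top[OF tendsto_const]
     filterlim_at_top_mult_tendsto_pos[OF tendsto_const] filterlim_real_sequentially) auto

lemma cut_tendsto: "(\<lambda>n. cut n t) \<longlonglongrightarrow> t"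
proof (cases "t = 0")
  case False
  have "(\<lambda>n. t * ramp (real n * t\<^sup>2 - 1)) \<longlonglongrightarrow> t * 1"
    by (intro tendsto_intros tendsto_ramp filterlim_cut_arg False)
  then show ?thesis by (simp add: cut_def)
qed (simp add: cut_def)

lemma cut'_tendsto: "t \<noteq> 0 \<Longrightarrow> (\<lambda>n. cut' n t) \<longlonglongrightarrow> 1"
  using tendsto_add[OF tendsto_ramp[OF filterlim_cut_arg] tendsto_mult[OF tendsto_const[of 2] tendsto_ramp'[OF filterlim_cut_arg]], of t t]
  by (simp add: cut'_def mult.assoc)

section \<open>Bumps on intervals and boxes, and the fundamental lemma of the calculus of
  variations\<close>

definition bump1 :: "nat \<Rightarrow> real \<Rightarrow> real \<Rightarrow> real \<Rightarrow> real" where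
  "bump1 n a b t = ramp (real n * (t - a)) * ramp (real n * (b - t))"

lemma bump1_bounds: "0 \<le> bump1 n a b t" "bump1 n a b t \<le> 1"
  using ramp_bounds by (auto simp: bump1_def intro: mult_le_one)

lemma bump1_outside: "t \<notin> {a<..<b} \<Longrightarrow> bump1 n a b t = 0"
  by (auto simp: bump1_def ramp_nonpos mult_nonneg_nonpos)

lemma bump1_tendsto: "(\<lambda>n. bump1 n a b t) \<longlonglongrightarrow> indicator {a<..<b} t"
proof (cases "t \<in> {a<..<b}")
  case True
  have "filterlim (\<lambda>n. real n * c) at_top sequentially" if "c > 0" for c
    using filterlim_at_top_mult_tendsto_pos[OF tendsto_const that filterlim_real_sequentially] by simp
  then have "(\<lambda>n. bump1 n a b t) \<longlonglongrightarrow> 1 * 1"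
    unfolding bump1_def using True by (intro tendsto_mult tendsto_ramp) auto
  then show ?thesis using True by simp
qed (simp add: bump1_outside)

lemma DERIV_bump1: "(bump1 n a b has_real_derivative
    (ramp (real n * (t - a)) * (ramp' (real n * (b - t)) * (- real n)) + (ramp' (real n * (t - a)) * real n) * ramp (real n * (b - t)))) (at t)"
proof -
  have 1: "((\<lambda>t. ramp (real n * (t - a))) has_real_derivative ramp' (real n * (t - a)) * real n) (at t)"
    by (rule DERIV_chain2[OF DERIV_ramp]) (auto intro!: derivative_eq_intros)
  have 2: "((\<lambda>t. ramp (real n * (b - t))) has_real_derivative ramp' (real n * (b - t)) * (- real n)) (at t)"
    by (rule DERIV_chain2[OF DERIV_ramp]) (auto intro!: derivative_eq_intros)
  show ?thesis
    unfolding bump1_def[abs_def] using DERIV_mult'[OF 1 2] by simp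
qed

lemma bump1_C1: "\<exists>d. (\<forall>t. (bump1 n a b has_real_derivative d t) (at t)) \<and> continuous_on UNIV d"
  by (rule exI, rule conjI, rule allI, rule DERIV_bump1)
     (intro continuous_intros continuous_on_compose2[OF continuous_on_ramp[of UNIV]]
     continuous_on_compose2[OF continuous_on_ramp'[of UNIV]] subset_UNIV)

lemma continuous_on_bump1: "continuous_on S (bump1 n a b)"
  by (meson DERIV_bump1 DERIV_isCont continuous_at_imp_continuous_on)

lemma bump2_test_fun:
  assumes "cbox a b \<subseteq> U"
  shows "\<exists>g. test_fun U (\<lambda>x. bump1 n (fst a) (fst b) (fst x) * bump1 n (snd a) (snd b) (snd x)) g"
proof -
  obtain d1 where d1: "\<And>t. (bump1 n (fst a) (fst b) has_real_derivative d1 t) (at t)" "continuous_on UNIV d1"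
    using bump1_C1 by blast
  obtain d2 where d2: "\<And>t. (bump1 n (snd a) (snd b) has_real_derivative d2 t) (at t)" "continuous_on UNIV d2"
    using bump1_C1 by blast
  note C1_grad_mult[OF C1_grad_compose[OF C1_grad_fst d1] C1_grad_compose[OF C1_grad_snd d2], of UNIV]
  moreover have "bump1 n (fst a) (fst b) (fst x) * bump1 n (snd a) (snd b) (snd x) = 0" if "x \<notin> cbox a b" for x
  proof -
    have "cbox a b = cbox (fst a) (fst b) \<times> cbox (snd a) (snd b)"
      by (metis cbox_Pair_eq prod.collapse)
    then have "fst x \<notin> {fst a<..<fst b} \<or> snd x \<notin> {snd a<..<snd b}"
      using that by (auto simp: mem_Times_iff)
    then show ?thesis by (auto simp: bump1_outside)
  qed
  ultimately show ?thesis unfolding test_fun_def using assms compact_cbox by blast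
qed

text \<open>Products of interval bumps are bounded by 1 and converge to the indicator of an open
  box, so by dominated convergence the integral of \<open>h\<close> over each box in
  \<open>U\<close> is 0.\<close>

lemma AE_zero_of_test_fun:
  fixes h :: "pt \<Rightarrow> real"
  assumes "open U"
    and int: "\<And>a b. cbox a b \<subseteq> U \<Longrightarrow> set_integrable lborel (cbox a b) h"
    and zero: "\<And>\<psi> g. test_fun U \<psi> g \<Longrightarrow> (LINT x:U|lborel. h x * \<psi> x) = 0"
  shows "AE x in lborel. x \<in> U \<longrightarrow> h x = 0"
proof (rule AE_zero_of_integral_cbox_zero[OF \<open>open U\<close> int])
  fix a b :: pt assume ab: "cbox a b \<subseteq> U"
  define \<psi> where "\<psi> = (\<lambda>n x. bump1 n (fst a) (fst b) (fst x) * bump1 n (snd a) (snd b) (snd x))"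
  have box: "box a b = {fst a<..<fst b} \<times> {snd a<..<snd b}"
    by (auto simp: box_def Basis_prod_def inner_prod_def)
  have i: "integrable lborel (\<lambda>x. indicator (cbox a b) x *\<^sub>R h x)"
    using int[OF ab] by (simp add: set_integrable_def)
  have out: "\<psi> n x = 0" if "x \<notin> box a b" for n x
    using that unfolding box by (auto simp: \<psi>_def mem_Times_iff bump1_outside)
  have cont: "continuous_on UNIV (\<psi> n)" for n
    unfolding \<psi>_def by (intro continuous_intros continuous_on_compose2[OF continuous_on_bump1[of UNIV]]) auto
  then have [measurable]: "\<psi> n \<in> borel_measurable borel" for n
    by (simp add: borel_measurable_continuous_onI)
  have "(\<lambda>n. \<integral>x. \<psi> n x * (indicator (cbox a b) x *\<^sub>R h x) \<partial>lborel) \<longlonglongrightarrow> (\<integral>x. indicator (box a b) x * (indicator (cbox a b) x *\<^sub>R h x) \<partial>lborel)"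
  proof (rule integral_dominated_convergence[where w="\<lambda>x. norm (indicator (cbox a b) x *\<^sub>R h x)"])
    show "integrable lborel (\<lambda>x. norm (indicator (cbox a b) x *\<^sub>R h x))"
      using i by (rule integrable_norm)
    show "(\<lambda>x. indicator (box a b) x * (indicator (cbox a b) x *\<^sub>R h x)) \<in> borel_measurable lborel"
      using borel_measurable_integrable[OF i] by measurable
    show "(\<lambda>x. \<psi> n x * (indicator (cbox a b) x *\<^sub>R h x)) \<in> borel_measurable lborel" for n
      using borel_measurable_integrable[OF i] by measurable
    have "(\<lambda>n. \<psi> n x) \<longlonglongrightarrow> indicator (box a b) x" for x
      using tendsto_mult[OF bump1_tendsto[of "fst a" "fst b" "fst x"] bump1_tendsto[of "snd a" "snd b" "snd x"]]
      unfolding \<psi>_def box by (simp add: indicator_times)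
    then show "AE x in lborel. (\<lambda>n. \<psi> n x * (indicator (cbox a b) x *\<^sub>R h x)) \<longlonglongrightarrow> indicator (box a b) x * (indicator (cbox a b) x *\<^sub>R h x)"
      by (intro AE_I2 tendsto_mult tendsto_const)
    have b1: "\<bar>\<psi> n x\<bar> \<le> 1" for n x
      unfolding \<psi>_def abs_mult using bump1_bounds by (auto intro!: mult_le_one)
    have "norm (\<psi> n x * z) \<le> norm z" for n x z
      using b1[of n x] by (simp add: abs_mult mult_left_le_one_le)
    then show "AE x in lborel. norm (\<psi> n x * (indicator (cbox a b) x *\<^sub>R h x)) \<le> norm (indicator (cbox a b) x *\<^sub>R h x)" for n
      by (intro AE_I2)
  qed
  moreover have "(\<integral>x. \<psi> n x * (indicator (cbox a b) x *\<^sub>R h x) \<partial>lborel) = 0" for n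
  proof -
    obtain g where "test_fun U (\<psi> n) g"
      using bump2_test_fun[OF ab] unfolding \<psi>_def by blast
    from zero[OF this] have "(\<integral>x. indicator U x *\<^sub>R (h x * \<psi> n x) \<partial>lborel) = 0"
      unfolding set_lebesgue_integral_def .
    moreover have "indicator U x *\<^sub>R (h x * \<psi> n x) = \<psi> n x * (indicator (cbox a b) x *\<^sub>R h x)" for x
      using out[of x n] ab box_subset_cbox[of a b] by (cases "x \<in> box a b") (auto simp: indicator_def)
    ultimately show ?thesis by (simp only:)
  qed
  ultimately have "(\<integral>x. indicator (box a b) x * (indicator (cbox a b) x *\<^sub>R h x) \<partial>lborel) = 0"
    by (simp add: LIMSEQ_const_iff)
  \<comment> \<open>The limit yields the open box while the claim is about the closed one; the faces
    are negligible.\<close>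
  moreover have "AE x in lborel. x \<in> cbox a b \<longrightarrow> x \<in> box a b"
  proof -
    have "negligible (cbox a b - box a b)" by (rule negligible_frontier_interval)
    then have "AE x in lebesgue. x \<notin> cbox a b - box a b"
      by (intro AE_not_in) (simp add: negligible_iff_null_sets)
    then show ?thesis by (simp add: AE_completion_iff)
  qed
  then have "(\<integral>x. indicator (box a b) x * (indicator (cbox a b) x *\<^sub>R h x) \<partial>lborel) = (\<integral>x. indicator (cbox a b) x *\<^sub>R h x \<partial>lborel)"
    using borel_measurable_integrable[OF i]
    by (intro integral_cong_AE) (auto elim!: eventually_mono simp: indicator_def)
  ultimately show "(LINT x:cbox a b|lborel. h x) = 0"
    by (simp add: set_lebesgue_integral_def)
qed

section \<open>Radial test functions\<close>

text \<open>The norm is not differentiable at the origin, but \<eta> is constant below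
  \<open>a\<close> because its derivative \<open>g\<close> vanishes there, so the composition is
  constant near 0. Away from 0 the chain rule applies, and the two regions cover the plane.\<close>

lemma radial_test_fun:
  assumes ab: "0 < a" "a < b" "b < 1"
    and g: "continuous_on UNIV g" "\<And>t. t \<notin> {a<..<b} \<Longrightarrow> g t = 0"
    and \<eta>: "\<And>t. (\<eta> has_real_derivative g t) (at t)" "\<And>t. b \<le> t \<Longrightarrow> \<eta> t = 0"
  shows "test_fun B1 (\<lambda>x. \<eta> (norm x)) (\<lambda>x. (g (norm x) / norm x) *\<^sub>R x)"
proof -
  let ?g = "\<lambda>x::pt. (g (norm x) / norm x) *\<^sub>R x"
  have "\<exists>c. \<forall>t\<in>{..<a}. \<eta> t = c"
  proof (rule has_field_derivative_zero_constant)
    show "(\<eta> has_real_derivative 0) (at t within {..<a})" if "t \<in> {..<a}" for t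
      using \<eta>(1)[of t] g(2)[of t] that by (auto intro: has_field_derivative_at_within)
  qed auto
  then obtain c where c: "\<And>t. t < a \<Longrightarrow> \<eta> t = c" by auto
  have "((\<lambda>x. \<eta> (norm x)) has_derivative (\<lambda>h. ?g x \<bullet> h)) (at x)" for x :: pt
  proof (cases "norm x < a")
    case True
    have "((\<lambda>x. c) has_derivative (\<lambda>h. 0)) (at x)" by (rule has_derivative_const)
    then have "((\<lambda>x. \<eta> (norm x)) has_derivative (\<lambda>h. 0)) (at x)"
      by (rule has_derivative_transform_within_open[OF _ open_ball[of 0 a]]) (use True c in auto)
    then show ?thesis using g(2)[of "norm x"] True by simp
  next
    case False
    then have "x \<noteq> 0" using ab by auto
    then have "(norm has_derivative (\<lambda>h. h \<bullet> sgn x)) (at x)" by (rule has_derivative_norm)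
    then have "((\<lambda>x. \<eta> (norm x)) has_derivative (\<lambda>h. g (norm x) * (h \<bullet> sgn x))) (at x)"
      using \<eta>(1)[of "norm x"] has_derivative_compose[of norm _ x UNIV \<eta> "(*) (g (norm x))"]
      by (simp add: has_field_derivative_def)
    moreover have "(\<lambda>h. g (norm x) * (h \<bullet> sgn x)) = (\<lambda>h. ?g x \<bullet> h)"
      by (rule ext) (simp add: sgn_div_norm inner_commute divide_inverse)
    ultimately show ?thesis by simp
  qed
  moreover have "continuous_on (ball 0 a \<union> - {0}) ?g"
  proof (rule continuous_on_open_Un)
    show "continuous_on (ball 0 a) ?g"
      by (rule continuous_on_eq[of _ "\<lambda>_. 0"]) (use g(2) in auto)
    show "continuous_on (- {0}) ?g"
      by (intro continuous_intros continuous_on_compose2[OF g(1)]) auto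
  qed auto
  moreover have "ball 0 a \<union> - {0} = (UNIV :: pt set)" using ab by auto
  ultimately have "C1_grad UNIV (\<lambda>x. \<eta> (norm x)) ?g" by (simp add: C1_grad_def)
  moreover have "cball 0 b \<subseteq> B1" using ab by (auto simp: B1_def)
  moreover have "\<eta> (norm x) = 0" if "x \<notin> cball 0 b" for x :: pt
    using that \<eta>(2) by auto
  ultimately show ?thesis unfolding test_fun_def using compact_cball by blast
qed

section \<open>Radial weights, circle integrals and ball integrals\<close>

lemma norm_polar: "0 \<le> r \<Longrightarrow> norm (r * cos \<theta>, r * sin \<theta>) = r"
proof -
  assume "0 \<le> r"
  have "(r * cos \<theta>)\<^sup>2 + (r * sin \<theta>)\<^sup>2 = r\<^sup>2 * ((sin \<theta>)\<^sup>2 + (cos \<theta>)\<^sup>2)"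
    by (simp only: power_mult_distrib distrib_left add.commute)
  then show ?thesis using \<open>0 \<le> r\<close> by (simp add: norm_Pair)
qed

lemma circle_integral_cong:
  assumes "0 \<le> r" "\<And>x. norm x = r \<Longrightarrow> f x = g x"
  shows "circle_integral r f = circle_integral r g"
  unfolding circle_integral_def using assms by (auto simp: norm_polar)

lemma circle_integral_cmult: "circle_integral r (\<lambda>x. c * f x) = c * circle_integral r f"
  unfolding circle_integral_def by (simp add: mult.assoc)

text \<open>On the circle of radius r the weight is the constant \<open>k r\<close>, so it leaves
  the circle integral.\<close>

lemma integral_radial_mult:
  fixes f :: "pt \<Rightarrow> real"
  assumes f: "integrable lborel f" and [measurable]: "k \<in> borel_measurable borel"
    and bd: "\<And>t. 0 \<le> t \<Longrightarrow> \<bar>k t\<bar> \<le> C"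
  shows "integrable lborel (\<lambda>z. k (norm z) * f z)"
    and "integrable lborel (\<lambda>r. k r * (indicator {0<..} r * circle_integral r f))"
    and "(\<integral>z. k (norm z) * f z \<partial>lborel) = (\<integral>r. k r * (indicator {0<..} r * circle_integral r f) \<partial>lborel)"
proof -
  have [measurable]: "f \<in> borel_measurable borel" using f by simp
  show i: "integrable lborel (\<lambda>z. k (norm z) * f z)"
  proof (rule Bochner_Integration.integrable_bound[OF integrable_mult_right[OF integrable_norm[OF f], of C]])
    show "AE x in lborel. norm (k (norm x) * f x) \<le> norm (C * norm (f x))"
    proof (rule AE_I2)
      fix x :: pt
      have "\<bar>k (norm x)\<bar> * \<bar>f x\<bar> \<le> \<bar>C\<bar> * \<bar>f x\<bar>"
        using bd[of "norm x"] by (intro mult_right_mono) auto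
      then show "norm (k (norm x) * f x) \<le> norm (C * norm (f x))" by (simp add: abs_mult)
    qed
  qed simp
  have eq: "indicator {0<..} r * circle_integral r (\<lambda>z. k (norm z) * f z)
      = k r * (indicator {0<..} r * circle_integral r f)" for r
  proof (cases "r > 0")
    case True
    have "circle_integral r (\<lambda>z. k (norm z) * f z) = circle_integral r (\<lambda>z. k r * f z)"
      using True by (intro circle_integral_cong) auto
    then show ?thesis by (simp add: circle_integral_cmult)
  qed simp
  show "integrable lborel (\<lambda>r. k r * (indicator {0<..} r * circle_integral r f))"
    using integral_polar(2)[OF i] unfolding eq .
  show "(\<integral>z. k (norm z) * f z \<partial>lborel) = (\<integral>r. k r * (indicator {0<..} r * circle_integral r f) \<partial>lborel)"
    using integral_polar(3)[OF i] unfolding eq .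
qed

text \<open>The two indicators make this an integrable function on the whole line, whatever
  \<open>f\<close> is outside the disk and whatever \<open>circle_integral\<close> returns at
  negative radii.\<close>

definition radial_density :: "(pt \<Rightarrow> real) \<Rightarrow> real \<Rightarrow> real" where
  "radial_density f r = indicator {0<..} r * circle_integral r (\<lambda>x. indicator B1 x * f x)"

lemma radial_density_eq: "0 < r \<Longrightarrow> r < 1 \<Longrightarrow> radial_density f r = circle_integral r f"
  unfolding radial_density_def by (auto simp: B1_def intro!: circle_integral_cong)

lemma integrable_B1: "set_integrable lborel B1 f \<Longrightarrow> integrable lborel (\<lambda>x. indicator B1 x * (f x :: real))"
  by (simp add: set_integrable_def)

lemma integrable_radial_density:
  assumes "set_integrable lborel B1 f"
  shows "integrable lborel (radial_density f)"
  unfolding radial_density_def by (rule integral_polar(2)[OF integrable_B1[OF assms]])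

text \<open>Polar coordinates with the indicator of \<open>{..<r}\<close> as radial weight; the
  endpoint r is a null set.\<close>

lemma ball_integral_radial:
  assumes f: "set_integrable lborel B1 f" and r: "r \<le> 1"
  shows "(LINT x:ball 0 r|lborel. f x) = (LINT t:{0..r}|lborel. radial_density f t)"
proof -
  have "(LINT x:ball 0 r|lborel. f x) = (\<integral>x. indicator {..<r} (norm x) * (indicator B1 x * f x) \<partial>lborel)"
    unfolding set_lebesgue_integral_def using r
    by (intro Bochner_Integration.integral_cong) (auto simp: indicator_def B1_def)
  also have "\<dots> = (\<integral>t. indicator {..<r} t * radial_density f t \<partial>lborel)"
    unfolding radial_density_def
    by (rule integral_radial_mult(3)[OF integrable_B1[OF f], of _ 1]) (auto simp: indicator_def)
  also have "\<dots> = (\<integral>t. indicator {0..r} t * radial_density f t \<partial>lborel)"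
  proof (rule integral_cong_AE)
    have [measurable]: "radial_density f \<in> borel_measurable borel"
      using integrable_radial_density[OF f] by simp
    show "(\<lambda>t. indicator {..<r} t * radial_density f t) \<in> borel_measurable lborel"
      "(\<lambda>t. indicator {0..r} t * radial_density f t) \<in> borel_measurable lborel" by measurable
    show "AE t in lborel. indicator {..<r} t * radial_density f t = indicator {0..r} t * radial_density f t"
      using AE_lborel_singleton[of r]
      by eventually_elim (auto simp: indicator_def radial_density_def)
  qed
  finally show ?thesis by (simp add: set_lebesgue_integral_def)
qed

lemma ball_integral_has_derivative:
  assumes f: "set_integrable lborel B1 f"
  shows "AE r in lborel. 0 < r \<and> r < 1 \<longrightarrow>
    ((\<lambda>r. LINT x:ball 0 r|lborel. f x) has_real_derivative circle_integral r f) (at r)"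
  using lebesgue_differentiation_real[OF integrable_radial_density[OF f]]
proof eventually_elim
  case (elim r)
  show ?case
  proof
    assume r: "0 < r \<and> r < 1"
    then have "((\<lambda>x. LINT t:{0..x}|lborel. radial_density f t) has_real_derivative circle_integral r f) (at r)"
      using elim radial_density_eq by simp
    then show "((\<lambda>r. LINT x:ball 0 r|lborel. f x) has_real_derivative circle_integral r f) (at r)"
      by (rule has_field_derivative_transform_within_open[where S="{..<1}"])
         (use r ball_integral_radial[OF f] in auto)
  qed
qed

text \<open>Serves to upgrade an identity between circle and ball integrals from almost every radius
  to every radius in \<open>circle_square_eq\<close>.\<close>

lemma continuous_on_ball_integral:
  fixes f :: "pt \<Rightarrow> real"
  assumes f: "set_integrable lborel B1 f"
  shows "continuous_on {0..1} (\<lambda>r. LINT x:ball 0 r|lborel. f x)"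
proof -
  have i: "set_integrable lborel {0..r} (radial_density f)" for r
    using integrable_radial_density[OF f] unfolding set_integrable_def
    by (intro integrable_mult_indicator) auto
  have "continuous_on {0..1} (\<lambda>r. integral {0..r} (radial_density f))"
    using set_borel_integral_eq_integral(1)[OF i] by (intro indefinite_integral_continuous_1)
  then show ?thesis
    by (rule continuous_on_eq)
       (use set_borel_integral_eq_integral(2)[OF i] ball_integral_radial[OF f] in auto)
qed

lemma integration_by_parts_cutoff:
  fixes p g \<eta> :: "real \<Rightarrow> real"
  assumes p: "integrable lborel p"
    and g: "continuous_on UNIV g" "\<And>t. t \<notin> {a<..<b} \<Longrightarrow> g t = 0" and ab: "0 < a" "a < b" "b < 1"
    and \<eta>: "\<And>t. (\<eta> has_real_derivative g t) (at t)" "\<And>t. b \<le> t \<Longrightarrow> \<eta> t = 0"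
    and p0: "\<And>t. t \<le> 0 \<Longrightarrow> p t = 0"
  shows "(\<integral>r. \<eta> r * p r \<partial>lborel) = - (\<integral>s. g s * (LINT r:{0..s}|lborel. p r) \<partial>lborel)"
proof -
  have [measurable]: "p \<in> borel_measurable borel" using p by simp
  have [measurable]: "g \<in> borel_measurable borel" using g(1) by (rule borel_measurable_continuous_onI)
  have ig: "integrable lborel g"
    by (rule integrable_continuous_compact_support[OF g(1), of "{a..b}"]) (use g(2) in auto)
  have e: "(\<integral>s. indicator {..s} r * g s \<partial>lborel) = - \<eta> r" for r
  proof (cases "r \<le> b")
    case True
    have "(\<integral>s. indicator {r..b} s *\<^sub>R g s \<partial>lborel) = \<eta> b - \<eta> r"
      using True \<eta> g(1) by (intro integral_FTC_Icc)
        (auto simp: has_real_derivative_iff_has_vector_derivative[symmetric]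
         intro: has_field_derivative_at_within continuous_on_subset)
    moreover have "indicator {r..b} s *\<^sub>R g s = indicator {..s} r * g s" for s
      using g(2)[of s] by (auto simp: indicator_def)
    ultimately have "(\<integral>s. indicator {..s} r * g s \<partial>lborel) = \<eta> b - \<eta> r" by (simp only:)
    then show ?thesis using \<eta>(2)[of b] by simp
  next
    case False
    then have "indicator {..s} r * g s = 0" for s
      using g(2)[of s] by (auto simp: indicator_def)
    then have "(\<integral>s. indicator {..s} r * g s \<partial>lborel) = 0"
      by (simp only: Bochner_Integration.integral_zero)
    then show ?thesis using \<eta>(2)[of r] False by simp
  qed
  let ?f = "\<lambda>r s. indicator {..s} r * g s * p r"
  have "(\<lambda>(r, s). if r \<le> s then g s * p r else 0) \<in> borel_measurable (borel \<Otimes>\<^sub>M borel)"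
    by measurable
  moreover have "(\<lambda>(r, s). if r \<le> s then g s * p r else 0) = (\<lambda>(r, s). ?f r s)"
    by (auto simp: fun_eq_iff)
  ultimately have meas: "(\<lambda>(r, s). ?f r s) \<in> borel_measurable (lborel \<Otimes>\<^sub>M lborel)"
    by (simp add: lborel_prod borel_prod)
  have int: "integrable (lborel \<Otimes>\<^sub>M lborel) (\<lambda>(r, s). ?f r s)"
  proof (rule Bochner_Integration.integrable_bound)
    show "integrable (lborel \<Otimes>\<^sub>M lborel) (\<lambda>(r, s). g s * p r)"
    proof (rule lborel_pair.Fubini_integrable)
      have "(\<lambda>r. \<integral>s. norm (case (r, s) of (r, s) \<Rightarrow> g s * p r) \<partial>lborel) = (\<lambda>r. (\<integral>s. norm (g s) \<partial>lborel) * norm (p r))"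
        by (simp add: abs_mult)
      then show "integrable lborel (\<lambda>r. \<integral>s. norm (case (r, s) of (r, s) \<Rightarrow> g s * p r) \<partial>lborel)"
        using p by simp
    qed (use ig in auto)
    show "AE x in lborel \<Otimes>\<^sub>M lborel. norm (case x of (r, s) \<Rightarrow> ?f r s) \<le> norm (case x of (r, s) \<Rightarrow> g s * p r)"
      by (auto simp: indicator_def split: prod.split)
  qed (rule meas)
  have "(\<integral>s. (\<integral>r. ?f r s \<partial>lborel) \<partial>lborel) = (\<integral>r. (\<integral>s. ?f r s \<partial>lborel) \<partial>lborel)"
    by (rule lborel_pair.Fubini_integral[OF int])
  moreover have "(\<integral>s. ?f r s \<partial>lborel) = - (\<eta> r * p r)" for r
    using e[of r] by simp
  moreover have "(\<integral>r. ?f r s \<partial>lborel) = g s * (LINT r:{0..s}|lborel. p r)" for s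
  proof -
    have "?f r s = g s * (indicator {0..s} r *\<^sub>R p r)" for r
      using p0[of r] by (auto simp: indicator_def)
    then have "(\<integral>r. ?f r s \<partial>lborel) = (\<integral>r. g s * (indicator {0..s} r *\<^sub>R p r) \<partial>lborel)" by (simp only:)
    then show ?thesis by (simp add: set_lebesgue_integral_def)
  qed
  ultimately show ?thesis by simp
qed

lemma exists_antiderivative:
  fixes g :: "real \<Rightarrow> real"
  assumes "continuous_on UNIV g"
  shows "\<exists>F. \<forall>t. (F has_real_derivative g t) (at t)"
proof (intro exI allI)
  fix t
  have "((\<lambda>u. LBINT y=(0::real)..u. g y) has_vector_derivative g t) (at t within {-\<bar>t\<bar>-1..\<bar>t\<bar>+1})"
    using assms by (intro interval_integral_FTC2) (auto intro: continuous_on_subset)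
  then show "((\<lambda>u. LBINT y=(0::real)..u. g y) has_real_derivative g t) (at t)"
    by (simp add: has_real_derivative_iff_has_vector_derivative at_within_Icc_at)
qed

text \<open>Integration by parts turns the hypothesis into a vanishing integral of \<open>g\<close>
  against circle integral of \<open>q\<close> minus ball integral of \<open>p\<close>, for every
  continuous \<open>g\<close> supported inside (0, 1). The cutoff \<eta> may be a nonzero constant
  near the origin, so \<open>g\<close> is free of any zero-mean condition and the difference is 0
  instead of an unknown constant.\<close>

lemma radial_identity:
  fixes p q :: "pt \<Rightarrow> real"
  assumes p: "set_integrable lborel B1 p" and q: "set_integrable lborel B1 q"
    and H: "\<And>\<eta> g. test_fun B1 (\<lambda>x. \<eta> (norm x)) (\<lambda>x. (g (norm x) / norm x) *\<^sub>R x) \<Longrightarrow>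
        (LINT x:B1|lborel. \<eta> (norm x) * p x + g (norm x) * q x) = 0"
  shows "AE r in lborel. 0 < r \<and> r < 1 \<longrightarrow> circle_integral r q = (LINT x:ball 0 r|lborel. p x)"
proof -
  let ?p = "radial_density p" and ?q = "radial_density q"
  define P where "P s = (LINT r:{0..s}|lborel. ?p r)" for s
  note ip = integrable_radial_density[OF p] and iq = integrable_radial_density[OF q]
  have [measurable]: "?p \<in> borel_measurable borel" "?q \<in> borel_measurable borel"
    using ip iq by simp_all
  have [measurable]: "P \<in> borel_measurable borel"
    unfolding P_def set_lebesgue_integral_def
    by (rule lborel.borel_measurable_lebesgue_integral) (simp add: indicator_def; measurable)
  have Pb: "\<bar>P s\<bar> \<le> (\<integral>r. norm (?p r) \<partial>lborel)" for s
  proof -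
    have "\<bar>P s\<bar> \<le> (\<integral>r. norm (indicator {0..s} r *\<^sub>R ?p r) \<partial>lborel)"
      unfolding P_def set_lebesgue_integral_def unfolding real_norm_def by (rule integral_abs_bound)
    also have "\<dots> \<le> (\<integral>r. norm (?p r) \<partial>lborel)"
      using ip by (intro integral_mono integrable_norm integrable_mult_indicator) (auto simp: indicator_def)
    finally show ?thesis .
  qed
  define h where "h s = ?q s - P s" for s
  have ih: "set_integrable lborel {a..b} h" for a b
  proof -
    have "set_integrable lborel {a..b} P"
      unfolding set_integrable_def
      by (rule integrableI_bounded_set_indicator[where B="\<integral>r. norm (?p r) \<partial>lborel"])
         (use Pb emeasure_bounded_finite[of "{a..b}"] in auto)
    moreover have "set_integrable lborel {a..b} ?q"
      using iq unfolding set_integrable_def by (intro integrable_mult_indicator) auto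
    ultimately show ?thesis unfolding h_def by (intro set_integral_diff)
  qed
  have hg: "(\<integral>s. g s * h s \<partial>lborel) = 0"
    if g: "continuous_on UNIV g" "\<And>t. t \<notin> {a<..<b} \<Longrightarrow> g t = 0" and ab: "0 < a" "a < b" "b < 1" for g a b
  proof -
    obtain F where F: "\<And>t. (F has_real_derivative g t) (at t)" using exists_antiderivative[OF g(1)] by blast
    \<comment> \<open>Normalising at \<open>b\<close> makes \<eta> vanish beyond \<open>b\<close>,
      because \<open>g\<close> does; on the other side \<eta> is left with whatever constant
      results.\<close>
    define \<eta> where "\<eta> t = F t - F b" for t
    have \<eta>1: "(\<eta> has_real_derivative g t) (at t)" for t
      unfolding \<eta>_def using F[of t] by (auto intro!: derivative_eq_intros)
    have \<eta>2: "\<eta> t = 0" if "b \<le> t" for t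
    proof -
      have "\<exists>c. \<forall>t\<in>{b..}. \<eta> t = c"
      proof (rule has_field_derivative_zero_constant)
        show "(\<eta> has_real_derivative 0) (at t within {b..})" if "t \<in> {b..}" for t
          using \<eta>1[of t] g(2)[of t] that by (auto intro: has_field_derivative_at_within)
      qed auto
      then have "\<eta> t = \<eta> b" using that by auto
      then show ?thesis by (simp add: \<eta>_def)
    qed
    have c\<eta>: "continuous_on S \<eta>" for S
      by (meson \<eta>1 DERIV_isCont continuous_at_imp_continuous_on)
    then have [measurable]: "\<eta> \<in> borel_measurable borel" by (simp add: borel_measurable_continuous_onI)
    have [measurable]: "g \<in> borel_measurable borel" using g(1) by (rule borel_measurable_continuous_onI)
    have "bounded (\<eta> ` {0..b})" "bounded (g ` {0..b})"
      using c\<eta> g(1) by (auto intro!: compact_imp_bounded compact_continuous_image intro: continuous_on_subset)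
    then obtain C D where C: "\<forall>x\<in>\<eta> ` {0..b}. \<bar>x\<bar> \<le> C" and D: "\<forall>x\<in>g ` {0..b}. \<bar>x\<bar> \<le> D"
      unfolding bounded_iff real_norm_def by blast
    have C': "\<bar>\<eta> t\<bar> \<le> \<bar>C\<bar>" if "0 \<le> t" for t
      using C[rule_format, of "\<eta> t"] \<eta>2[of t] that by (cases "t \<le> b") auto
    have D': "\<bar>g t\<bar> \<le> \<bar>D\<bar>" if "0 \<le> t" for t
      using D[rule_format, of "g t"] g(2)[of t] that by (cases "t \<le> b") auto
    note T = radial_test_fun[OF ab g \<eta>1 \<eta>2]
    note R\<eta> = integral_radial_mult[OF integrable_B1[OF p], of \<eta> "\<bar>C\<bar>", OF _ C', folded radial_density_def, simplified]
    note Rg = integral_radial_mult[OF integrable_B1[OF q], of g "\<bar>D\<bar>", OF _ D', folded radial_density_def, simplified]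
    have "0 = (\<integral>x. \<eta> (norm x) * (indicator B1 x * p x) + g (norm x) * (indicator B1 x * q x) \<partial>lborel)"
      using H[OF T] unfolding set_lebesgue_integral_def by (simp add: algebra_simps)
    also have "\<dots> = (\<integral>r. \<eta> r * ?p r \<partial>lborel) + (\<integral>r. g r * ?q r \<partial>lborel)"
      using R\<eta> Rg by (simp add: Bochner_Integration.integral_add)
    also have "(\<integral>r. \<eta> r * ?p r \<partial>lborel) = - (\<integral>s. g s * P s \<partial>lborel)"
      unfolding P_def by (rule integration_by_parts_cutoff[OF ip g ab \<eta>1 \<eta>2]) (auto simp: radial_density_def)
    finally have "(\<integral>r. g r * ?q r \<partial>lborel) - (\<integral>s. g s * P s \<partial>lborel) = 0" by simp
    moreover have "integrable lborel (\<lambda>s. g s * P s)"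
    proof (rule Bochner_Integration.integrable_bound)
      have "integrable lborel g"
        by (rule integrable_continuous_compact_support[OF g(1), of "{a..b}"]) (use g(2) in auto)
      then show "integrable lborel (\<lambda>s. g s * (\<integral>r. norm (?p r) \<partial>lborel))" by simp
      show "AE s in lborel. norm (g s * P s) \<le> norm (g s * (\<integral>r. norm (?p r) \<partial>lborel))"
        using Pb by (auto simp: abs_mult intro!: mult_left_mono order_trans[OF Pb] AE_I2)
    qed measurable
    ultimately show ?thesis
      using Rg unfolding h_def by (simp add: right_diff_distrib Bochner_Integration.integral_diff)
  qed
  have "AE r in lborel. r \<in> {0<..<1} \<longrightarrow> h r = 0"
  proof (rule AE_zero_of_integral_cbox_zero)
    fix a b :: real assume sub: "cbox a b \<subseteq> {0<..<1}"
    show "set_integrable lborel (cbox a b) h" using ih by simp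
    show "(LINT x:cbox a b|lborel. h x) = 0"
    proof (cases "a < b")
      case False
      have "AE x in lborel. indicator (cbox a b) x *\<^sub>R h x = 0"
        using AE_lborel_singleton[of a] by eventually_elim (use False in \<open>auto simp: indicator_def\<close>)
      then show ?thesis unfolding set_lebesgue_integral_def by (rule integral_eq_zero_AE)
    next
      case True
      then have "a \<in> cbox a b" "b \<in> cbox a b" by auto
      then have "a \<in> {0<..<1}" "b \<in> {0<..<1}" using sub by blast+
      with True have ab: "0 < a" "a < b" "b < 1" by auto
      let ?h = "\<lambda>x. indicator {a..b} x *\<^sub>R h x"
      have i: "integrable lborel ?h" using ih by (simp add: set_integrable_def)
      note [measurable] = borel_measurable_integrable[OF i]
      have [measurable]: "bump1 n a b \<in> borel_measurable borel" for n
        by (intro borel_measurable_continuous_onI continuous_on_bump1)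
      have "(\<lambda>n. \<integral>x. bump1 n a b x * ?h x \<partial>lborel) \<longlonglongrightarrow> (\<integral>x. indicator {a<..<b} x * ?h x \<partial>lborel)"
      proof (rule integral_dominated_convergence[where w="\<lambda>x. norm (?h x)"])
        show "AE x in lborel. (\<lambda>n. bump1 n a b x * ?h x) \<longlonglongrightarrow> indicator {a<..<b} x * ?h x"
          by (intro AE_I2 tendsto_mult tendsto_const bump1_tendsto)
        have "norm (bump1 n a b x * z) \<le> norm z" for n x z
          using bump1_bounds[of n a b x] by (simp add: abs_mult mult_left_le_one_le)
        then show "AE x in lborel. norm (bump1 n a b x * ?h x) \<le> norm (?h x)" for n
          by (intro AE_I2)
      qed (use i in \<open>auto intro: integrable_norm\<close>)
      moreover have "(\<integral>x. bump1 n a b x * ?h x \<partial>lborel) = 0" for n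
      proof -
        have "bump1 n a b x * ?h x = bump1 n a b x * h x" for x
          using bump1_outside[of x a b n] by (cases "x \<in> {a<..<b}") auto
        then have "(\<integral>x. bump1 n a b x * ?h x \<partial>lborel) = (\<integral>x. bump1 n a b x * h x \<partial>lborel)" by (simp only:)
        then show ?thesis using hg[OF continuous_on_bump1 bump1_outside ab] by simp
      qed
      ultimately have "(\<integral>x. indicator {a<..<b} x * ?h x \<partial>lborel) = 0"
        by (simp add: LIMSEQ_const_iff)
      moreover have "(\<integral>x. indicator {a<..<b} x * ?h x \<partial>lborel) = (\<integral>x. ?h x \<partial>lborel)"
      proof (rule integral_cong_AE)
        show "AE x in lborel. indicator {a<..<b} x * ?h x = ?h x"
          using AE_lborel_singleton[of a] AE_lborel_singleton[of b]
          by eventually_elim (auto simp: indicator_def)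
      qed measurable
      ultimately show ?thesis by (simp add: set_lebesgue_integral_def)
    qed
  qed simp
  then show ?thesis
  proof eventually_elim
    case (elim r)
    then show ?case
      using radial_density_eq[of r q] ball_integral_radial[OF p, of r] by (auto simp: h_def P_def)
  qed
qed

section \<open>Classical and weak gradient of a variational solution\<close>

lemma C1_grad_const: "C1_grad S (\<lambda>_. c) (\<lambda>_. 0)"
  by (auto simp: C1_grad_def)

lemma C1_grad_cong:
  assumes "C1_grad S f g" "open S" "\<And>x. x \<in> S \<Longrightarrow> f x = f' x" "\<And>x. x \<in> S \<Longrightarrow> g x = g' x"
  shows "C1_grad S f' g'"
  unfolding C1_grad_def
proof
  show "continuous_on S g'"
    using C1_grad_continuous_grad[OF assms(1)] assms(4) by (rule continuous_on_eq)
  show "\<forall>x\<in>S. (f' has_derivative (\<lambda>h. g' x \<bullet> h)) (at x)"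
  proof
    fix x assume "x \<in> S"
    then show "(f' has_derivative (\<lambda>h. g' x \<bullet> h)) (at x)"
      using has_derivative_transform_within_open[OF C1_gradD[OF assms(1)] assms(2), of x f'] assms by auto
  qed
qed

lemma C1_grad_glue:
  assumes "C1_grad S f g" "C1_grad T f' g'" "open S" "open T" "S \<inter> T = {}"
  shows "C1_grad (S \<union> T) (\<lambda>x. if x \<in> S then f x else f' x) (\<lambda>x. if x \<in> S then g x else g' x)"
proof -
  have "C1_grad S (\<lambda>x. if x \<in> S then f x else f' x) (\<lambda>x. if x \<in> S then g x else g' x)"
    by (rule C1_grad_cong[OF assms(1,3)]) auto
  moreover have "C1_grad T (\<lambda>x. if x \<in> S then f x else f' x) (\<lambda>x. if x \<in> S then g x else g' x)"
    by (rule C1_grad_cong[OF assms(2,4)]) (use assms(5) in auto)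
  ultimately show ?thesis
    unfolding C1_grad_def using continuous_on_open_Un[OF assms(3,4)] by blast
qed

text \<open>A linear functional on the plane is the inner product with its values on the two basis
  vectors. Applied to both operator-valued derivatives this yields the gradient \<open>F\<close> and
  the rows \<open>H1\<close>, \<open>H2\<close> of the Hessian.\<close>

lemma C2_on_imp_C1_grad:
  assumes "C2_on S f"
  shows "\<exists>F H1 H2. C1_grad S f F \<and> C1_grad S (\<lambda>x. fst (F x)) H1 \<and> C1_grad S (\<lambda>x. snd (F x)) H2"
proof -
  from assms obtain D :: "pt \<Rightarrow> pt \<Rightarrow>\<^sub>L real" and D2 :: "pt \<Rightarrow> pt \<Rightarrow>\<^sub>L (pt \<Rightarrow>\<^sub>L real)" where
    *: "\<forall>x\<in>S. (f has_derivative blinfun_apply (D x)) (at x) \<and> (D has_derivative blinfun_apply (D2 x)) (at x)"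
    and c2: "continuous_on S D2"
    unfolding C2_on_def by (elim exE conjE)
  from * have D: "\<And>x. x \<in> S \<Longrightarrow> (f has_derivative blinfun_apply (D x)) (at x)"
    and D2: "\<And>x. x \<in> S \<Longrightarrow> (D has_derivative blinfun_apply (D2 x)) (at x)"
    by simp_all
  have cD: "continuous_on S D"
    using D2 by (meson continuous_at_imp_continuous_on has_derivative_continuous)
  have lin: "L h = (L (1,0), L (0,1)) \<bullet> h" if "linear L" for L :: "pt \<Rightarrow> real" and h
  proof -
    have "h = fst h *\<^sub>R (1,0) + snd h *\<^sub>R (0,1)" by (simp add: prod_eq_iff)
    then have "L h = L (fst h *\<^sub>R (1,0) + snd h *\<^sub>R (0,1))" by (rule arg_cong)
    also have "\<dots> = fst h *\<^sub>R L (1,0) + snd h *\<^sub>R L (0,1)"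
      by (simp only: linear_add[OF that] linear_scale[OF that])
    finally show ?thesis by (simp add: inner_prod_def mult.commute)
  qed
  have 1: "C1_grad S f (\<lambda>x. (D x (1,0), D x (0,1)))"
    unfolding C1_grad_def
  proof
    show "\<forall>x\<in>S. (f has_derivative (\<lambda>h. (D x (1,0), D x (0,1)) \<bullet> h)) (at x)"
    proof
      fix x assume "x \<in> S"
      have "blinfun_apply (D x) = (\<lambda>h. (D x (1,0), D x (0,1)) \<bullet> h)"
        by (rule ext, rule lin) (simp add: blinfun.bounded_linear_right bounded_linear.linear)
      then show "(f has_derivative (\<lambda>h. (D x (1,0), D x (0,1)) \<bullet> h)) (at x)"
        using D[OF \<open>x \<in> S\<close>] by simp
    qed
    show "continuous_on S (\<lambda>x. (D x (1,0), D x (0,1)))"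
      using cD by (intro continuous_intros)
  qed
  have 2: "C1_grad S (\<lambda>x. D x v) (\<lambda>x. (D2 x (1,0) v, D2 x (0,1) v))" for v
    unfolding C1_grad_def
  proof
    show "\<forall>x\<in>S. ((\<lambda>x. D x v) has_derivative (\<lambda>h. (D2 x (1,0) v, D2 x (0,1) v) \<bullet> h)) (at x)"
    proof
      fix x assume "x \<in> S"
      have "((\<lambda>x. D x v) has_derivative (\<lambda>h. D2 x h v)) (at x)"
        by (rule bounded_linear.has_derivative[OF blinfun.bounded_linear_left D2[OF \<open>x \<in> S\<close>]])
      moreover have "linear (\<lambda>h. D2 x h v)"
        by (intro linearI) (simp_all add: blinfun.add_right blinfun.add_left blinfun.scaleR_right blinfun.scaleR_left)
      then have "(\<lambda>h. D2 x h v) = (\<lambda>h. (D2 x (1,0) v, D2 x (0,1) v) \<bullet> h)"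
        using lin by blast
      ultimately show "((\<lambda>x. D x v) has_derivative (\<lambda>h. (D2 x (1,0) v, D2 x (0,1) v) \<bullet> h)) (at x)"
        by simp
    qed
    show "continuous_on S (\<lambda>x. (D2 x (1,0) v, D2 x (0,1) v))"
      using c2 by (intro continuous_intros)
  qed
  from 1 2[of "(1,0)"] 2[of "(0,1)"] show ?thesis by force
qed

lemma integral_grad_compact_support:
  assumes "open S" "compact K" "K \<subseteq> S" "C1_grad S f g" "\<And>x. x \<in> S \<Longrightarrow> x \<notin> K \<Longrightarrow> f x = 0" "v \<in> Basis"
  shows "set_integrable lborel S (\<lambda>x. g x \<bullet> v)" "(LINT x:S|lborel. g x \<bullet> v) = 0"
proof -
  have "v = (1, 0) \<or> v = (0, 1)" using assms(6) by (auto simp: Basis_prod_def)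
  then have "set_integrable lborel S (\<lambda>x. g x \<bullet> v) \<and> (LINT x:S|lborel. g x \<bullet> v) = 0"
  proof
    assume v: "v = (1, 0)"
    show ?thesis
      using divergence_theorem_compact_support[OF assms(1-4) C1_grad_const[of S 0] assms(5)] v by (simp add: inner_prod_def)
  next
    assume v: "v = (0, 1)"
    show ?thesis
      using divergence_theorem_compact_support[OF assms(1-3) C1_grad_const[of S 0] assms(4) _ assms(5)] v by (simp add: inner_prod_def)
  qed
  then show "set_integrable lborel S (\<lambda>x. g x \<bullet> v)" "(LINT x:S|lborel. g x \<bullet> v) = 0" by auto
qed

lemma set_integrable_mult_bounded:
  fixes f k :: "pt \<Rightarrow> real"
  assumes f: "set_integrable lborel S f" and [measurable]: "k \<in> borel_measurable borel"
    and bd: "\<And>x. \<bar>k x\<bar> \<le> C"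
  shows "set_integrable lborel S (\<lambda>x. f x * k x)"
proof -
  have [measurable]: "(\<lambda>x. indicator S x *\<^sub>R f x) \<in> borel_measurable lborel"
    using f unfolding set_integrable_def by (rule borel_measurable_integrable)
  have "integrable lborel (\<lambda>x. indicator S x *\<^sub>R f x * k x)"
  proof (rule Bochner_Integration.integrable_bound)
    show "integrable lborel (\<lambda>x. norm (indicator S x *\<^sub>R f x) * C)"
      using f unfolding set_integrable_def by (intro integrable_mult_left integrable_norm)
    show "AE x in lborel. norm (indicator S x *\<^sub>R f x * k x) \<le> norm (norm (indicator S x *\<^sub>R f x) * C)"
    proof (rule AE_I2)
      fix x
      have "\<bar>indicator S x *\<^sub>R f x\<bar> * \<bar>k x\<bar> \<le> \<bar>indicator S x *\<^sub>R f x\<bar> * \<bar>C\<bar>"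
        using bd[of x] by (intro mult_left_mono) auto
      then show "norm (indicator S x *\<^sub>R f x * k x) \<le> norm (norm (indicator S x *\<^sub>R f x) * C)"
        by (simp add: abs_mult)
    qed
  qed measurable
  then show ?thesis by (simp add: set_integrable_def mult.assoc)
qed

lemma test_fun_bounded:
  assumes "test_fun S f g"
  obtains C where "C \<ge> 0" "\<And>x. \<bar>f x\<bar> \<le> C" "\<And>x. norm (g x) \<le> C"
proof -
  obtain K where K: "compact K" "\<And>x. x \<notin> K \<Longrightarrow> f x = 0" "\<And>x. x \<notin> K \<Longrightarrow> g x = 0"
    using test_funD[OF assms] by metis
  have "C1_grad UNIV f g" using assms by (simp add: test_fun_def)
  then have "continuous_on K f" "continuous_on K g"
    by (meson C1_grad_continuous C1_grad_continuous_grad continuous_on_subset subset_UNIV)+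
  then have "bounded (f ` K)" "bounded (g ` K)"
    using K(1) by (auto intro: compact_imp_bounded compact_continuous_image)
  then obtain A B where A: "\<forall>x\<in>f ` K. norm x \<le> A" and B: "\<forall>x\<in>g ` K. norm x \<le> B"
    unfolding bounded_iff by blast
  have "\<bar>f x\<bar> \<le> max 0 (max A B)" for x
    using A[rule_format, of "f x"] K(2)[of x] by (cases "x \<in> K") auto
  moreover have "norm (g x) \<le> max 0 (max A B)" for x
    using B[rule_format, of "g x"] K(3)[of x] by (cases "x \<in> K") auto
  ultimately show thesis using that[of "max 0 (max A B)"] by simp
qed

lemma test_fun_measurable:
  assumes "test_fun S f g"
  shows "f \<in> borel_measurable borel" "g \<in> borel_measurable borel"
proof -
  have "C1_grad UNIV f g" using assms by (simp add: test_fun_def)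
  then show "f \<in> borel_measurable borel" "g \<in> borel_measurable borel"
    by (auto intro: borel_measurable_continuous_onI C1_grad_continuous C1_grad_continuous_grad)
qed

lemma test_fun_mult:
  assumes "test_fun S f g" "C1_grad UNIV k h"
  shows "test_fun S (\<lambda>x. f x * k x) (\<lambda>x. f x *\<^sub>R h x + k x *\<^sub>R g x)"
  using assms C1_grad_mult[of UNIV f g k h] unfolding test_fun_def by (metis mult_zero_left)

section \<open>The solution off its zero set\<close>

locale variational =
  fixes \<rho>p \<rho>m :: real and u :: "pt \<Rightarrow> real" and G :: "pt \<Rightarrow> pt"
  assumes vs: "variational_solution \<rho>p \<rho>m u G"
begin

text \<open>Zeros of \<open>u\<close> inside \<open>Omega_plus u\<close> are left out too, although
  \<open>u\<close> is C^2 there: the truncations of \<open>u\<close> are supported where |u| is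
  bounded below, and such sets meet a compact set in a compact subset of \<open>P\<close>.\<close>

definition P where "P = {x \<in> B1. u x \<noteq> 0}"

lemma u_cont: "continuous_on B1 u"
  and iu2: "set_integrable lborel B1 (\<lambda>x. (u x)\<^sup>2)"
  and iG2: "set_integrable lborel B1 (\<lambda>x. (norm (G x))\<^sup>2)"
  and iu: "set_integrable lborel B1 u"
  and iG: "set_integrable lborel B1 G"
  using vs unfolding variational_solution_def H1_with_gradient_def weak_gradient_on_def by auto

lemma weak_grad:
  assumes "test_fun B1 \<psi> g" "v \<in> Basis"
  shows "(LINT x:B1|lborel. u x * (g x \<bullet> v)) = - (LINT x:B1|lborel. (G x \<bullet> v) * \<psi> x)"
proof -
  have "(LINT x:B1|lborel. u x * frechet_derivative \<psi> (at x) v) = - (LINT x:B1|lborel. (G x \<bullet> v) * \<psi> x)"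
    using vs test_fun_C1c(1)[OF assms(1)] assms(2)
    unfolding variational_solution_def H1_with_gradient_def weak_gradient_on_def by blast
  then show ?thesis by (simp add: test_fun_C1c(2)[OF assms(1)])
qed

lemma open_B1: "open B1" by (simp add: B1_def)

lemma P_sub: "P \<subseteq> B1" by (auto simp: P_def)

lemma open_pos: "open {x \<in> B1. u x > 0}" and open_neg: "open {x \<in> B1. u x < 0}"
proof -
  have "open (B1 \<inter> u -` {0<..})" "open (B1 \<inter> u -` {..<0})"
    using u_cont open_B1 by (auto intro: continuous_open_preimage)
  then show "open {x \<in> B1. u x > 0}" "open {x \<in> B1. u x < 0}"
    by (simp_all add: vimage_def Int_def)
qed

lemma P_eq: "P = {x \<in> B1. u x > 0} \<union> {x \<in> B1. u x < 0}" by (auto simp: P_def)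

lemma open_P: "open P" unfolding P_eq using open_pos open_neg by blast

lemma pos_sub: "{x \<in> B1. u x > 0} \<subseteq> Omega_plus u"
  unfolding Omega_plus_def by (rule interior_maximal[OF _ open_pos]) auto

text \<open>The sets where \<open>u\<close> is positive and negative are open and disjoint, so the
  derivatives from the two phases can be glued with no matching condition at the interface.\<close>

lemma ex_classical_gradient:
  "\<exists>F H1 H2. C1_grad P u F \<and> C1_grad P (\<lambda>x. fst (F x)) H1 \<and> C1_grad P (\<lambda>x. snd (F x)) H2"
proof -
  let ?p = "{x \<in> B1. u x > 0}" and ?m = "{x \<in> B1. u x < 0}"
  have "C2_on (Omega_plus u) u" "C2_on ?m u"
    using vs unfolding variational_solution_def Omega_minus_def by auto
  note C = this[THEN C2_on_imp_C1_grad]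
  from C(1) obtain F H1 H2 where
    1: "C1_grad (Omega_plus u) u F" "C1_grad (Omega_plus u) (\<lambda>x. fst (F x)) H1" "C1_grad (Omega_plus u) (\<lambda>x. snd (F x)) H2"
    by (elim exE conjE)
  from C(2) obtain F' H1' H2' where
    2: "C1_grad ?m u F'" "C1_grad ?m (\<lambda>x. fst (F' x)) H1'" "C1_grad ?m (\<lambda>x. snd (F' x)) H2'"
    by (elim exE conjE)
  note 1 = 1[THEN C1_grad_subset[OF _ pos_sub]]
  have d: "?p \<inter> ?m = {}" by auto
  let ?F = "\<lambda>x. if x \<in> ?p then F x else F' x"
  let ?H1 = "\<lambda>x. if x \<in> ?p then H1 x else H1' x" and ?H2 = "\<lambda>x. if x \<in> ?p then H2 x else H2' x"
  have "C1_grad P (\<lambda>x. if x \<in> ?p then u x else u x) ?F"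
    unfolding P_eq by (rule C1_grad_glue[OF 1(1) 2(1) open_pos open_neg d])
  moreover have "C1_grad P (\<lambda>x. if x \<in> ?p then fst (F x) else fst (F' x)) ?H1"
    unfolding P_eq by (rule C1_grad_glue[OF 1(2) 2(2) open_pos open_neg d])
  moreover have "C1_grad P (\<lambda>x. if x \<in> ?p then snd (F x) else snd (F' x)) ?H2"
    unfolding P_eq by (rule C1_grad_glue[OF 1(3) 2(3) open_pos open_neg d])
  ultimately have "C1_grad P u ?F \<and> C1_grad P (\<lambda>x. fst (?F x)) ?H1 \<and> C1_grad P (\<lambda>x. snd (?F x)) ?H2"
    by (simp only: if_distrib[of fst] if_distrib[of snd] if_cancel simp_thms)
  then show ?thesis by blast
qed

text \<open>The density is constant on each of the two open pieces of \<open>P\<close>, so it may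
  enter a field to be differentiated there as a C^1 factor with gradient 0.\<close>

lemma rho_C1: "C1_grad P (rho_chi \<rho>p \<rho>m u) (\<lambda>_. 0)"
proof -
  let ?p = "{x \<in> B1. u x > 0}" and ?m = "{x \<in> B1. u x < 0}"
  have "C1_grad P (\<lambda>x. if x \<in> ?p then \<rho>p else \<rho>m) (\<lambda>x. if x \<in> ?p then 0 else 0)"
    unfolding P_eq by (rule C1_grad_glue[OF C1_grad_const C1_grad_const open_pos open_neg]) auto
  then show ?thesis
  proof (rule C1_grad_cong[OF _ open_P])
    fix x assume "x \<in> P"
    have "Omega_plus u \<subseteq> {x \<in> B1. u x \<ge> 0}" unfolding Omega_plus_def by (rule interior_subset)
    then show "(if x \<in> ?p then \<rho>p else \<rho>m) = rho_chi \<rho>p \<rho>m u x"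
      using pos_sub \<open>x \<in> P\<close> unfolding rho_chi_def Omega_minus_def P_def by (auto simp: indicator_def)
  qed auto
qed

lemma rho_measurable [measurable]: "rho_chi \<rho>p \<rho>m u \<in> borel_measurable borel"
proof -
  have [measurable]: "Omega_plus u \<in> sets borel" "Omega_minus u \<in> sets borel"
    using open_neg by (auto simp: Omega_plus_def Omega_minus_def)
  show ?thesis unfolding rho_chi_def[abs_def] by measurable
qed

lemma rho_bounded: "\<bar>rho_chi \<rho>p \<rho>m u x\<bar> \<le> \<bar>\<rho>p\<bar> + \<bar>\<rho>m\<bar>"
  by (auto simp: rho_chi_def indicator_def)

end

text \<open>Fixes one classical gradient and the rows of its Hessian;
  \<open>fst (H1 x) + snd (H2 x)\<close> is the Laplacian of \<open>u\<close>.\<close>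

locale variational_classical = variational +
  fixes F H1 H2
  assumes F: "C1_grad P u F" "C1_grad P (\<lambda>x. fst (F x)) H1" "C1_grad P (\<lambda>x. snd (F x)) H2"
begin

lemma iGv: "set_integrable lborel B1 (\<lambda>x. G x \<bullet> v)"
proof -
  have "integrable lborel (\<lambda>x. (indicator B1 x *\<^sub>R G x) \<bullet> v)"
    using iG unfolding set_integrable_def by (intro integrable_inner_left) auto
  then show ?thesis by (simp add: set_integrable_def)
qed

lemma inner_Basis_bound: "v \<in> Basis \<Longrightarrow> \<bar>(x::pt) \<bullet> v\<bar> \<le> norm x"
  by (simp add: Basis_le_norm)

text \<open>For test functions supported in \<open>P\<close> the classical product rule shows that
  \<open>F\<close> satisfies the same integration by parts as \<open>G\<close>; the fundamental
  lemma, applied componentwise, identifies the two.\<close>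

lemma G_eq_F: "AE x in lborel. x \<in> P \<longrightarrow> G x = F x"
proof -
  have "AE x in lborel. x \<in> P \<longrightarrow> (G x - F x) \<bullet> v = 0" if v: "v \<in> Basis" for v
  proof (rule AE_zero_of_test_fun[OF open_P])
    have GP: "set_integrable lborel P (\<lambda>x. G x \<bullet> v)"
      using open_P by (intro set_integrable_subset[OF iGv] P_sub) auto
    fix a b :: pt assume ab: "cbox a b \<subseteq> P"
    have "continuous_on (cbox a b) (\<lambda>x. F x \<bullet> v)"
      using C1_grad_continuous_grad[OF F(1)] ab by (intro continuous_intros) (rule continuous_on_subset)
    then have "set_integrable lborel (cbox a b) (\<lambda>x. F x \<bullet> v)"
      unfolding set_integrable_def by (intro borel_integrable_compact compact_cbox)
    moreover have "set_integrable lborel (cbox a b) (\<lambda>x. G x \<bullet> v)"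
      by (rule set_integrable_subset[OF GP _ ab]) simp
    ultimately show "set_integrable lborel (cbox a b) (\<lambda>x. (G x - F x) \<bullet> v)"
      unfolding inner_diff_left by (intro set_integral_diff(1))
  next
    fix \<psi> g assume t: "test_fun P \<psi> g"
    obtain C where C: "\<And>x. \<bar>\<psi> x\<bar> \<le> C" "\<And>x. norm (g x) \<le> C" using test_fun_bounded[OF t] by metis
    obtain K where K: "compact K" "K \<subseteq> P" "\<And>x. x \<notin> K \<Longrightarrow> \<psi> x = 0" "\<And>x. x \<notin> K \<Longrightarrow> g x = 0"
      using test_funD[OF t] by metis
    note [measurable] = test_fun_measurable[OF t]
    have C1: "C1_grad P \<psi> g" using t by (auto simp: test_fun_def intro: C1_grad_subset)
    note D = integral_grad_compact_support[OF open_P K(1,2) C1_grad_mult[OF F(1) C1] _ v]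
    have I: "set_integrable lborel P (\<lambda>x. u x * (g x \<bullet> v) + \<psi> x * (F x \<bullet> v))"
      "(LINT x:P|lborel. u x * (g x \<bullet> v) + \<psi> x * (F x \<bullet> v)) = 0"
      using D K(3) by (simp_all add: inner_add_left)
    have b: "\<bar>g x \<bullet> v\<bar> \<le> C" for x using inner_Basis_bound[OF v, of "g x"] C(2)[of x] by linarith
    have iug: "set_integrable lborel P (\<lambda>x. u x * (g x \<bullet> v))"
      using open_P by (intro set_integrable_mult_bounded[OF set_integrable_subset[OF iu _ P_sub] _ b]) auto
    have iF: "set_integrable lborel P (\<lambda>x. \<psi> x * (F x \<bullet> v))"
      using set_integral_diff(1)[OF I(1) iug] by simp
    have iGp: "set_integrable lborel P (\<lambda>x. (G x \<bullet> v) * \<psi> x)"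
      using open_P by (intro set_integrable_mult_bounded[OF set_integrable_subset[OF iGv _ P_sub] _ C(1)]) auto
    have e1: "(LINT x:P|lborel. u x * (g x \<bullet> v)) = (LINT x:B1|lborel. u x * (g x \<bullet> v))"
      unfolding set_lebesgue_integral_def
    proof (intro Bochner_Integration.integral_cong refl)
      fix x show "indicator P x *\<^sub>R (u x * (g x \<bullet> v)) = indicator B1 x *\<^sub>R (u x * (g x \<bullet> v))"
        using K(2) K(4)[of x] P_sub by (cases "x \<in> K") (auto simp: indicator_def)
    qed
    have e2: "(LINT x:P|lborel. (G x \<bullet> v) * \<psi> x) = (LINT x:B1|lborel. (G x \<bullet> v) * \<psi> x)"
      unfolding set_lebesgue_integral_def
    proof (intro Bochner_Integration.integral_cong refl)
      fix x show "indicator P x *\<^sub>R ((G x \<bullet> v) * \<psi> x) = indicator B1 x *\<^sub>R ((G x \<bullet> v) * \<psi> x)"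
        using K(2) K(3)[of x] P_sub by (cases "x \<in> K") (auto simp: indicator_def)
    qed
    have "(LINT x:P|lborel. u x * (g x \<bullet> v)) + (LINT x:P|lborel. \<psi> x * (F x \<bullet> v)) = 0"
      using I(2) set_integral_add(2)[OF iug iF] by simp
    moreover have "(LINT x:B1|lborel. u x * (g x \<bullet> v)) = - (LINT x:B1|lborel. (G x \<bullet> v) * \<psi> x)"
      by (rule weak_grad[OF test_fun_mono[OF t P_sub] v])
    moreover have "(LINT x:P|lborel. (G x - F x) \<bullet> v * \<psi> x)
        = (LINT x:P|lborel. (G x \<bullet> v) * \<psi> x) - (LINT x:P|lborel. \<psi> x * (F x \<bullet> v))"
      using set_integral_diff(2)[OF iGp iF] by (simp add: inner_diff_left left_diff_distrib right_diff_distrib mult.commute)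
    ultimately show "(LINT x:P|lborel. (G x - F x) \<bullet> v * \<psi> x) = 0"
      using e1 e2 by simp
  qed
  then have "AE x in lborel. \<forall>v\<in>Basis. x \<in> P \<longrightarrow> (G x - F x) \<bullet> v = 0"
    by (intro AE_finite_allI) auto
  then show ?thesis
  proof eventually_elim
    case (elim x)
    then show ?case using euclidean_eq_iff[of "G x" "F x"] by (auto simp: inner_diff_left)
  qed
qed

text \<open>Dominated convergence for the passage from truncated integrals over \<open>P\<close>,
  written with \<open>F\<close>, to an integral over the disk written with \<open>G\<close>.
  Convergence and domination are asked only where \<open>G\<close> and \<open>F\<close> agree, and
  \<open>off\<close> says that the limit integrand ignores the zero set.\<close>

lemma integral_zero_by_cut_limit:
  assumes w: "\<And>n. set_integrable lborel P (w n)" "\<And>n. (LINT x:P|lborel. w n x) = 0"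
    and f: "set_integrable lborel B1 f" and k: "set_integrable lborel B1 k"
    and lim: "\<And>x. x \<in> P \<Longrightarrow> G x = F x \<Longrightarrow> (\<lambda>n. w n x) \<longlonglongrightarrow> f x"
    and bd: "\<And>x n. x \<in> P \<Longrightarrow> G x = F x \<Longrightarrow> \<bar>w n x\<bar> \<le> k x"
    and off: "AE x in lborel. x \<in> B1 - P \<longrightarrow> f x = (0::real)"
  shows "(LINT x:B1|lborel. f x) = 0"
proof -
  have "(\<lambda>n. \<integral>x. indicator P x *\<^sub>R w n x \<partial>lborel) \<longlonglongrightarrow> (\<integral>x. indicator B1 x *\<^sub>R f x \<partial>lborel)"
  proof (rule integral_dominated_convergence[where w="\<lambda>x. norm (indicator B1 x *\<^sub>R k x)"])
    show "(\<lambda>x. indicator B1 x *\<^sub>R f x) \<in> borel_measurable lborel"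
      using f unfolding set_integrable_def by (rule borel_measurable_integrable)
    show "(\<lambda>x. indicator P x *\<^sub>R w n x) \<in> borel_measurable lborel" for n
      using w(1)[of n] unfolding set_integrable_def by (rule borel_measurable_integrable)
    show "integrable lborel (\<lambda>x. norm (indicator B1 x *\<^sub>R k x))"
      using k unfolding set_integrable_def by (rule integrable_norm)
    show "AE x in lborel. (\<lambda>n. indicator P x *\<^sub>R w n x) \<longlonglongrightarrow> indicator B1 x *\<^sub>R f x"
      using G_eq_F off
    proof eventually_elim
      case (elim x)
      then show ?case using lim[of x] P_sub by (cases "x \<in> P") (auto simp: indicator_def)
    qed
    show "AE x in lborel. norm (indicator P x *\<^sub>R w n x) \<le> norm (indicator B1 x *\<^sub>R k x)" for n
      using G_eq_F
    proof eventually_elim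
      case (elim x)
      then show ?case using bd[of x n] P_sub by (cases "x \<in> P") (auto simp: indicator_def)
    qed
  qed
  then show ?thesis
    using w(2) by (simp add: set_lebesgue_integral_def LIMSEQ_const_iff)
qed

text \<open>On this set u^2 is at least 1/n, so it stays away from the zero set, and continuity of
  \<open>u\<close> makes it closed in \<open>K\<close>. A factor \<open>cut n (u x)\<close> thus
  turns anything supported in \<open>K\<close> into something compactly supported in
  \<open>P\<close>.\<close>

lemma cut_support:
  assumes "compact K" "K \<subseteq> B1"
  shows "compact {x \<in> K. 1 \<le> real n * (u x)\<^sup>2}" "{x \<in> K. 1 \<le> real n * (u x)\<^sup>2} \<subseteq> P"
    and "x \<notin> {x \<in> K. 1 \<le> real n * (u x)\<^sup>2} \<Longrightarrow> x \<in> K \<Longrightarrow> cut n (u x) = 0"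
proof -
  have "continuous_on K (\<lambda>x. real n * (u x)\<^sup>2)"
    using u_cont assms(2) by (intro continuous_intros) (rule continuous_on_subset)
  then have "closedin (top_of_set K) (K \<inter> (\<lambda>x. real n * (u x)\<^sup>2) -` {1..})"
    by (intro continuous_closedin_preimage) auto
  then have "compact (K \<inter> (\<lambda>x. real n * (u x)\<^sup>2) -` {1..})"
    using assms(1) closedin_compact by blast
  moreover have "K \<inter> (\<lambda>x. real n * (u x)\<^sup>2) -` {1..} = {x \<in> K. 1 \<le> real n * (u x)\<^sup>2}" by auto
  ultimately show "compact {x \<in> K. 1 \<le> real n * (u x)\<^sup>2}" by simp
  show "{x \<in> K. 1 \<le> real n * (u x)\<^sup>2} \<subseteq> P" using assms(2) by (auto simp: P_def)
  show "x \<notin> {x \<in> K. 1 \<le> real n * (u x)\<^sup>2} \<Longrightarrow> x \<in> K \<Longrightarrow> cut n (u x) = 0"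
    by (auto intro: cut_eq_0)
qed

lemma C1_grad_cut_u: "C1_grad P (\<lambda>x. cut n (u x)) (\<lambda>x. cut' n (u x) *\<^sub>R F x)"
  by (rule C1_grad_compose[OF F(1) DERIV_cut continuous_on_cut'])

text \<open>
  Letting \<open>n \<rightarrow> \<infinity>\<close> in \<open>\<integral>\<partial>\<^sub>v(cut n u \<psi>) = 0\<close> shows that \<open>G\<close> restricted to \<open>P\<close> is also a weak gradient of \<open>u\<close>.
\<close>

lemma G_eq_0: "AE x in lborel. x \<in> B1 - P \<longrightarrow> G x = 0"
proof -
  have "AE x in lborel. x \<in> B1 \<longrightarrow> (G x \<bullet> v) * indicator (- P) x = 0" if v: "v \<in> Basis" for v
  proof (rule AE_zero_of_test_fun[OF open_B1])
    have [measurable]: "P \<in> sets borel" using open_P by simp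
    have iGoff: "set_integrable lborel B1 (\<lambda>x. (G x \<bullet> v) * indicator (- P) x)"
      by (rule set_integrable_mult_bounded[OF iGv, of _ 1]) (auto simp: indicator_def)
    then show "set_integrable lborel (cbox a b) (\<lambda>x. (G x \<bullet> v) * indicator (- P) x)" if "cbox a b \<subseteq> B1" for a b
      by (rule set_integrable_subset) (use that in auto)
    fix \<psi> g assume t: "test_fun B1 \<psi> g"
    obtain C where C: "C \<ge> 0" "\<And>x. \<bar>\<psi> x\<bar> \<le> C" "\<And>x. norm (g x) \<le> C" using test_fun_bounded[OF t] by metis
    obtain K where K: "compact K" "K \<subseteq> B1" "\<And>x. x \<notin> K \<Longrightarrow> \<psi> x = 0" "\<And>x. x \<notin> K \<Longrightarrow> g x = 0"
      using test_funD[OF t] by metis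
    note [measurable] = test_fun_measurable[OF t]
    have C1: "C1_grad P \<psi> g" using t by (auto simp: test_fun_def intro: C1_grad_subset)
    have b: "\<bar>g x \<bullet> v\<bar> \<le> C" for x using inner_Basis_bound[OF v, of "g x"] C(3)[of x] by linarith
    let ?w = "\<lambda>n x. cut n (u x) * (g x \<bullet> v) + \<psi> x * cut' n (u x) * (F x \<bullet> v)"
    \<comment> \<open>The indicator of \<open>P\<close> is built into the limit because nothing is
      known yet about \<open>G\<close> on the zero set.\<close>
    let ?f = "\<lambda>x. u x * (g x \<bullet> v) + (G x \<bullet> v) * (\<psi> x * indicator P x)"
    have i1: "set_integrable lborel B1 (\<lambda>x. u x * (g x \<bullet> v))"
      by (rule set_integrable_mult_bounded[OF iu _ b]) measurable
    have b2: "\<bar>\<psi> x * indicator P x\<bar> \<le> C" for x using C(1) C(2)[of x] by (auto simp: indicator_def)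
    have i2: "set_integrable lborel B1 (\<lambda>x. (G x \<bullet> v) * (\<psi> x * indicator P x))"
      by (rule set_integrable_mult_bounded[OF iGv _ b2]) measurable
    have i3: "set_integrable lborel B1 (\<lambda>x. (G x \<bullet> v) * \<psi> x)"
      by (rule set_integrable_mult_bounded[OF iGv _ C(2)]) measurable
    have "(LINT x:B1|lborel. ?f x) = 0"
    proof (rule integral_zero_by_cut_limit)
      fix n
      note s = cut_support[OF K(1,2), where n=n]
      note D = integral_grad_compact_support[OF open_P s(1,2) C1_grad_mult[OF C1_grad_cut_u C1] _ v]
      have "cut n (u x) * \<psi> x = 0" if "x \<notin> {x \<in> K. 1 \<le> real n * (u x)\<^sup>2}" for x
        using s(3)[OF that] K(3) by (cases "x \<in> K") auto
      then show "set_integrable lborel P (?w n)" "(LINT x:P|lborel. ?w n x) = 0"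
        using D by (simp_all add: inner_add_left mult.assoc)
    next
      show "set_integrable lborel B1 ?f" using i1 i2 by (rule set_integral_add)
      show "set_integrable lborel B1 (\<lambda>x. C * \<bar>u x\<bar> + 9 * C * \<bar>G x \<bullet> v\<bar>)"
        using iu iGv[of v] by (intro set_integral_add set_integrable_mult_right set_integrable_abs)
      show "(\<lambda>n. ?w n x) \<longlonglongrightarrow> ?f x" if "x \<in> P" "G x = F x" for x
      proof -
        have "(\<lambda>n. ?w n x) \<longlonglongrightarrow> u x * (g x \<bullet> v) + \<psi> x * 1 * (F x \<bullet> v)"
          by (intro tendsto_intros cut_tendsto cut'_tendsto) (use that in \<open>auto simp: P_def\<close>)
        then show ?thesis using that by (simp add: mult.commute)
      qed
      show "\<bar>?w n x\<bar> \<le> C * \<bar>u x\<bar> + 9 * C * \<bar>G x \<bullet> v\<bar>" if "x \<in> P" "G x = F x" for x n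
      proof -
        have "\<bar>cut n (u x) * (g x \<bullet> v)\<bar> \<le> \<bar>u x\<bar> * C"
          unfolding abs_mult using b[of x] C(1) by (intro mult_mono cut_bound) auto
        moreover have "\<bar>\<psi> x * cut' n (u x) * (F x \<bullet> v)\<bar> \<le> C * 9 * \<bar>F x \<bullet> v\<bar>"
          unfolding abs_mult using C by (intro mult_mono cut'_bound) auto
        ultimately show ?thesis using that by (simp add: mult.commute)
      qed
      show "AE x in lborel. x \<in> B1 - P \<longrightarrow> ?f x = 0"
        by (auto simp: P_def)
    qed
    then have "(LINT x:B1|lborel. u x * (g x \<bullet> v)) + (LINT x:B1|lborel. (G x \<bullet> v) * (\<psi> x * indicator P x)) = 0"
      using set_integral_add(2)[OF i1 i2] by simp
    \<comment> \<open>The weak gradient identity with the full \<open>G\<close> replaces the first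
      term, so that only the part of \<open>G\<close> off \<open>P\<close> is left against
      \<psi>.\<close>
    then have "(LINT x:B1|lborel. (G x \<bullet> v) * \<psi> x) - (LINT x:B1|lborel. (G x \<bullet> v) * (\<psi> x * indicator P x)) = 0"
      using weak_grad[OF t v] by simp
    then have "(LINT x:B1|lborel. (G x \<bullet> v) * \<psi> x - (G x \<bullet> v) * (\<psi> x * indicator P x)) = 0"
      using set_integral_diff(2)[OF i3 i2] by simp
    moreover have "(G x \<bullet> v) * indicator (- P) x * \<psi> x = (G x \<bullet> v) * \<psi> x - (G x \<bullet> v) * (\<psi> x * indicator P x)" for x
      by (auto simp: indicator_def)
    ultimately show "(LINT x:B1|lborel. (G x \<bullet> v) * indicator (- P) x * \<psi> x) = 0" by (simp only:)
  qed
  then have "AE x in lborel. \<forall>v\<in>Basis. x \<in> B1 \<longrightarrow> (G x \<bullet> v) * indicator (- P) x = 0"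
    by (intro AE_finite_allI) auto
  then show ?thesis
  proof eventually_elim
    case (elim x)
    then show ?case using euclidean_eq_iff[of "G x" 0] by auto
  qed
qed

end

section \<open>Integral identities\<close>

context variational
begin

text \<open>Measurability of \<open>u\<close> and \<open>G\<close> is known only on the disk; their
  extensions by 0 are measurable on the plane and let measurability of compound integrands be
  derived structurally.\<close>

definition u0 where "u0 x = indicator B1 x * u x"
definition G0 where "G0 x = indicator B1 x *\<^sub>R G x"

lemma u0_measurable [measurable]: "u0 \<in> borel_measurable borel"
  using borel_measurable_integrable[OF iu[unfolded set_integrable_def]] by (simp add: u0_def[abs_def])

lemma G0_measurable [measurable]: "G0 \<in> borel_measurable borel"
  using borel_measurable_integrable[OF iG[unfolded set_integrable_def]] by (simp add: G0_def[abs_def])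

lemma fst_snd_measurable [measurable]:
  "(fst :: pt \<Rightarrow> real) \<in> borel_measurable borel" "(snd :: pt \<Rightarrow> real) \<in> borel_measurable borel"
  by (auto intro!: borel_measurable_continuous_onI continuous_intros)

lemma indicator_B1_measurable:
  assumes [measurable]: "(\<lambda>x. \<Phi> x (u0 x) (G0 x)) \<in> borel_measurable borel"
  shows "(\<lambda>x. indicator B1 x *\<^sub>R (\<Phi> x (u x) (G x) :: real)) \<in> borel_measurable borel"
proof -
  have [measurable]: "B1 \<in> sets borel" by (simp add: B1_def)
  have "(\<lambda>x. indicator B1 x *\<^sub>R \<Phi> x (u x) (G x)) = (\<lambda>x. indicator B1 x *\<^sub>R \<Phi> x (u0 x) (G0 x))"
    by (auto simp: u0_def G0_def indicator_def)
  then show ?thesis by simp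
qed

text \<open>All integrands below grow at most quadratically in \<open>u\<close> and
  \<open>G\<close>, and 1 + u^2 + |G|^2 is integrable because the disk has finite measure and
  \<open>u\<close> lies in H^1. The form with \<Phi> allows measurability to be checked at
  \<open>u0\<close> and \<open>G0\<close>.\<close>

lemma set_integrable_quadratic:
  assumes "(\<lambda>x. \<Phi> x (u0 x) (G0 x)) \<in> borel_measurable borel"
    and "\<And>x. x \<in> B1 \<Longrightarrow> \<bar>\<Phi> x (u x) (G x)\<bar> \<le> C * (1 + (u x)\<^sup>2 + (norm (G x))\<^sup>2)"
  shows "set_integrable lborel B1 (\<lambda>x. \<Phi> x (u x) (G x) :: real)"
  unfolding set_integrable_def
proof (rule Bochner_Integration.integrable_bound)
  have "set_integrable lborel B1 (\<lambda>x. 1::real)"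
    using emeasure_bounded_finite[of B1] open_B1 unfolding B1_def set_integrable_def by simp
  then have "set_integrable lborel B1 (\<lambda>x. C * (1 + (u x)\<^sup>2 + (norm (G x))\<^sup>2))"
    using iu2 iG2 by (intro set_integrable_mult_right set_integral_add)
  then show "integrable lborel (\<lambda>x. indicator B1 x *\<^sub>R (C * (1 + (u x)\<^sup>2 + (norm (G x))\<^sup>2)))"
    by (simp add: set_integrable_def)
  show "(\<lambda>x. indicator B1 x *\<^sub>R \<Phi> x (u x) (G x)) \<in> borel_measurable lborel"
    using indicator_B1_measurable[of \<Phi>, OF assms(1)] by simp
  show "AE x in lborel. norm (indicator B1 x *\<^sub>R \<Phi> x (u x) (G x))
      \<le> norm (indicator B1 x *\<^sub>R (C * (1 + (u x)\<^sup>2 + (norm (G x))\<^sup>2)))"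
  proof (rule AE_I2)
    fix x
    show "norm (indicator B1 x *\<^sub>R \<Phi> x (u x) (G x)) \<le> norm (indicator B1 x *\<^sub>R (C * (1 + (u x)\<^sup>2 + (norm (G x))\<^sup>2)))"
      using order_trans[OF assms(2)[of x] abs_ge_self] by (cases "x \<in> B1") simp_all
  qed
qed

lemma norm_B1: "x \<in> B1 \<Longrightarrow> norm x \<le> 1"
  by (simp add: B1_def)

lemma prod_le_squares: "\<bar>a\<bar> * \<bar>b\<bar> \<le> 1 + a\<^sup>2 + (b::real)\<^sup>2"
proof -
  have "2 * (\<bar>a\<bar> * \<bar>b\<bar>) \<le> a\<^sup>2 + b\<^sup>2"
    using sum_squares_bound[of "\<bar>a\<bar>" "\<bar>b\<bar>"] by (simp add: mult.assoc)
  moreover have "0 \<le> \<bar>a\<bar> * \<bar>b\<bar>" by simp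
  ultimately show ?thesis by linarith
qed

text \<open>The variational identity in coordinates, for a field with components \<open>f1\<close>
  and \<open>f2\<close>. The isolated \<open>f2\<close> is the derivative of y in div (y \<phi>) = y
  div \<phi> + f2.\<close>

lemma variational_identity:
  assumes t1: "test_fun B1 f1 g1" and t2: "test_fun B1 f2 g2"
  shows "(LINT x:B1|lborel. (norm (G x))\<^sup>2 * (fst (g1 x) + snd (g2 x))
      - 2 * (fst (G x) * (g1 x \<bullet> G x) + snd (G x) * (g2 x \<bullet> G x))
      - rho_chi \<rho>p \<rho>m u x * (snd x * (fst (g1 x) + snd (g2 x)) + f2 x)) = 0"
proof -
  let ?\<phi> = "\<lambda>x. (f1 x, f2 x)"
  have f: "frechet_derivative ?\<phi> (at x) = (\<lambda>h. (g1 x \<bullet> h, g2 x \<bullet> h))" for x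
    using frechet_derivative_at[OF test_fun_pair_C1c(2)[OF t1 t2]] by simp
  have d: "divergence ?\<phi> x = fst (g1 x) + snd (g2 x)" for x
    by (simp add: divergence_def f inner_prod_def)
  have e: "(\<lambda>p. snd p *\<^sub>R ?\<phi> p) = (\<lambda>p. (f1 p * snd p, f2 p * snd p))"
    by (auto simp: mult.commute)
  note y1 = test_fun_mult[OF t1 C1_grad_snd] and y2 = test_fun_mult[OF t2 C1_grad_snd]
  have d2: "divergence (\<lambda>p. snd p *\<^sub>R ?\<phi> p) x = snd x * (fst (g1 x) + snd (g2 x)) + f2 x" for x
    unfolding e divergence_def frechet_derivative_at[OF test_fun_pair_C1c(2)[OF y1 y2], symmetric]
    by (simp add: inner_prod_def algebra_simps)
  have "0 = (LINT x:B1|lborel. (norm (G x))\<^sup>2 * divergence ?\<phi> x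
               - 2 * (G x \<bullet> frechet_derivative ?\<phi> (at x) (G x))
               - rho_chi \<rho>p \<rho>m u x * divergence (\<lambda>p. snd p *\<^sub>R ?\<phi> p) x)"
    using vs test_fun_pair_C1c(1)[OF t1 t2] unfolding variational_solution_def by blast
  then show ?thesis unfolding d d2 f by (simp add: inner_prod_def)
qed

text \<open>For \<phi> = \<psi> x the derivative is \<psi> times the identity plus a rank-one term.
  In two dimensions the divergence of the first part contributes 2 \<psi> |G|^2, which the term -2
  D\<phi>[G, G] cancels; the 3 comes from div (y x) = 3 y.\<close>

lemma identity_inner_variation:
  assumes t: "test_fun B1 \<psi> g"
  shows "(LINT x:B1|lborel. (norm (G x))\<^sup>2 * (g x \<bullet> x) - 2 * ((g x \<bullet> G x) * (x \<bullet> G x))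
      - rho_chi \<rho>p \<rho>m u x * (snd x * (3 * \<psi> x + g x \<bullet> x))) = 0"
proof -
  have n: "(norm z)\<^sup>2 = fst z * fst z + snd z * snd z" for z :: pt
    by (simp add: power2_norm_eq_inner inner_prod_def)
  have eq: "(norm (G x))\<^sup>2 * (fst (\<psi> x *\<^sub>R (1, 0) + fst x *\<^sub>R g x) + snd (\<psi> x *\<^sub>R (0, 1) + snd x *\<^sub>R g x))
      - 2 * (fst (G x) * ((\<psi> x *\<^sub>R (1, 0) + fst x *\<^sub>R g x) \<bullet> G x) + snd (G x) * ((\<psi> x *\<^sub>R (0, 1) + snd x *\<^sub>R g x) \<bullet> G x))
      - rho_chi \<rho>p \<rho>m u x * (snd x * (fst (\<psi> x *\<^sub>R (1, 0) + fst x *\<^sub>R g x) + snd (\<psi> x *\<^sub>R (0, 1) + snd x *\<^sub>R g x)) + \<psi> x * snd x)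
    = (norm (G x))\<^sup>2 * (g x \<bullet> x) - 2 * ((g x \<bullet> G x) * (x \<bullet> G x)) - rho_chi \<rho>p \<rho>m u x * (snd x * (3 * \<psi> x + g x \<bullet> x))" for x
    unfolding n by (simp add: inner_prod_def algebra_simps)
  show ?thesis
    using variational_identity[OF test_fun_mult[OF t C1_grad_fst] test_fun_mult[OF t C1_grad_snd]]
    unfolding eq .
qed

end

section \<open>Harmonicity off the zero set and the limiting integral identities\<close>

lemma open_null_empty:
  fixes S :: "'a::euclidean_space set"
  assumes "open S" "AE x in lborel. x \<notin> S"
  shows "S = {}"
proof -
  have "{x \<in> space lborel. \<not> x \<notin> S} \<in> null_sets lborel"
    using assms by (subst AE_iff_null[symmetric]) auto
  then have "S \<in> null_sets lebesgue" by (simp add: null_sets_completionI)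
  then show ?thesis using open_not_negligible[OF assms(1)] by (auto simp: negligible_iff_null_sets)
qed

context variational_classical
begin

text \<open>
  For \<open>\<phi> = \<zeta> F\<close> the integrand of the variational identity equals
  \<open>2 \<zeta> \<bar>F\<bar>\<^sup>2 \<Delta>u - div (\<zeta> (\<bar>F\<bar>\<^sup>2 + \<rho> y) F)\<close>.
\<close>

lemma laplacian_test:
  assumes t: "test_fun P \<zeta> g"
  shows "(LINT x:P|lborel. ((norm (F x))\<^sup>2 * (fst (H1 x) + snd (H2 x))) * \<zeta> x) = 0"
proof -
  let ?\<rho> = "rho_chi \<rho>p \<rho>m u"
  obtain K where K: "compact K" "K \<subseteq> P" "\<And>x. x \<notin> K \<Longrightarrow> \<zeta> x = 0" "\<And>x. x \<notin> K \<Longrightarrow> g x = 0"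
    using test_funD[OF t] by metis
  have C1: "C1_grad P \<zeta> g" using t by (auto simp: test_fun_def intro: C1_grad_subset)
  note [measurable] = test_fun_measurable[OF t]
  note c1 = C1_grad_mult[OF C1 F(2)] and c2 = C1_grad_mult[OF C1 F(3)]
  let ?g1 = "\<lambda>x. \<zeta> x *\<^sub>R H1 x + fst (F x) *\<^sub>R g x" and ?g2 = "\<lambda>x. \<zeta> x *\<^sub>R H2 x + snd (F x) *\<^sub>R g x"
  have t1: "test_fun P (\<lambda>x. if x \<in> P then \<zeta> x * fst (F x) else 0) (\<lambda>x. if x \<in> P then ?g1 x else 0)"
    by (rule C1_grad_extend[OF c1 open_P K(1,2)]) (simp add: K(3))
  have t2: "test_fun P (\<lambda>x. if x \<in> P then \<zeta> x * snd (F x) else 0) (\<lambda>x. if x \<in> P then ?g2 x else 0)"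
    by (rule C1_grad_extend[OF c2 open_P K(1,2)]) (simp add: K(3))
  note [measurable] = test_fun_measurable[OF t1] test_fun_measurable[OF t2]
  let ?g1' = "\<lambda>x. if x \<in> P then ?g1 x else 0" and ?g2' = "\<lambda>x. if x \<in> P then ?g2 x else 0"
  let ?f2' = "\<lambda>x. if x \<in> P then \<zeta> x * snd (F x) else 0"
  \<comment> \<open>The gradient is a separate argument, so that measurability can be checked at
    \<open>G0\<close> and the algebra carried out at \<open>F\<close>.\<close>
  define I where "I x z = (norm z)\<^sup>2 * (fst (?g1' x) + snd (?g2' x))
      - 2 * (fst z * (?g1' x \<bullet> z) + snd z * (?g2' x \<bullet> z))
      - ?\<rho> x * (snd x * (fst (?g1' x) + snd (?g2' x)) + ?f2' x)" for x and z :: pt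
  have I0: "(LINT x:B1|lborel. I x (G x)) = 0"
    unfolding I_def by (rule variational_identity[OF test_fun_mono[OF t1 P_sub] test_fun_mono[OF t2 P_sub]])
  \<comment> \<open>The gradient of the factor |F|^2 + \<rho> y; its \<rho> part uses that the
    density is locally constant on \<open>P\<close>.\<close>
  note k = C1_grad_add[OF C1_grad_add[OF C1_grad_mult[OF F(2) F(2)] C1_grad_mult[OF F(3) F(3)]] C1_grad_mult[OF rho_C1 C1_grad_snd]]
  note V1 = C1_grad_mult[OF C1_grad_mult[OF C1 k] F(2)] and V2 = C1_grad_mult[OF C1_grad_mult[OF C1 k] F(3)]
  have sz: "\<zeta> x * c * d = 0" if "x \<notin> K" for x c d using K(3)[OF that] by simp
  note D = divergence_theorem_compact_support[OF open_P K(1,2) V1 V2, OF sz sz]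
  define dV where "dV x = \<zeta> x * ((norm (F x))\<^sup>2 + ?\<rho> x * snd x) * (fst (H1 x) + snd (H2 x))
      + \<zeta> x * (2 * (fst (F x) * (H1 x \<bullet> F x) + snd (F x) * (H2 x \<bullet> F x)) + ?\<rho> x * snd (F x))
      + ((norm (F x))\<^sup>2 + ?\<rho> x * snd x) * (g x \<bullet> F x)" for x
  have n: "(norm z)\<^sup>2 = fst z * fst z + snd z * snd z" for z :: pt
    by (simp add: power2_norm_eq_inner inner_prod_def)
  have dV: "set_integrable lborel P dV" "(LINT x:P|lborel. dV x) = 0"
    using D unfolding dV_def[abs_def] n by (simp_all add: inner_prod_def algebra_simps)
  let ?L = "\<lambda>x. ((norm (F x))\<^sup>2 * (fst (H1 x) + snd (H2 x))) * \<zeta> x"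
  have iL: "set_integrable lborel P ?L"
  proof -
    have "continuous_on K ?L"
      using F[THEN C1_grad_continuous_grad] C1_grad_continuous[OF C1] K(2)
      by (intro continuous_intros; elim continuous_on_subset)
    then have "integrable lborel (\<lambda>x. indicator K x *\<^sub>R ?L x)"
      by (intro borel_integrable_compact K(1))
    moreover have "indicator K x *\<^sub>R ?L x = indicator P x *\<^sub>R ?L x" for x
      using K(2) K(3)[of x] by (cases "x \<in> K") (auto simp: indicator_def)
    ultimately show ?thesis unfolding set_integrable_def by (simp only:)
  qed
  have "(LINT x:B1|lborel. I x (G x)) = (LINT x:P|lborel. 2 * ?L x - dV x)"
    unfolding set_lebesgue_integral_def
  proof (rule integral_cong_AE)
    have "(\<lambda>x. I x (G0 x)) \<in> borel_measurable borel"
      unfolding I_def by measurable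
    then show "(\<lambda>x. indicator B1 x *\<^sub>R I x (G x)) \<in> borel_measurable lborel"
      using indicator_B1_measurable[of "\<lambda>x _ z. I x z"] by simp
    have "set_integrable lborel P (\<lambda>x. 2 * ?L x - dV x)"
      using iL dV(1) by (intro set_integral_diff set_integrable_mult_right)
    then show "(\<lambda>x. indicator P x *\<^sub>R (2 * ?L x - dV x)) \<in> borel_measurable lborel"
      unfolding set_integrable_def by (rule borel_measurable_integrable)
    show "AE x in lborel. indicator B1 x *\<^sub>R I x (G x) = indicator P x *\<^sub>R (2 * ?L x - dV x)"
      using G_eq_F
    proof eventually_elim
      case (elim x)
      show ?case
      proof (cases "x \<in> P")
        case True
        then have "I x (G x) = 2 * ?L x - dV x"
          using elim unfolding I_def dV_def n by (simp add: inner_prod_def algebra_simps)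
        then show ?thesis using True P_sub by (auto simp: indicator_def)
      next
        case False
        then show ?thesis by (simp add: I_def)
      qed
    qed
  qed
  also have "\<dots> = 2 * (LINT x:P|lborel. ?L x) - (LINT x:P|lborel. dV x)"
    using iL dV(1) by (simp add: set_integral_diff set_integrable_mult_right)
  finally show ?thesis using I0 dV(2) by simp
qed

text \<open>By continuity the product |F|^2 times the Laplacian vanishes everywhere on
  \<open>P\<close>. If the Laplacian were nonzero at x it would be nonzero on a neighbourhood, so F
  would vanish there, and with F both rows of the Hessian at x: a contradiction.\<close>

lemma laplacian_zero:
  assumes "x \<in> P"
  shows "fst (H1 x) + snd (H2 x) = 0"
proof (rule ccontr)
  assume nz: "fst (H1 x) + snd (H2 x) \<noteq> 0"
  let ?\<Delta> = "\<lambda>x. fst (H1 x) + snd (H2 x)"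
  have c\<Delta>: "continuous_on P ?\<Delta>"
    using F[THEN C1_grad_continuous_grad] by (intro continuous_intros)
  have cs: "continuous_on P (\<lambda>x. (norm (F x))\<^sup>2 * ?\<Delta> x)"
    using F[THEN C1_grad_continuous_grad] by (intro continuous_intros)
  have pre: "open {x \<in> P. f x \<noteq> 0}" if "continuous_on P f" for f :: "pt \<Rightarrow> real"
  proof -
    have "open (P \<inter> f -` (- {0}))" using that open_P by (intro continuous_open_preimage) auto
    then show ?thesis by (simp add: vimage_def Int_def)
  qed
  have "AE x in lborel. x \<in> P \<longrightarrow> (norm (F x))\<^sup>2 * ?\<Delta> x = 0"
  proof (rule AE_zero_of_test_fun[OF open_P _ laplacian_test])
    fix a b :: pt assume "cbox a b \<subseteq> P"
    then show "set_integrable lborel (cbox a b) (\<lambda>x. (norm (F x))\<^sup>2 * ?\<Delta> x)"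
      unfolding set_integrable_def
      by (intro borel_integrable_compact compact_cbox continuous_on_subset[OF cs])
  qed
  then have "{x \<in> P. (norm (F x))\<^sup>2 * ?\<Delta> x \<noteq> 0} = {}"
    by (intro open_null_empty pre cs) auto
  then have e: "(norm (F y))\<^sup>2 * ?\<Delta> y = 0" if "y \<in> P" for y
    using that by blast
  have z: "F y = 0" if "y \<in> P" "?\<Delta> y \<noteq> 0" for y
    using e[OF that(1)] that(2) by simp
  have "H1 x = 0"
    by (rule C1_grad_eq_0_on_open[OF F(2) pre[OF c\<Delta>]]) (use z nz assms in auto)
  moreover have "H2 x = 0"
    by (rule C1_grad_eq_0_on_open[OF F(3) pre[OF c\<Delta>]]) (use z nz assms in auto)
  ultimately show False using nz by simp
qed

text \<open>The field is \<open>cut n (u x) * \<psi> x\<close> times \<open>F\<close>. Harmonicity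
  removes the only second-order term of its divergence, which could not be dominated near the zero
  set; what remains is quadratic in \<open>u\<close> and \<open>F\<close>. In the limit the zero set
  contributes nothing, as \<open>G\<close> vanishes there almost everywhere.\<close>

lemma identity_energy:
  assumes t: "test_fun B1 \<psi> g"
  shows "(LINT x:B1|lborel. \<psi> x * (norm (G x))\<^sup>2 + u x * (g x \<bullet> G x)) = 0"
proof -
  obtain C where C: "C \<ge> 0" "\<And>x. \<bar>\<psi> x\<bar> \<le> C" "\<And>x. norm (g x) \<le> C" using test_fun_bounded[OF t] by metis
  obtain K where K: "compact K" "K \<subseteq> B1" "\<And>x. x \<notin> K \<Longrightarrow> \<psi> x = 0" "\<And>x. x \<notin> K \<Longrightarrow> g x = 0"
    using test_funD[OF t] by metis
  note [measurable] = test_fun_measurable[OF t]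
  have C1: "C1_grad P \<psi> g" using t by (auto simp: test_fun_def intro: C1_grad_subset)
  let ?w = "\<lambda>n x. \<psi> x * cut' n (u x) * (norm (F x))\<^sup>2 + cut n (u x) * (g x \<bullet> F x)"
  have n: "(norm z)\<^sup>2 = fst z * fst z + snd z * snd z" for z :: pt
    by (simp add: power2_norm_eq_inner inner_prod_def)
  have ug: "\<bar>u x\<bar> * \<bar>g x \<bullet> z\<bar> \<le> C * (1 + (u x)\<^sup>2 + (norm z)\<^sup>2)" for x z
  proof -
    have "\<bar>g x \<bullet> z\<bar> \<le> C * norm z"
      using Cauchy_Schwarz_ineq2[of "g x" z] C(3)[of x] by (meson mult_right_mono norm_ge_zero order_trans)
    then have "\<bar>u x\<bar> * \<bar>g x \<bullet> z\<bar> \<le> \<bar>u x\<bar> * (C * norm z)" by (intro mult_left_mono) auto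
    also have "\<dots> = C * (\<bar>u x\<bar> * \<bar>norm z\<bar>)" by simp
    also have "\<dots> \<le> C * (1 + (u x)\<^sup>2 + (norm z)\<^sup>2)"
      using C(1) by (intro mult_left_mono prod_le_squares)
    finally show ?thesis .
  qed
  have pz: "\<bar>\<psi> x\<bar> * (norm z)\<^sup>2 \<le> C * (1 + (u x)\<^sup>2 + (norm z)\<^sup>2)" for x and z :: pt
    using C by (intro mult_mono) auto
  show ?thesis
  proof (rule integral_zero_by_cut_limit)
    fix n
    note s = cut_support[OF K(1,2), where n=n]
    note D = divergence_theorem_compact_support[OF open_P s(1,2)
        C1_grad_mult[OF C1_grad_mult[OF C1_grad_cut_u[of n] C1] F(2)] C1_grad_mult[OF C1_grad_mult[OF C1_grad_cut_u[of n] C1] F(3)]]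
    have sz: "cut n (u x) * \<psi> x * c = 0" if "x \<notin> {x \<in> K. 1 \<le> real n * (u x)\<^sup>2}" for x c
      using s(3)[OF that] K(3) by (cases "x \<in> K") auto
    let ?d = "\<lambda>x. fst ((cut n (u x) * \<psi> x) *\<^sub>R H1 x + fst (F x) *\<^sub>R (cut n (u x) *\<^sub>R g x + \<psi> x *\<^sub>R cut' n (u x) *\<^sub>R F x))
      + snd ((cut n (u x) * \<psi> x) *\<^sub>R H2 x + snd (F x) *\<^sub>R (cut n (u x) *\<^sub>R g x + \<psi> x *\<^sub>R cut' n (u x) *\<^sub>R F x))"
    have i: "set_integrable lborel P ?d" "(LINT x:P|lborel. ?d x) = 0"
      by (rule D[OF sz sz], assumption+)+
    have eq: "?d x = ?w n x" if "x \<in> P" for x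
    proof -
      have "?d x = (cut n (u x) * \<psi> x) * (fst (H1 x) + snd (H2 x)) + ?w n x"
        unfolding n by (simp add: inner_prod_def algebra_simps)
      then show ?thesis using laplacian_zero[OF that] by simp
    qed
    then have eq': "indicator P x *\<^sub>R ?d x = indicator P x *\<^sub>R ?w n x" for x
      by (cases "x \<in> P") auto
    show "set_integrable lborel P (?w n)"
      using i(1) unfolding set_integrable_def eq' .
    show "(LINT x:P|lborel. ?w n x) = 0"
      using i(2) unfolding set_lebesgue_integral_def eq' .
  next
  show "set_integrable lborel B1 (\<lambda>x. \<psi> x * (norm (G x))\<^sup>2 + u x * (g x \<bullet> G x))"
  proof (rule set_integrable_quadratic[of "\<lambda>x a z. \<psi> x * (norm z)\<^sup>2 + a * (g x \<bullet> z)" "2 * C"])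
    show "\<bar>\<psi> x * (norm (G x))\<^sup>2 + u x * (g x \<bullet> G x)\<bar> \<le> 2 * C * (1 + (u x)\<^sup>2 + (norm (G x))\<^sup>2)" for x
      using ug[of x "G x"] pz[of x "G x"] abs_triangle_ineq[of "\<psi> x * (norm (G x))\<^sup>2" "u x * (g x \<bullet> G x)"]
      by (simp add: abs_mult)
  qed measurable
  \<comment> \<open>The 10 is 9 + 1: |\<open>cut'\<close>| is at most 9 in the first term, and
    |\<open>cut n (u x)\<close>| is at most |u| in the second.\<close>
  show "set_integrable lborel B1 (\<lambda>x. 10 * C * (1 + (u x)\<^sup>2 + (norm (G x))\<^sup>2))"
    using C(1) by (intro set_integrable_quadratic[of "\<lambda>x a z. 10 * C * (1 + a\<^sup>2 + (norm z)\<^sup>2)" "10 * C"])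
      (auto simp: abs_mult)
  show "(\<lambda>n. ?w n x) \<longlonglongrightarrow> \<psi> x * (norm (G x))\<^sup>2 + u x * (g x \<bullet> G x)" if "x \<in> P" "G x = F x" for x
  proof -
    have "(\<lambda>n. ?w n x) \<longlonglongrightarrow> \<psi> x * 1 * (norm (F x))\<^sup>2 + u x * (g x \<bullet> F x)"
      by (intro tendsto_intros cut_tendsto cut'_tendsto) (use that in \<open>auto simp: P_def\<close>)
    then show ?thesis using that by simp
  qed
  show "\<bar>?w n x\<bar> \<le> 10 * C * (1 + (u x)\<^sup>2 + (norm (G x))\<^sup>2)" if "x \<in> P" "G x = F x" for x n
  proof -
    have "\<bar>\<psi> x * cut' n (u x) * (norm (F x))\<^sup>2\<bar> = \<bar>cut' n (u x)\<bar> * (\<bar>\<psi> x\<bar> * (norm (F x))\<^sup>2)"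
      by (simp add: abs_mult)
    also have "\<dots> \<le> 9 * (C * (1 + (u x)\<^sup>2 + (norm (F x))\<^sup>2))"
      using cut'_bound C by (intro mult_mono) auto
    finally have 1: "\<bar>\<psi> x * cut' n (u x) * (norm (F x))\<^sup>2\<bar> \<le> 9 * (C * (1 + (u x)\<^sup>2 + (norm (F x))\<^sup>2))" .
    have "\<bar>cut n (u x) * (g x \<bullet> F x)\<bar> \<le> \<bar>u x\<bar> * \<bar>g x \<bullet> F x\<bar>"
      unfolding abs_mult by (intro mult_right_mono cut_bound) auto
    then have 2: "\<bar>cut n (u x) * (g x \<bullet> F x)\<bar> \<le> C * (1 + (u x)\<^sup>2 + (norm (F x))\<^sup>2)"
      using ug[of x "F x"] by linarith
    have "\<bar>?w n x\<bar> \<le> 9 * (C * (1 + (u x)\<^sup>2 + (norm (F x))\<^sup>2)) + C * (1 + (u x)\<^sup>2 + (norm (F x))\<^sup>2)"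
      using 1 2 abs_triangle_ineq[of "\<psi> x * cut' n (u x) * (norm (F x))\<^sup>2" "cut n (u x) * (g x \<bullet> F x)"] by linarith
    then show ?thesis using that by (simp add: algebra_simps)
  qed
  show "AE x in lborel. x \<in> B1 - P \<longrightarrow> \<psi> x * (norm (G x))\<^sup>2 + u x * (g x \<bullet> G x) = 0"
    using G_eq_0 by eventually_elim auto
  qed
qed

text \<open>The divergence theorem for the field (cut n u)^2 \<psi> x, with div x = 2 giving the
  zeroth-order term. Every term of the limit carries a factor u, hence vanishes on the zero
  set.\<close>

lemma identity_square:
  assumes t: "test_fun B1 \<psi> g"
  shows "(LINT x:B1|lborel. \<psi> x * (2 * (u x * (G x \<bullet> x)) + 2 * (u x)\<^sup>2) + (u x)\<^sup>2 * (g x \<bullet> x)) = 0"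
proof -
  obtain C where C: "C \<ge> 0" "\<And>x. \<bar>\<psi> x\<bar> \<le> C" "\<And>x. norm (g x) \<le> C" using test_fun_bounded[OF t] by metis
  obtain K where K: "compact K" "K \<subseteq> B1" "\<And>x. x \<notin> K \<Longrightarrow> \<psi> x = 0" "\<And>x. x \<notin> K \<Longrightarrow> g x = 0"
    using test_funD[OF t] by metis
  note [measurable] = test_fun_measurable[OF t]
  have C1: "C1_grad P \<psi> g" using t by (auto simp: test_fun_def intro: C1_grad_subset)
  let ?w = "\<lambda>n x. \<psi> x * (2 * (cut n (u x) * cut' n (u x) * (F x \<bullet> x)) + 2 * (cut n (u x))\<^sup>2) + (cut n (u x))\<^sup>2 * (g x \<bullet> x)"
  \<comment> \<open>The bound serves the truncated integrands with \<open>a = cut n (u x)\<close>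
    and \<open>b = cut' n (u x)\<close>, and the limit with \<open>a = u x\<close> and
    \<open>b = 1\<close>. The constant is 2 * 9 + 2 from the bracket and 1 from the last term, using
    |x| \<le> 1.\<close>
  have bnd: "\<bar>\<psi> x * (2 * (a * b * (z \<bullet> x)) + 2 * a\<^sup>2) + a\<^sup>2 * (g x \<bullet> x)\<bar> \<le> 21 * C * (1 + (u x)\<^sup>2 + (norm z)\<^sup>2)"
    if "x \<in> B1" "\<bar>a\<bar> \<le> \<bar>u x\<bar>" "\<bar>b\<bar> \<le> 9" for x z a b
  proof -
    let ?S = "1 + (u x)\<^sup>2 + (norm z)\<^sup>2"
    have a2: "a\<^sup>2 \<le> ?S" using that(2) abs_le_square_iff[of a "u x"] zero_le_power2[of "norm z"] by linarith
    have gx: "\<bar>g x \<bullet> x\<bar> \<le> C"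
      using Cauchy_Schwarz_ineq2[of "g x" x] mult_mono[OF C(3)[of x] norm_B1[OF that(1)]] C(1) by simp
    have zx: "\<bar>z \<bullet> x\<bar> \<le> norm z"
      using Cauchy_Schwarz_ineq2[of z x] mult_left_mono[OF norm_B1[OF that(1)], of "norm z"] by simp
    have "\<bar>a * b * (z \<bullet> x)\<bar> = \<bar>b\<bar> * (\<bar>a\<bar> * \<bar>z \<bullet> x\<bar>)" by (simp add: abs_mult)
    also have "\<dots> \<le> 9 * (\<bar>u x\<bar> * \<bar>norm z\<bar>)" using that zx by (intro mult_mono) auto
    also have "\<dots> \<le> 9 * ?S" using prod_le_squares[of "u x" "norm z"] by simp
    finally have ab: "\<bar>a * b * (z \<bullet> x)\<bar> \<le> 9 * ?S" .
    have "\<bar>2 * p + 2 * q\<bar> \<le> 20 * S" if "\<bar>p\<bar> \<le> 9 * S" "q \<le> S" "0 \<le> q" for p q S :: real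
      using that by linarith
    from this[OF ab a2 zero_le_power2] have "\<bar>2 * (a * b * (z \<bullet> x)) + 2 * a\<^sup>2\<bar> \<le> 20 * ?S" .
    then have "\<bar>\<psi> x * (2 * (a * b * (z \<bullet> x)) + 2 * a\<^sup>2)\<bar> \<le> C * (20 * ?S)"
      unfolding abs_mult using C by (intro mult_mono) auto
    moreover have "\<bar>a\<^sup>2 * (g x \<bullet> x)\<bar> \<le> ?S * C"
      unfolding abs_mult using a2 gx by (intro mult_mono) auto
    ultimately show ?thesis
      using abs_triangle_ineq[of "\<psi> x * (2 * (a * b * (z \<bullet> x)) + 2 * a\<^sup>2)" "a\<^sup>2 * (g x \<bullet> x)"]
      by (simp add: algebra_simps)
  qed
  show ?thesis
  proof (rule integral_zero_by_cut_limit)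
    fix n
    note s = cut_support[OF K(1,2), where n=n]
    note D = divergence_theorem_compact_support[OF open_P s(1,2)
        C1_grad_mult[OF C1_grad_mult[OF C1_grad_cut_u[of n] C1_grad_mult[OF C1_grad_cut_u[of n] C1]] C1_grad_fst]
        C1_grad_mult[OF C1_grad_mult[OF C1_grad_cut_u[of n] C1_grad_mult[OF C1_grad_cut_u[of n] C1]] C1_grad_snd]]
    have sz: "cut n (u x) * (cut n (u x) * \<psi> x) * c = 0" if "x \<notin> {x \<in> K. 1 \<le> real n * (u x)\<^sup>2}" for x c
      using s(3)[OF that] K(3) by (cases "x \<in> K") auto
    show "set_integrable lborel P (?w n)" "(LINT x:P|lborel. ?w n x) = 0"
      using D[OF sz sz] by (simp_all add: inner_prod_def algebra_simps power2_eq_square)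
  next
  show "set_integrable lborel B1 (\<lambda>x. \<psi> x * (2 * (u x * (G x \<bullet> x)) + 2 * (u x)\<^sup>2) + (u x)\<^sup>2 * (g x \<bullet> x))"
  proof (rule set_integrable_quadratic[of "\<lambda>x a z. \<psi> x * (2 * (a * (z \<bullet> x)) + 2 * a\<^sup>2) + a\<^sup>2 * (g x \<bullet> x)" "21 * C"])
    show "\<bar>\<psi> x * (2 * (u x * (G x \<bullet> x)) + 2 * (u x)\<^sup>2) + (u x)\<^sup>2 * (g x \<bullet> x)\<bar> \<le> 21 * C * (1 + (u x)\<^sup>2 + (norm (G x))\<^sup>2)" if "x \<in> B1" for x
      using bnd[OF that, of "u x" 1 "G x"] by simp
  qed measurable
  show "set_integrable lborel B1 (\<lambda>x. 21 * C * (1 + (u x)\<^sup>2 + (norm (G x))\<^sup>2))"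
    using C(1) by (intro set_integrable_quadratic[of "\<lambda>x a z. 21 * C * (1 + a\<^sup>2 + (norm z)\<^sup>2)" "21 * C"])
      (auto simp: abs_mult)
  show "(\<lambda>n. ?w n x) \<longlonglongrightarrow> \<psi> x * (2 * (u x * (G x \<bullet> x)) + 2 * (u x)\<^sup>2) + (u x)\<^sup>2 * (g x \<bullet> x)" if "x \<in> P" "G x = F x" for x
  proof -
    have "(\<lambda>n. ?w n x) \<longlonglongrightarrow> \<psi> x * (2 * (u x * 1 * (F x \<bullet> x)) + 2 * (u x)\<^sup>2) + (u x)\<^sup>2 * (g x \<bullet> x)"
      by (intro tendsto_intros cut_tendsto cut'_tendsto) (use that in \<open>auto simp: P_def\<close>)
    then show ?thesis using that by simp
  qed
  show "\<bar>?w n x\<bar> \<le> 21 * C * (1 + (u x)\<^sup>2 + (norm (G x))\<^sup>2)" if "x \<in> P" "G x = F x" for x n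
    using bnd[of x "cut n (u x)" "cut' n (u x)" "F x"] that P_sub cut_bound cut'_bound by auto
  show "AE x in lborel. x \<in> B1 - P \<longrightarrow> \<psi> x * (2 * (u x * (G x \<bullet> x)) + 2 * (u x)\<^sup>2) + (u x)\<^sup>2 * (g x \<bullet> x) = 0"
    by (auto simp: P_def)
  qed
qed

end

section \<open>The monotonicity formula\<close>

text \<open>A Bochner integral is 0 by convention when the integrand is not integrable, so linearity
  of \<open>circle_integral\<close> has to be earned; it holds for almost every radius.\<close>

definition circle_integrable :: "real \<Rightarrow> (pt \<Rightarrow> real) \<Rightarrow> bool" where
  "circle_integrable r f \<longleftrightarrow> set_integrable lborel {0..2*pi} (\<lambda>\<theta>. f (r * cos \<theta>, r * sin \<theta>))"

lemma AE_circle_integrable: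
  assumes "set_integrable lborel B1 f"
  shows "AE r in lborel. 0 < r \<and> r < 1 \<longrightarrow> circle_integrable r f"
  using integral_polar(1)[OF integrable_B1[OF assms]]
proof eventually_elim
  case (elim r)
  show ?case
  proof
    assume r: "0 < r \<and> r < 1"
    then have "(r * cos \<theta>, r * sin \<theta>) \<in> B1" for \<theta> by (simp add: B1_def norm_polar)
    then show "circle_integrable r f" using elim r by (simp add: circle_integrable_def)
  qed
qed

lemma circle_integral_linear:
  assumes "circle_integrable r f" "circle_integrable r g" "circle_integrable r h"
  shows "circle_integral r (\<lambda>x. a * f x + b * g x + c * h x)
    = a * circle_integral r f + b * circle_integral r g + c * circle_integral r h"
proof -
  let ?c = "\<lambda>f \<theta>. f (r * cos \<theta>, r * sin \<theta>) * r"
  have i: "set_integrable lborel {0..2*pi} (\<lambda>\<theta>. k * ?c f \<theta>)" if "circle_integrable r f" for f :: "pt \<Rightarrow> real" and k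
    using that unfolding circle_integrable_def by (intro set_integrable_mult_right set_integrable_mult_left)
  have "circle_integral r (\<lambda>x. a * f x + b * g x + c * h x)
     = (LINT \<theta>:{0..2*pi}|lborel. (a * ?c f \<theta> + b * ?c g \<theta>) + c * ?c h \<theta>)"
    unfolding circle_integral_def by (simp add: algebra_simps)
  also have "\<dots> = (LINT \<theta>:{0..2*pi}|lborel. a * ?c f \<theta> + b * ?c g \<theta>) + (LINT \<theta>:{0..2*pi}|lborel. c * ?c h \<theta>)"
    by (intro set_integral_add(2) set_integral_add(1) i assms)
  also have "(LINT \<theta>:{0..2*pi}|lborel. a * ?c f \<theta> + b * ?c g \<theta>)
     = (LINT \<theta>:{0..2*pi}|lborel. a * ?c f \<theta>) + (LINT \<theta>:{0..2*pi}|lborel. b * ?c g \<theta>)"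
    by (intro set_integral_add(2) i assms)
  finally show ?thesis unfolding set_integral_mult_right circle_integral_def .
qed

text \<open>\<open>R\<close> stands for the ball integral of div (u^2 x), which is r times the
  circle integral of u^2. This is why r^5 appears where \<open>Mfun\<close> has r^4.\<close>

lemma DERIV_energy_quotient:
  fixes A R :: "real \<Rightarrow> real"
  assumes "(A has_real_derivative A') (at r)" "(R has_real_derivative R') (at r)" "r \<noteq> 0"
  shows "((\<lambda>r. A r / r^3 - 3/2 * (R r / r^5)) has_real_derivative
      A' / r^3 - 3 * A r / r^4 - 3/2 * (R' / r^5 - 5 * R r / r^6)) (at r)"
proof -
  have 1: "((\<lambda>r. A r / r^3) has_real_derivative (A' * r^3 - A r * (3 * r^2)) / (r^3 * r^3)) (at r)"
    using assms by (intro DERIV_divide) (auto intro!: derivative_eq_intros)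
  have 2: "((\<lambda>r. R r / r^5) has_real_derivative (R' * r^5 - R r * (5 * r^4)) / (r^5 * r^5)) (at r)"
    using assms by (intro DERIV_divide) (auto intro!: derivative_eq_intros)
  have q: "(x * r^m - y * (c * r^n)) / (r^m * r^m) = x / r^m - c * y / r^l" if "m + m = l + n"
    for x y c :: real and m n l :: nat
  proof -
    have "y * (c * r^n) / (r^m * r^m) = (c * y) * r^n / (r^l * r^n)"
      using that by (simp add: mult_ac flip: power_add)
    also have "\<dots> = c * y / r^l" using assms(3) by (intro nonzero_mult_divide_mult_cancel_right) simp
    finally have "y * (c * r^n) / (r^m * r^m) = c * y / r^l" .
    moreover have "x * r^m / (r^m * r^m) = x / r^m"
      using assms(3) by (intro nonzero_mult_divide_mult_cancel_right) simp
    ultimately show ?thesis by (simp only: diff_divide_distrib)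
  qed
  \<comment> \<open>The exponents satisfy 3 + 3 = 4 + 2 and 5 + 5 = 6 + 4.\<close>
  from q[of 3 4 2 A' "A r" 3] q[of 5 6 4 R' "R r" 5]
  have e: "(A' * r^3 - A r * (3 * r^2)) / (r^3 * r^3) = A' / r^3 - 3 * A r / r^4"
    "(R' * r^5 - R r * (5 * r^4)) / (r^5 * r^5) = R' / r^5 - 5 * R r / r^6" by simp_all
  show ?thesis using DERIV_diff[OF 1 DERIV_cmult[OF 2, of "3/2"]] unfolding e .
qed

text \<open>To be read with m = |x|, e = |G|^2, w = x . G and \<open>g\<close> the derivative of
  \<eta>. The right side has the shape \<eta> p + g q required by \<open>radial_identity\<close>,
  with q involving the radial derivative w / m.\<close>

lemma radial_integrand_algebra:
  fixes m :: real
  assumes "m \<noteq> 0"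
  shows "e * (g / m * m\<^sup>2) - 2 * ((g / m * w) * w) - \<rho> * (y * (3 * \<eta> + g / m * m\<^sup>2))
    = \<eta> * (- 3 * (y * \<rho>)) + g * ((e - y * \<rho> - 2 * (w / m)\<^sup>2) * m)"
proof -
  have 1: "g / m * m\<^sup>2 = g * m" using assms by (simp add: power2_eq_square)
  have 2: "(w / m)\<^sup>2 * m = w * w / m" using assms by (simp add: power2_eq_square)
  have "g * ((e - y * \<rho> - 2 * (w / m)\<^sup>2) * m) = g * ((e - y * \<rho>) * m - 2 * ((w / m)\<^sup>2 * m))"
    by (simp only: left_diff_distrib mult.assoc)
  then show ?thesis unfolding 1 2 by (simp add: algebra_simps)
qed

lemma circle_square_algebra:
  "(w / r - 3/2 * v / r)\<^sup>2 = 1 * (w / r)\<^sup>2 + (- 3 / r) * (v * (w / r)) + 9 / (4 * r\<^sup>2) * (v::real)\<^sup>2"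
proof -
  define t where "t = 1 / r"
  have "w / r = w * t" "3/2 * v / r = 3/2 * v * t" "- 3 / r = - 3 * t" "9 / (4 * r\<^sup>2) = 9/4 * t\<^sup>2"
    by (simp_all add: t_def power_divide)
  then show ?thesis by (simp only:) (simp add: power2_eq_square algebra_simps)
qed

text \<open>Here a, b, c, d, k are the circle integrals of |G|^2, the squared radial derivative, y
  \<rho>, u times the radial derivative, and u^2, while \<open>C\<close> is the ball integral of y
  \<rho>. By Green's identity d is also the Dirichlet energy of the ball. Solving the hypothesis for
  a - c introduces -3 C / r, which cancels against the 3 C from differentiating r^-3.\<close>

lemma energy_derivative_algebra:
  fixes r :: real
  assumes r: "r \<noteq> 0" and 1: "r * a - r * c - 2 * r * b = - 3 * C"
  shows "(a - c) / r^3 - 3 * (d - C) / r^4 - 3/2 * ((2 * r * d + 2 * k) / r^5 - 5 * (r * k) / r^6)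
    = 2 / r^3 * (b - 3 / r * d + 9 / (4 * r\<^sup>2) * k)"
proof -
  \<comment> \<open>With t = 1 / r all terms become polynomial, and r t = 1 is the only relation
    needed.\<close>
  define t where "t = 1 / r"
  have rt: "r * t = 1" using r by (simp add: t_def)
  have "(a - c) * (r * t) = 2 * b * (r * t) - 3 * C * t"
    using arg_cong[OF 1, of "\<lambda>z. z * t"] by (simp add: algebra_simps)
  then have ac: "a - c = 2 * b - 3 * C * t" by (simp add: rt)
  have r5: "r * t^5 = t^4" and r6: "r * t^6 = t^5"
    using rt by (simp_all add: power_numeral_reduce flip: mult.assoc)
  have d: "x / r^n = x * t^n" for x n by (simp add: t_def power_divide)
  have "(a - c) * t^3 - 3 * (d - C) * t^4 - 3/2 * ((2 * r * d + 2 * k) * t^5 - 5 * (r * k) * t^6)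
     = (2 * b - 3 * C * t) * t^3 - 3 * (d - C) * t^4 - 3/2 * (2 * d * (r * t^5) + 2 * k * t^5 - 5 * k * (r * t^6))"
    by (simp add: ac algebra_simps)
  also have "\<dots> = 2 * t^3 * (b - 3 * t * d + 9/4 * t^2 * k)"
    unfolding r5 r6 by (simp add: algebra_simps power_numeral_reduce)
  also have "\<dots> = 2 * t^3 * (b - 3 / r * d + 9 / (4 * r^2) * k)"
    by (simp add: t_def power_divide)
  finally show ?thesis unfolding d .
qed

context variational_classical
begin

section \<open>The three radial identities and the derivative of the energy\<close>

lemma int_yrho: "set_integrable lborel B1 (\<lambda>x. snd x * rho_chi \<rho>p \<rho>m u x)"
proof (rule set_integrable_quadratic[of "\<lambda>x a z. snd x * rho_chi \<rho>p \<rho>m u x" "\<bar>\<rho>p\<bar> + \<bar>\<rho>m\<bar>"])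
  fix x assume "x \<in> B1"
  then have "\<bar>snd x\<bar> \<le> 1" using norm_B1[of x] norm_snd_le[of "snd x" "fst x"] by simp
  then have "\<bar>snd x\<bar> * \<bar>rho_chi \<rho>p \<rho>m u x\<bar> \<le> 1 * (\<bar>\<rho>p\<bar> + \<bar>\<rho>m\<bar>)"
    by (intro mult_mono rho_bounded) auto
  also have "\<dots> \<le> (\<bar>\<rho>p\<bar> + \<bar>\<rho>m\<bar>) * (1 + (u x)\<^sup>2 + (norm (G x))\<^sup>2)"
    using mult_left_mono[of 1 "1 + (u x)\<^sup>2 + (norm (G x))\<^sup>2" "\<bar>\<rho>p\<bar> + \<bar>\<rho>m\<bar>"] by simp
  finally show "\<bar>snd x * rho_chi \<rho>p \<rho>m u x\<bar> \<le> (\<bar>\<rho>p\<bar> + \<bar>\<rho>m\<bar>) * (1 + (u x)\<^sup>2 + (norm (G x))\<^sup>2)"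
    by (simp add: abs_mult)
qed measurable

lemma radial_component_le: "\<bar>x \<bullet> z\<bar> / norm x \<le> norm (z::pt)"
proof (cases "x = 0")
  case False
  then show ?thesis using Cauchy_Schwarz_ineq2[of x z] by (simp add: divide_le_eq mult.commute)
qed simp

lemma int_radial_sq: "set_integrable lborel B1 (\<lambda>x. ((x \<bullet> G x) / norm x)\<^sup>2)"
proof (rule set_integrable_quadratic[of "\<lambda>x a z. ((x \<bullet> z) / norm x)\<^sup>2" 1])
  fix x
  have "((x \<bullet> G x) / norm x)\<^sup>2 \<le> (norm (G x))\<^sup>2"
    using radial_component_le[of x "G x"] by (intro power2_le_iff_abs_le[THEN iffD2]) auto
  then show "\<bar>((x \<bullet> G x) / norm x)\<^sup>2\<bar> \<le> 1 * (1 + (u x)\<^sup>2 + (norm (G x))\<^sup>2)"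
    by (simp add: add_increasing)
qed measurable

lemma int_u_radial: "set_integrable lborel B1 (\<lambda>x. u x * ((x \<bullet> G x) / norm x))"
proof (rule set_integrable_quadratic[of "\<lambda>x a z. a * ((x \<bullet> z) / norm x)" 1])
  fix x
  have "\<bar>u x * ((x \<bullet> G x) / norm x)\<bar> \<le> \<bar>u x\<bar> * \<bar>norm (G x)\<bar>"
  proof -
    have "\<bar>u x * ((x \<bullet> G x) / norm x)\<bar> = \<bar>u x\<bar> * (\<bar>x \<bullet> G x\<bar> / norm x)" by (simp add: abs_mult)
    also have "\<dots> \<le> \<bar>u x\<bar> * norm (G x)" by (intro mult_left_mono radial_component_le) simp
    finally show ?thesis by simp
  qed
  also note prod_le_squares
  finally show "\<bar>u x * ((x \<bullet> G x) / norm x)\<bar> \<le> 1 * (1 + (u x)\<^sup>2 + (norm (G x))\<^sup>2)" by simp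
qed measurable

lemma set_integrable_mult_norm:
  assumes "set_integrable lborel B1 f"
  shows "set_integrable lborel B1 (\<lambda>x. f x * norm x)"
proof -
  \<comment> \<open>The norm is unbounded on the plane; truncated at 1 it is a bounded factor that
    agrees with it on the disk.\<close>
  have "set_integrable lborel B1 (\<lambda>x. f x * min 1 (norm x))"
    by (rule set_integrable_mult_bounded[OF assms, of _ 1]) auto
  moreover have "indicator B1 x *\<^sub>R (f x * min 1 (norm x)) = indicator B1 x *\<^sub>R (f x * norm x)" for x
    using norm_B1[of x] by (cases "x \<in> B1") auto
  ultimately show ?thesis unfolding set_integrable_def by (simp only:)
qed

lemma AE_inner_variation:
  "AE r in lborel. 0 < r \<and> r < 1 \<longrightarrow>
     circle_integral r (\<lambda>x. ((norm (G x))\<^sup>2 - snd x * rho_chi \<rho>p \<rho>m u x - 2 * ((x \<bullet> G x) / norm x)\<^sup>2) * norm x)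
     = (LINT x:ball 0 r|lborel. - 3 * (snd x * rho_chi \<rho>p \<rho>m u x))"
proof (rule radial_identity)
  show "set_integrable lborel B1 (\<lambda>x. - 3 * (snd x * rho_chi \<rho>p \<rho>m u x))"
    using int_yrho by (rule set_integrable_mult_right)
  show "set_integrable lborel B1 (\<lambda>x. ((norm (G x))\<^sup>2 - snd x * rho_chi \<rho>p \<rho>m u x - 2 * ((x \<bullet> G x) / norm x)\<^sup>2) * norm x)"
    by (intro set_integrable_mult_norm set_integral_diff set_integrable_mult_right iG2 int_yrho int_radial_sq)
  fix \<eta> g
  assume t: "test_fun B1 (\<lambda>x. \<eta> (norm x)) (\<lambda>x. (g (norm x) / norm x) *\<^sub>R x)"
  have "(norm (G x))\<^sup>2 * ((g (norm x) / norm x) *\<^sub>R x \<bullet> x) - 2 * (((g (norm x) / norm x) *\<^sub>R x \<bullet> G x) * (x \<bullet> G x))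
      - rho_chi \<rho>p \<rho>m u x * (snd x * (3 * \<eta> (norm x) + (g (norm x) / norm x) *\<^sub>R x \<bullet> x))
    = \<eta> (norm x) * (- 3 * (snd x * rho_chi \<rho>p \<rho>m u x))
      + g (norm x) * (((norm (G x))\<^sup>2 - snd x * rho_chi \<rho>p \<rho>m u x - 2 * ((x \<bullet> G x) / norm x)\<^sup>2) * norm x)" for x
    using radial_integrand_algebra[of "norm x" "(norm (G x))\<^sup>2" "g (norm x)" "x \<bullet> G x" "rho_chi \<rho>p \<rho>m u x" "snd x" "\<eta> (norm x)"]
    by (cases "x = 0") (simp_all add: dot_square_norm)
  with identity_inner_variation[OF t]
  show "(LINT x:B1|lborel. \<eta> (norm x) * (- 3 * (snd x * rho_chi \<rho>p \<rho>m u x))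
      + g (norm x) * (((norm (G x))\<^sup>2 - snd x * rho_chi \<rho>p \<rho>m u x - 2 * ((x \<bullet> G x) / norm x)\<^sup>2) * norm x)) = 0"
    by (simp only:)
qed

text \<open>Green's identity on the ball. It holds although \<open>u\<close> need not be harmonic
  across its zero set, because the factor u removes any contribution from there.\<close>

lemma AE_energy:
  "AE r in lborel. 0 < r \<and> r < 1 \<longrightarrow>
     circle_integral r (\<lambda>x. u x * ((x \<bullet> G x) / norm x)) = (LINT x:ball 0 r|lborel. (norm (G x))\<^sup>2)"
proof (rule radial_identity[OF iG2 int_u_radial])
  fix \<eta> g
  assume t: "test_fun B1 (\<lambda>x. \<eta> (norm x)) (\<lambda>x. (g (norm x) / norm x) *\<^sub>R x)"
  have "\<eta> (norm x) * (norm (G x))\<^sup>2 + u x * ((g (norm x) / norm x) *\<^sub>R x \<bullet> G x)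
    = \<eta> (norm x) * (norm (G x))\<^sup>2 + g (norm x) * (u x * ((x \<bullet> G x) / norm x))" for x
    by simp
  with identity_energy[OF t]
  show "(LINT x:B1|lborel. \<eta> (norm x) * (norm (G x))\<^sup>2 + g (norm x) * (u x * ((x \<bullet> G x) / norm x))) = 0"
    by (simp only:)
qed

lemma int_square_div: "set_integrable lborel B1 (\<lambda>x. 2 * (u x * (G x \<bullet> x)) + 2 * (u x)\<^sup>2)"
proof -
  have "u x * ((x \<bullet> G x) / norm x) * norm x = u x * (G x \<bullet> x)" for x
    by (cases "x = 0") (simp_all add: inner_commute)
  then have "set_integrable lborel B1 (\<lambda>x. u x * (G x \<bullet> x))"
    using set_integrable_mult_norm[OF int_u_radial] by (simp only:)
  then show ?thesis using iu2 by (intro set_integral_add set_integrable_mult_right)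
qed

lemma AE_square:
  "AE r in lborel. 0 < r \<and> r < 1 \<longrightarrow>
     circle_integral r (\<lambda>x. (u x)\<^sup>2 * norm x) = (LINT x:ball 0 r|lborel. 2 * (u x * (G x \<bullet> x)) + 2 * (u x)\<^sup>2)"
proof (rule radial_identity[OF int_square_div set_integrable_mult_norm[OF iu2]])
  fix \<eta> g
  assume t: "test_fun B1 (\<lambda>x. \<eta> (norm x)) (\<lambda>x. (g (norm x) / norm x) *\<^sub>R x)"
  have "\<eta> (norm x) * (2 * (u x * (G x \<bullet> x)) + 2 * (u x)\<^sup>2) + (u x)\<^sup>2 * ((g (norm x) / norm x) *\<^sub>R x \<bullet> x)
    = \<eta> (norm x) * (2 * (u x * (G x \<bullet> x)) + 2 * (u x)\<^sup>2) + g (norm x) * ((u x)\<^sup>2 * norm x)" for x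
    by (cases "x = 0") (simp_all add: dot_square_norm power2_eq_square)
  with identity_square[OF t]
  show "(LINT x:B1|lborel. \<eta> (norm x) * (2 * (u x * (G x \<bullet> x)) + 2 * (u x)\<^sup>2) + g (norm x) * ((u x)\<^sup>2 * norm x)) = 0"
    by (simp only:)
qed

lemma continuous_on_circle_square: "continuous_on {0<..<1} (\<lambda>r. circle_integral r (\<lambda>x. (u x)\<^sup>2))"
proof -
  have c: "continuous_on ({0<..<1} \<times> cbox 0 (2*pi)) (\<lambda>(r, \<theta>). (u (r * cos \<theta>, r * sin \<theta>))\<^sup>2 * r)"
    unfolding case_prod_beta
    by (intro continuous_intros continuous_on_compose2[OF u_cont]) (auto simp: B1_def norm_polar)
  have "continuous_on {0<..<1} (\<lambda>r. integral (cbox 0 (2*pi)) (\<lambda>\<theta>. (u (r * cos \<theta>, r * sin \<theta>))\<^sup>2 * r))"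
    by (rule integral_continuous_on_param[OF c])
  then show ?thesis
  proof (rule continuous_on_eq)
    fix r :: real assume r: "r \<in> {0<..<1}"
    have "continuous_on {0..2*pi} (\<lambda>\<theta>. (u (r * cos \<theta>, r * sin \<theta>))\<^sup>2 * r)"
      using r by (intro continuous_intros continuous_on_compose2[OF u_cont]) (auto simp: B1_def norm_polar)
    then have "set_integrable lborel {0..2*pi} (\<lambda>\<theta>. (u (r * cos \<theta>, r * sin \<theta>))\<^sup>2 * r)"
      unfolding set_integrable_def by (intro borel_integrable_compact compact_Icc)
    from set_borel_integral_eq_integral(2)[OF this]
    show "integral (cbox 0 (2*pi)) (\<lambda>\<theta>. (u (r * cos \<theta>, r * sin \<theta>))\<^sup>2 * r) = circle_integral r (\<lambda>x. (u x)\<^sup>2)"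
      unfolding circle_integral_def box_real by (rule sym)
  qed
qed

text \<open>Both sides depend continuously on the radius, so the set where they differ is open and
  null, hence empty. Validity at every radius is essential: the boundary term of \<open>Mfun\<close>
  is to be differentiated through this identity.\<close>

lemma circle_square_eq:
  assumes "0 < r" "r < 1"
  shows "r * circle_integral r (\<lambda>x. (u x)\<^sup>2) = (LINT x:ball 0 r|lborel. 2 * (u x * (G x \<bullet> x)) + 2 * (u x)\<^sup>2)"
proof -
  let ?h = "\<lambda>r. r * circle_integral r (\<lambda>x. (u x)\<^sup>2) - (LINT x:ball 0 r|lborel. 2 * (u x * (G x \<bullet> x)) + 2 * (u x)\<^sup>2)"
  have "continuous_on {0<..<1} ?h"
    by (intro continuous_intros continuous_on_circle_square
        continuous_on_subset[OF continuous_on_ball_integral[OF int_square_div]]) auto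
  then have "open ({0<..<1} \<inter> ?h -` (- {0}))"
    by (intro continuous_open_preimage) auto
  moreover have "AE r in lborel. r \<notin> {0<..<1} \<inter> ?h -` (- {0})"
    using AE_square
  proof eventually_elim
    case (elim r)
    have "?h r = 0" if r: "r \<in> {0<..<1}"
    proof -
      have "circle_integral r (\<lambda>x. (u x)\<^sup>2 * norm x) = circle_integral r (\<lambda>x. r * (u x)\<^sup>2)"
        using r by (intro circle_integral_cong) (auto simp: mult.commute)
      also have "\<dots> = r * circle_integral r (\<lambda>x. (u x)\<^sup>2)" by (rule circle_integral_cmult)
      finally show ?thesis using elim r by simp
    qed
    then show ?case by blast
  qed
  ultimately have e: "{0<..<1} \<inter> ?h -` (- {0}) = {}" by (rule open_null_empty)
  have "?h r = 0"
  proof (rule ccontr)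
    assume "?h r \<noteq> 0"
    then have "r \<in> {0<..<1} \<inter> ?h -` (- {0})" using assms by simp
    then show False unfolding e by simp
  qed
  then show ?thesis by simp
qed

theorem monotonicity_formula:
  "AE r in lborel. 0 < r \<and> r < 1 \<longrightarrow>
     (Mfun \<rho>p \<rho>m u G has_real_derivative
        2 / r^3 * circle_integral r (\<lambda>x. (G x \<bullet> ((1/r) *\<^sub>R x) - 3/2 * u x / r)\<^sup>2)) (at r)"
proof -
  let ?\<rho> = "rho_chi \<rho>p \<rho>m u"
  let ?E = "\<lambda>x. (norm (G x))\<^sup>2" and ?Y = "\<lambda>x. snd x * ?\<rho> x"
  let ?N = "\<lambda>x. ((x \<bullet> G x) / norm x)\<^sup>2" and ?D = "\<lambda>x. u x * ((x \<bullet> G x) / norm x)" and ?U = "\<lambda>x. (u x)\<^sup>2"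
  let ?W = "\<lambda>x. 2 * (u x * (G x \<bullet> x)) + 2 * (u x)\<^sup>2"
  have iEY: "set_integrable lborel B1 (\<lambda>x. ?E x - ?Y x)"
    by (intro set_integral_diff iG2 int_yrho)
  show ?thesis
    using AE_circle_integrable[OF iG2] AE_circle_integrable[OF int_yrho] AE_circle_integrable[OF int_radial_sq]
      AE_circle_integrable[OF int_u_radial] AE_circle_integrable[OF iu2]
      AE_inner_variation AE_energy
      ball_integral_has_derivative[OF iEY] ball_integral_has_derivative[OF int_square_div]
  proof eventually_elim
    case (elim r)
    show ?case
    proof
      assume r: "0 < r \<and> r < 1"
      define a b c d k where "a = circle_integral r ?E" and "b = circle_integral r ?N"
        and "c = circle_integral r ?Y" and "d = circle_integral r ?D" and "k = circle_integral r ?U"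
      define Ai Ci where "Ai = (LINT x:ball 0 r|lborel. ?E x)" and "Ci = (LINT x:ball 0 r|lborel. ?Y x)"
      note ci = elim(1-5)[rule_format, OF r]
      have ball: "ball 0 r \<subseteq> B1" using r by (auto simp: B1_def)
      have 1: "r * a - r * c - 2 * r * b = - 3 * Ci"
      proof -
        have "circle_integral r (\<lambda>x. (?E x - ?Y x - 2 * ?N x) * norm x)
            = circle_integral r (\<lambda>x. r * ?E x + (- r) * ?Y x + (- 2 * r) * ?N x)"
          using r by (intro circle_integral_cong) (auto simp: algebra_simps)
        also have "\<dots> = r * a - r * c - 2 * r * b"
          using circle_integral_linear[OF ci(1,2,3), of r "-r" "- 2 * r"] by (simp add: a_def b_def c_def)
        finally have "r * a - r * c - 2 * r * b = (LINT x:ball 0 r|lborel. - 3 * ?Y x)"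
          using elim(6)[rule_format, OF r] by (simp only:)
        also have "\<dots> = - 3 * Ci" unfolding Ci_def by (rule set_integral_mult_right)
        finally show ?thesis .
      qed
      \<comment> \<open>Green's identity eliminates the Dirichlet energy of the ball, so that beside
        the ball integral of y \<rho> only circle integrals remain.\<close>
      have 2: "d = Ai" using elim(7) r by (simp add: d_def Ai_def)
      have 3: "circle_integral r (\<lambda>x. ?E x - ?Y x) = a - c"
        using circle_integral_linear[OF ci(1,2,3), of 1 "-1" 0] by (simp add: a_def c_def)
      have 4: "circle_integral r ?W = 2 * r * d + 2 * k"
      proof -
        have "?W x = 2 * r * ?D x + 2 * ?U x + 0 * ?U x" if "norm x = r" for x
          using that r by (simp add: inner_commute)
        then have "circle_integral r ?W = circle_integral r (\<lambda>x. 2 * r * ?D x + 2 * ?U x + 0 * ?U x)"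
          using r by (intro circle_integral_cong) auto
        then show ?thesis
          using circle_integral_linear[OF ci(4,5,5), of "2 * r" 2 0] by (simp add: d_def k_def)
      qed
      have 5: "circle_integral r (\<lambda>x. (G x \<bullet> ((1/r) *\<^sub>R x) - 3/2 * u x / r)\<^sup>2) = b - 3 / r * d + 9 / (4 * r\<^sup>2) * k"
      proof -
        have "(G x \<bullet> ((1/r) *\<^sub>R x) - 3/2 * u x / r)\<^sup>2 = 1 * ?N x + (- 3 / r) * ?D x + 9 / (4 * r\<^sup>2) * ?U x" if "norm x = r" for x
          using circle_square_algebra[of "x \<bullet> G x" r "u x"] that by (simp add: inner_commute)
        then have "circle_integral r (\<lambda>x. (G x \<bullet> ((1/r) *\<^sub>R x) - 3/2 * u x / r)\<^sup>2)
            = circle_integral r (\<lambda>x. 1 * ?N x + (- 3 / r) * ?D x + 9 / (4 * r\<^sup>2) * ?U x)"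
          using r by (intro circle_integral_cong) auto
        then show ?thesis
          using circle_integral_linear[OF ci(3,4,5), of 1 "- 3 / r" "9 / (4 * r\<^sup>2)"] by (simp add: b_def d_def k_def)
      qed
      have 6: "(LINT x:ball 0 r|lborel. ?E x - ?Y x) = Ai - Ci"
        unfolding Ai_def Ci_def
        by (intro set_integral_diff set_integrable_subset[OF iG2 _ ball] set_integrable_subset[OF int_yrho _ ball]) auto
      have 7: "(LINT x:ball 0 r|lborel. ?W x) = r * k"
        using circle_square_eq r by (simp add: k_def)
      let ?A = "\<lambda>r. LINT x:ball 0 r|lborel. ?E x - ?Y x" and ?R = "\<lambda>r. LINT x:ball 0 r|lborel. ?W x"
      have dA: "(?A has_real_derivative a - c) (at r)" using elim(8) r 3 by simp
      have dR: "(?R has_real_derivative 2 * r * d + 2 * k) (at r)" using elim(9) r 4 by simp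
      \<comment> \<open>Both ball integrals are differentiable at r by Lebesgue differentiation; the
        inner variation \<open>1\<close> makes the derivative collapse to the expanded square
        \<open>5\<close>.\<close>
      have "((\<lambda>r. ?A r / r^3 - 3/2 * (?R r / r^5)) has_real_derivative
          2 / r^3 * circle_integral r (\<lambda>x. (G x \<bullet> ((1/r) *\<^sub>R x) - 3/2 * u x / r)\<^sup>2)) (at r)"
        using DERIV_energy_quotient[OF dA dR] energy_derivative_algebra[OF _ 1, of d k] r
        unfolding 5 6 7 2[symmetric] by simp
      \<comment> \<open>On all of (0, 1) \<open>Mfun\<close> coincides with this quotient of ball
        integrals, so it has the same derivative at r.\<close>
      then show "(Mfun \<rho>p \<rho>m u G has_real_derivative
          2 / r^3 * circle_integral r (\<lambda>x. (G x \<bullet> ((1/r) *\<^sub>R x) - 3/2 * u x / r)\<^sup>2)) (at r)"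
      proof (rule has_field_derivative_transform_within_open[where S="{0<..<1}"])
        fix s :: real assume s: "s \<in> {0<..<1}"
        then have "?R s = s * circle_integral s ?U" using circle_square_eq by simp
        then show "?A s / s^3 - 3/2 * (?R s / s^5) = Mfun \<rho>p \<rho>m u G s"
          using s by (simp add: Mfun_def power_numeral_reduce)
      qed (use r in auto)
    qed
  qed
qed

end

theorem theorem3p10:
  fixes \<rho>p \<rho>m :: real and u :: "pt \<Rightarrow> real" and G :: "pt \<Rightarrow> pt"
  assumes "\<rho>p > 0" and "\<rho>m > 0" and "\<rho>p \<noteq> \<rho>m"
    and "variational_solution \<rho>p \<rho>m u G"
  shows "AE r in lborel. 0 < r \<and> r < 1 \<longrightarrow>
           (Mfun \<rho>p \<rho>m u G has_real_derivative
              2 / r^3 * circle_integral r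
                 (\<lambda>x. (G x \<bullet> ((1/r) *\<^sub>R x) - 3/2 * u x / r)\<^sup>2)) (at r)"
proof -
  interpret variational \<rho>p \<rho>m u G by standard (rule assms(4))
  from ex_classical_gradient obtain F H1 H2 where
    "C1_grad P u F" "C1_grad P (\<lambda>x. fst (F x)) H1" "C1_grad P (\<lambda>x. snd (F x)) H2"
    by (elim exE conjE)
  then interpret variational_classical \<rho>p \<rho>m u G F H1 H2 by unfold_locales
  show ?thesis by (rule monotonicity_formula)
qed

end
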